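(* Let $P$ be the terminal symmetric operad (whose algebras in $\mathbf{Set}$ are commutative monoids), and let $\phi:F_\Sigma\Phi\to P$ be the generator of $P$ with $\Phi_0=\{e\}$, $\Phi_2=\{\,.\,\}$ and all other $\Phi_i$ empty. Let $\mathbf{SMC}$ be the category of symmetric monoidal categories and weak symmetric monoidal functors, and let $\mathbf{Wk}\text{-}P\text{-}\mathbf{Cat}$ be the category of $\phi$-weak $P$-categories (algebras for $\mathrm{Wk}_\phi(P)$) and weak morphisms between them. Then the functors $S:\mathbf{SMC}\to\mathbf{Wk}\text{-}P\text{-}\mathbf{Cat}$ and $R:\mathbf{Wk}\text{-}P\text{-}\mathbf{Cat}\to\mathbf{SMC}$ described in the context form an isomorphism of categories $\mathbf{SMC}\cong\mathbf{Wk}\text{-}P\text{-}\mathbf{Cat}$.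
   Context: Symmetric operads are operads of sets with compatible left $S_n$-actions; $F_\Sigma:\mathbf{Set}^{\mathbb N}\to\Sigma\text{-}\mathbf{Operad}$ is left adjoint to the forgetful functor. Elements of $(F_\Sigma\Phi)_n$ are $n$-ary permuted $\Phi$-trees $\sigma\cdot t$, with $t$ an $n$-ary planar tree built from a unit tree $|$ and the symbols $e$ (nullary), $.$ (binary), and $\sigma\in S_n$. A symmetric $\mathbf{Cat}$-operad is a symmetric operad with categories and functors in place of sets and functions (strict axioms); $D_*$ denotes the levelwise discrete category functor. $\mathrm{Wk}_\phi(P)$ is the symmetric $\mathbf{Cat}$-operad obtained by factorizing $D_*\phi:D_*F_\Sigma\Phi\to D_*P$ as a levelwise bijective-on-objects map followed by a levelwise full and faithful map; thus its 1-cells (objects) of arity $n$ are the elements of $(F_\Sigma\Phi)_n$, and there is exactly one 2-cell (arrow) between any two 1-cells of equal arity. An algebra is a category $\mathcal C$ with a map of symmetric $\mathbf{Cat}$-operads $\hat{(\ )}:\mathrm{Wk}_\phi(P)\to\mathrm{End}(\mathcal C)$, where $\mathrm{End}(\mathcal C)_n$ is the category of functors $\mathcal C^n\to\mathcal C$, with $(\sigma\cdot f)(A_1,\dots,A_n)=f(A_{\sigma1},\dots,A_{\sigma n})$. A weak morphism $(\mathcal C,\hat{(\ )})\to(\mathcal C',\check{(\ )})$ is a functor $F$ with isomorphisms $\psi_{q}:\check q(FA_1,\dots,FA_n)\to F\hat q(A_1,\dots,A_n)$, natural in the $n$-ary 1-cell $q$ and in the $A_i$, with $\psi_1=1$, $\psi_{q\circ(q_1,\dots,q_n)}=\psi_q\cdot\check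 q(\psi_{q_1},\dots,\psi_{q_n})$, and $(\psi_{\sigma\cdot q})_{A_1,\dots,A_n}=(\psi_q)_{A_{\sigma1},\dots,A_{\sigma n}}$. Symmetric monoidal categories $(\mathcal C,\otimes,I,\alpha,\lambda,\rho,\tau)$ (with $\alpha:A\otimes(B\otimes C)\to(A\otimes B)\otimes C$) and weak (i.e. strong) symmetric monoidal functors $(F,F_0,F_2)$, with invertible $F_0:I'\to FI$ and $F_2:FA\otimes'FB\to F(A\otimes B)$, are the classical ones. Functor $S$: for $M=(\mathcal C,\otimes,I,\alpha,\lambda,\rho,\tau)$, $SM$ is the algebra on $\mathcal C$ determined on 1-cells by $\hat{.}=\otimes$, $\hat e=I$, and sending each 2-cell $\tau_1\to\tau_2$ to the unique canonical natural isomorphism $\hat\tau_1\to\hat\tau_2$ supplied by Mac Lane's coherence theorem for symmetric monoidal categories. $S(F,F_0,F_2)=(F,\psi)$, where $\psi_{\sigma\cdot v}$ is the canonical natural isomorphism $(\sigma\cdot v)_N(FA_1,\dots,FA_n)\to F(\sigma\cdot v)_M(A_1,\dots,A_n)$ built from $F_0$ and $F_2$. Functor $R$: for an algebra $(\mathcal C,\hat{(\ )})$, $R(\mathcal C,\hat{(\ )})$ is $\mathcal C$ with $\otimes=\hat{.}$, $I=\hat e$, and $\alpha,\lambda,\rho,\tau$ the images under $\hat{(\ )}$ of the unique 2-cells $-.(-.-)\to(-.-).-$, $\ e.-\to-$, $\ -.e\to-$, $\ (-.-)\to(12)\cdot(-.-)$ respectively. $R(F,\psi)=(F,F_0,F_2)$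 with $F_0=\psi_{e}:\check e\to F\hat e$ and $F_2=\psi_{.}$. *)

theory Defs
  imports "HOL-Combinatorics.Permutations" "HOL-Library.FuncSet"
begin

text \<open>
  All structure maps are required to be \<open>undefined\<close> outside their domains, so that equality of
  records is equality of the structures they describe.
\<close>

record ('o, 'a) cat =
  Obj :: "'o set"
  Arr :: "'a set"
  Dom :: "'a \<Rightarrow> 'o"
  Cod :: "'a \<Rightarrow> 'o"
  Ide :: "'o \<Rightarrow> 'a"
  Cmp :: "'a \<Rightarrow> 'a \<Rightarrow> 'a"  \<comment> \<open>\<open>Cmp C g f\<close> is \<open>g\<close> after \<open>f\<close>\<close>

definition in_hom :: "('o, 'a) cat \<Rightarrow> 'a \<Rightarrow> 'o \<Rightarrow> 'o \<Rightarrow> bool" where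
  "in_hom C f A B \<longleftrightarrow> f \<in> Arr C \<and> Dom C f = A \<and> Cod C f = B"

definition composable :: "('o, 'a) cat \<Rightarrow> 'a \<Rightarrow> 'a \<Rightarrow> bool" where
  "composable C g f \<longleftrightarrow> g \<in> Arr C \<and> f \<in> Arr C \<and> Dom C g = Cod C f"

locale category =
  fixes C :: "('o, 'a) cat"
  assumes Dom_type: "Dom C \<in> Arr C \<rightarrow>\<^sub>E Obj C"
    and Cod_type: "Cod C \<in> Arr C \<rightarrow>\<^sub>E Obj C"
    and Ide_type: "Ide C \<in> Obj C \<rightarrow>\<^sub>E Arr C"
    and Ide_in_hom: "A \<in> Obj C \<Longrightarrow> in_hom C (Ide C A) A A"
    and Cmp_in_hom: "composable C g f \<Longrightarrow> in_hom C (Cmp C g f) (Dom C f) (Cod C g)"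
    and Cmp_undefined: "\<not> composable C g f \<Longrightarrow> Cmp C g f = undefined"
    and Cmp_Ide_right: "f \<in> Arr C \<Longrightarrow> Cmp C f (Ide C (Dom C f)) = f"
    and Cmp_Ide_left: "f \<in> Arr C \<Longrightarrow> Cmp C (Ide C (Cod C f)) f = f"
    and Cmp_assoc: "composable C h g \<Longrightarrow> composable C g f \<Longrightarrow>
      Cmp C h (Cmp C g f) = Cmp C (Cmp C h g) f"

definition inverse_arr :: "('o, 'a) cat \<Rightarrow> 'a \<Rightarrow> 'a \<Rightarrow> bool" where
  "inverse_arr C f g \<longleftrightarrow> in_hom C g (Cod C f) (Dom C f)
     \<and> Cmp C g f = Ide C (Dom C f) \<and> Cmp C f g = Ide C (Cod C f)"

definition is_iso :: "('o, 'a) cat \<Rightarrow> 'a \<Rightarrow> bool" where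
  "is_iso C f \<longleftrightarrow> f \<in> Arr C \<and> (\<exists>g. inverse_arr C f g)"

definition inv_arr :: "('o, 'a) cat \<Rightarrow> 'a \<Rightarrow> 'a" where
  "inv_arr C f = (THE g. inverse_arr C f g)"

record ('o, 'a, 'p, 'b) func =
  FO :: "'o \<Rightarrow> 'p"
  FA :: "'a \<Rightarrow> 'b"

locale cat_functor =
  fixes C :: "('o, 'a) cat" and D :: "('p, 'b) cat" and F :: "('o, 'a, 'p, 'b) func"
  assumes FO_type: "FO F \<in> Obj C \<rightarrow>\<^sub>E Obj D"
    and FA_type: "FA F \<in> Arr C \<rightarrow>\<^sub>E Arr D"
    and FA_in_hom: "f \<in> Arr C \<Longrightarrow> in_hom D (FA F f) (FO F (Dom C f)) (FO F (Cod C f))"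
    and FA_Ide: "A \<in> Obj C \<Longrightarrow> FA F (Ide C A) = Ide D (FO F A)"
    and FA_Cmp: "composable C g f \<Longrightarrow> FA F (Cmp C g f) = Cmp D (FA F g) (FA F f)"

definition id_func :: "('o, 'a) cat \<Rightarrow> ('o, 'a, 'o, 'a) func" where
  "id_func C = \<lparr>FO = (\<lambda>A\<in>Obj C. A), FA = (\<lambda>f\<in>Arr C. f)\<rparr>"

definition comp_func :: "('o, 'a) cat \<Rightarrow> ('p, 'b, 'q, 'c) func \<Rightarrow> ('o, 'a, 'p, 'b) func
    \<Rightarrow> ('o, 'a, 'q, 'c) func" where
  "comp_func C G F = \<lparr>FO = (\<lambda>A\<in>Obj C. FO G (FO F A)), FA = (\<lambda>f\<in>Arr C. FA G (FA F f))\<rparr>"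

definition isomorphism_of_categories :: "('o, 'a) cat \<Rightarrow> ('p, 'b) cat
    \<Rightarrow> ('o, 'a, 'p, 'b) func \<Rightarrow> ('p, 'b, 'o, 'a) func \<Rightarrow> bool" where
  "isomorphism_of_categories C D F G \<longleftrightarrow>
     category C \<and> category D \<and> cat_functor C D F \<and> cat_functor D C G
     \<and> comp_func C G F = id_func C \<and> comp_func D F G = id_func D"

record ('o, 'a, 'p, 'b) ntrans =
  NSrc :: "('o, 'a, 'p, 'b) func"
  NTgt :: "('o, 'a, 'p, 'b) func"
  NCmp :: "'o \<Rightarrow> 'b"

locale nat_trans =
  fixes C :: "('o, 'a) cat" and D :: "('p, 'b) cat" and \<eta> :: "('o, 'a, 'p, 'b) ntrans"
  assumes NSrc_functor: "cat_functor C D (NSrc \<eta>)"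
    and NTgt_functor: "cat_functor C D (NTgt \<eta>)"
    and NCmp_type: "NCmp \<eta> \<in> Obj C \<rightarrow>\<^sub>E Arr D"
    and NCmp_in_hom: "A \<in> Obj C \<Longrightarrow> in_hom D (NCmp \<eta> A) (FO (NSrc \<eta>) A) (FO (NTgt \<eta>) A)"
    and naturality: "f \<in> Arr C \<Longrightarrow>
      Cmp D (NCmp \<eta> (Cod C f)) (FA (NSrc \<eta>) f) = Cmp D (FA (NTgt \<eta>) f) (NCmp \<eta> (Dom C f))"

definition functor_cat :: "('o, 'a) cat \<Rightarrow> ('p, 'b) cat
    \<Rightarrow> (('o, 'a, 'p, 'b) func, ('o, 'a, 'p, 'b) ntrans) cat" where
  "functor_cat C D =
    \<lparr>Obj = {F. cat_functor C D F},
     Arr = {\<eta>. nat_trans C D \<eta>},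
     Dom = (\<lambda>\<eta>\<in>{\<eta>. nat_trans C D \<eta>}. NSrc \<eta>),
     Cod = (\<lambda>\<eta>\<in>{\<eta>. nat_trans C D \<eta>}. NTgt \<eta>),
     Ide = (\<lambda>F\<in>{F. cat_functor C D F}.
       \<lparr>NSrc = F, NTgt = F, NCmp = (\<lambda>A\<in>Obj C. Ide D (FO F A))\<rparr>),
     Cmp = (\<lambda>\<theta> \<eta>. if nat_trans C D \<theta> \<and> nat_trans C D \<eta> \<and> NSrc \<theta> = NTgt \<eta>
       then \<lparr>NSrc = NSrc \<eta>, NTgt = NTgt \<theta>,
             NCmp = (\<lambda>A\<in>Obj C. Cmp D (NCmp \<theta> A) (NCmp \<eta> A))\<rparr>
       else undefined)\<rparr>"

definition prod_cat :: "('o, 'a) cat \<Rightarrow> ('p, 'b) cat \<Rightarrow> ('o \<times> 'p, 'a \<times> 'b) cat" where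
  "prod_cat C D =
    \<lparr>Obj = Obj C \<times> Obj D,
     Arr = Arr C \<times> Arr D,
     Dom = (\<lambda>(f, g)\<in>Arr C \<times> Arr D. (Dom C f, Dom D g)),
     Cod = (\<lambda>(f, g)\<in>Arr C \<times> Arr D. (Cod C f, Cod D g)),
     Ide = (\<lambda>(A, B)\<in>Obj C \<times> Obj D. (Ide C A, Ide D B)),
     Cmp = (\<lambda>(f', g') (f, g). if composable C f' f \<and> composable D g' g
       then (Cmp C f' f, Cmp D g' g) else undefined)\<rparr>"

definition power_cat :: "('o, 'a) cat \<Rightarrow> nat \<Rightarrow> ('o list, 'a list) cat" where
  "power_cat C n =
    \<lparr>Obj = {As. length As = n \<and> set As \<subseteq> Obj C},
     Arr = {fs. length fs = n \<and> set fs \<subseteq> Arr C},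
     Dom = (\<lambda>fs\<in>{fs. length fs = n \<and> set fs \<subseteq> Arr C}. map (Dom C) fs),
     Cod = (\<lambda>fs\<in>{fs. length fs = n \<and> set fs \<subseteq> Arr C}. map (Cod C) fs),
     Ide = (\<lambda>As\<in>{As. length As = n \<and> set As \<subseteq> Obj C}. map (Ide C) As),
     Cmp = (\<lambda>gs fs. if length gs = n \<and> length fs = n \<and> list_all2 (composable C) gs fs
       then map2 (Cmp C) gs fs else undefined)\<rparr>"

text \<open>
  Arities, and the numbers permuted by an element of the symmetric group, are counted from 0:
  an element of \<open>S\<^sub>n\<close> is a function \<open>\<sigma>\<close> with \<open>\<sigma> permutes {..<n}\<close>.  The composite
  \<open>x \<circ> (x\<^sub>1, \<dots>, x\<^sub>n)\<close> with \<open>x\<^sub>i\<close> of arity \<open>k\<^sub>i\<close> is written \<open>comp [k\<^sub>1, \<dots>, k\<^sub>n] x [x\<^sub>1, \<dots>, x\<^sub>n]\<close>.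
  The records carry the data of an operad; the operads used below are given explicitly.
\<close>

record 'x sym_operad =
  Lvl :: "nat \<Rightarrow> 'x set"
  unitS :: 'x
  compS :: "nat list \<Rightarrow> 'x \<Rightarrow> 'x list \<Rightarrow> 'x"
  actS :: "nat \<Rightarrow> (nat \<Rightarrow> nat) \<Rightarrow> 'x \<Rightarrow> 'x"

record ('x, 'y) cat_operad =
  Lev :: "nat \<Rightarrow> ('x, 'y) cat"
  unitO :: 'x
  compO :: "nat list \<Rightarrow> 'x \<Rightarrow> 'x list \<Rightarrow> 'x"
  compA :: "nat list \<Rightarrow> 'y \<Rightarrow> 'y list \<Rightarrow> 'y"
  actO :: "nat \<Rightarrow> (nat \<Rightarrow> nat) \<Rightarrow> 'x \<Rightarrow> 'x"
  actA :: "nat \<Rightarrow> (nat \<Rightarrow> nat) \<Rightarrow> 'y \<Rightarrow> 'y"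

locale cat_operad_map =
  fixes Q :: "('x, 'y) cat_operad" and E :: "('z, 'w) cat_operad"
    and h :: "nat \<Rightarrow> ('x, 'y, 'z, 'w) func"
  assumes levelwise_functor: "cat_functor (Lev Q n) (Lev E n) (h n)"
    and preserves_unit: "FO (h 1) (unitO Q) = unitO E"
    and preserves_compO: "x \<in> Obj (Lev Q (length ks)) \<Longrightarrow>
      list_all2 (\<lambda>k x. x \<in> Obj (Lev Q k)) ks xs \<Longrightarrow>
      FO (h (sum_list ks)) (compO Q ks x xs) =
        compO E ks (FO (h (length ks)) x) (map2 (\<lambda>k. FO (h k)) ks xs)"
    and preserves_compA: "y \<in> Arr (Lev Q (length ks)) \<Longrightarrow>
      list_all2 (\<lambda>k y. y \<in> Arr (Lev Q k)) ks ys \<Longrightarrow>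
      FA (h (sum_list ks)) (compA Q ks y ys) =
        compA E ks (FA (h (length ks)) y) (map2 (\<lambda>k. FA (h k)) ks ys)"
    and preserves_actO: "x \<in> Obj (Lev Q n) \<Longrightarrow> \<sigma> permutes {..<n} \<Longrightarrow>
      FO (h n) (actO Q n \<sigma> x) = actO E n \<sigma> (FO (h n) x)"
    and preserves_actA: "y \<in> Arr (Lev Q n) \<Longrightarrow> \<sigma> permutes {..<n} \<Longrightarrow>
      FA (h n) (actA Q n \<sigma> y) = actA E n \<sigma> (FA (h n) y)"

text \<open>
  The factorization of \<open>D\<^sub>*\<phi> : D\<^sub>*Q \<rightarrow> D\<^sub>*P\<close> into a levelwise bijective-on-objects map followed by a
  levelwise full and faithful one: the hom-set from \<open>x\<close> to \<open>y\<close> is that of the discrete category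
  on \<open>P\<^sub>n\<close> from \<open>\<phi> x\<close> to \<open>\<phi> y\<close>, its only possible element being recorded as \<open>(x, y)\<close>.
\<close>

definition wk_level :: "'x sym_operad \<Rightarrow> (nat \<Rightarrow> 'x \<Rightarrow> 'p) \<Rightarrow> nat \<Rightarrow> ('x, 'x \<times> 'x) cat" where
  "wk_level Q \<phi> n =
    (let A = {(x, y). x \<in> Lvl Q n \<and> y \<in> Lvl Q n \<and> \<phi> n x = \<phi> n y} in
    \<lparr>Obj = Lvl Q n,
     Arr = A,
     Dom = (\<lambda>(x, y)\<in>A. x),
     Cod = (\<lambda>(x, y)\<in>A. y),
     Ide = (\<lambda>x\<in>Lvl Q n. (x, x)),
     Cmp = (\<lambda>g f. if g \<in> A \<and> f \<in> A \<and> fst g = snd f then (fst f, snd g) else undefined)\<rparr>)"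

definition Wk :: "'x sym_operad \<Rightarrow> (nat \<Rightarrow> 'x \<Rightarrow> 'p) \<Rightarrow> ('x, 'x \<times> 'x) cat_operad" where
  "Wk Q \<phi> =
    \<lparr>Lev = wk_level Q \<phi>,
     unitO = unitS Q,
     compO = compS Q,
     compA = (\<lambda>ks (x, y) es. (compS Q ks x (map fst es), compS Q ks y (map snd es))),
     actO = actS Q,
     actA = (\<lambda>n \<sigma> (x, y). (actS Q n \<sigma> x, actS Q n \<sigma> y))\<rparr>"

fun blocks :: "nat list \<Rightarrow> 'b list \<Rightarrow> 'b list list" where
  "blocks [] xs = []"
| "blocks (k # ks) xs = take k xs # blocks ks (drop k xs)"

text \<open>
  The endomorphism operad: \<open>f \<circ> (g\<^sub>1, \<dots>, g\<^sub>n)\<close> is the composite functor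
  \<open>f (g\<^sub>1 \<times> \<dots> \<times> g\<^sub>n)\<close>, on arrows horizontal composition of natural transformations, and
  \<open>(\<sigma> \<cdot> f)(A\<^sub>1, \<dots>, A\<^sub>n) = f(A\<^bsub>\<sigma>1\<^esub>, \<dots>, A\<^bsub>\<sigma>n\<^esub>)\<close>.
\<close>

definition end_compO :: "('o, 'a) cat \<Rightarrow> nat list \<Rightarrow> ('o list, 'a list, 'o, 'a) func
    \<Rightarrow> ('o list, 'a list, 'o, 'a) func list \<Rightarrow> ('o list, 'a list, 'o, 'a) func" where
  "end_compO C ks F Gs =
    \<lparr>FO = (\<lambda>As\<in>Obj (power_cat C (sum_list ks)). FO F (map2 FO Gs (blocks ks As))),
     FA = (\<lambda>fs\<in>Arr (power_cat C (sum_list ks)). FA F (map2 FA Gs (blocks ks fs)))\<rparr>"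

definition end_compA :: "('o, 'a) cat \<Rightarrow> nat list \<Rightarrow> ('o list, 'a list, 'o, 'a) ntrans
    \<Rightarrow> ('o list, 'a list, 'o, 'a) ntrans list \<Rightarrow> ('o list, 'a list, 'o, 'a) ntrans" where
  "end_compA C ks \<eta> \<theta>s =
    \<lparr>NSrc = end_compO C ks (NSrc \<eta>) (map NSrc \<theta>s),
     NTgt = end_compO C ks (NTgt \<eta>) (map NTgt \<theta>s),
     NCmp = (\<lambda>As\<in>Obj (power_cat C (sum_list ks)).
       Cmp C (NCmp \<eta> (map2 (\<lambda>\<theta>. FO (NTgt \<theta>)) \<theta>s (blocks ks As)))
             (FA (NSrc \<eta>) (map2 NCmp \<theta>s (blocks ks As))))\<rparr>"

definition end_actO :: "('o, 'a) cat \<Rightarrow> nat \<Rightarrow> (nat \<Rightarrow> nat)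
    \<Rightarrow> ('o list, 'a list, 'o, 'a) func \<Rightarrow> ('o list, 'a list, 'o, 'a) func" where
  "end_actO C n \<sigma> F =
    \<lparr>FO = (\<lambda>As\<in>Obj (power_cat C n). FO F (permute_list \<sigma> As)),
     FA = (\<lambda>fs\<in>Arr (power_cat C n). FA F (permute_list \<sigma> fs))\<rparr>"

definition end_actA :: "('o, 'a) cat \<Rightarrow> nat \<Rightarrow> (nat \<Rightarrow> nat)
    \<Rightarrow> ('o list, 'a list, 'o, 'a) ntrans \<Rightarrow> ('o list, 'a list, 'o, 'a) ntrans" where
  "end_actA C n \<sigma> \<eta> =
    \<lparr>NSrc = end_actO C n \<sigma> (NSrc \<eta>),
     NTgt = end_actO C n \<sigma> (NTgt \<eta>),
     NCmp = (\<lambda>As\<in>Obj (power_cat C n). NCmp \<eta> (permute_list \<sigma> As))\<rparr>"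

definition End :: "('o, 'a) cat
    \<Rightarrow> (('o list, 'a list, 'o, 'a) func, ('o list, 'a list, 'o, 'a) ntrans) cat_operad" where
  "End C =
    \<lparr>Lev = (\<lambda>n. functor_cat (power_cat C n) C),
     unitO = \<lparr>FO = (\<lambda>As\<in>Obj (power_cat C 1). hd As), FA = (\<lambda>fs\<in>Arr (power_cat C 1). hd fs)\<rparr>,
     compO = end_compO C,
     compA = end_compA C,
     actO = end_actO C,
     actA = end_actA C\<rparr>"

record ('x, 'y, 'o, 'a) alg =
  acat :: "('o, 'a) cat"
  hat :: "nat \<Rightarrow> ('x, 'y, ('o list, 'a list, 'o, 'a) func, ('o list, 'a list, 'o, 'a) ntrans) func"

definition algebra :: "('x, 'y) cat_operad \<Rightarrow> ('x, 'y, 'o, 'a) alg \<Rightarrow> bool" where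
  "algebra Q X \<longleftrightarrow> category (acat X) \<and> cat_operad_map Q (End (acat X)) (hat X)"

definition op1 :: "('x, 'y, 'o, 'a) alg \<Rightarrow> nat \<Rightarrow> 'x \<Rightarrow> ('o list, 'a list, 'o, 'a) func" where
  "op1 X n q = FO (hat X n) q"

definition op2 :: "('x, 'y, 'o, 'a) alg \<Rightarrow> nat \<Rightarrow> 'y \<Rightarrow> ('o list, 'a list, 'o, 'a) ntrans" where
  "op2 X n e = FA (hat X n) e"

record ('x, 'y, 'o, 'a) wmor =
  wsrc :: "('x, 'y, 'o, 'a) alg"
  wtgt :: "('x, 'y, 'o, 'a) alg"
  wfun :: "('o, 'a, 'o, 'a) func"
  wpsi :: "nat \<Rightarrow> 'x \<Rightarrow> 'o list \<Rightarrow> 'a"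

locale weak_morphism =
  fixes Q :: "('x, 'y) cat_operad" and m :: "('x, 'y, 'o, 'a) wmor"
  assumes src_algebra: "algebra Q (wsrc m)"
    and tgt_algebra: "algebra Q (wtgt m)"
    and wfun_functor: "cat_functor (acat (wsrc m)) (acat (wtgt m)) (wfun m)"
    and psi_extensional: "wpsi m n \<in> extensional (Obj (Lev Q n))"
      "q \<in> Obj (Lev Q n) \<Longrightarrow> wpsi m n q \<in> extensional (Obj (power_cat (acat (wsrc m)) n))"
    and psi_in_hom: "q \<in> Obj (Lev Q n) \<Longrightarrow> As \<in> Obj (power_cat (acat (wsrc m)) n) \<Longrightarrow>
      in_hom (acat (wtgt m)) (wpsi m n q As)
        (FO (op1 (wtgt m) n q) (map (FO (wfun m)) As)) (FO (wfun m) (FO (op1 (wsrc m) n q) As))"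
    and psi_iso: "q \<in> Obj (Lev Q n) \<Longrightarrow> As \<in> Obj (power_cat (acat (wsrc m)) n) \<Longrightarrow>
      is_iso (acat (wtgt m)) (wpsi m n q As)"
    and psi_natural_args: "q \<in> Obj (Lev Q n) \<Longrightarrow> fs \<in> Arr (power_cat (acat (wsrc m)) n) \<Longrightarrow>
      Cmp (acat (wtgt m))
        (wpsi m n q (map (Cod (acat (wsrc m))) fs)) (FA (op1 (wtgt m) n q) (map (FA (wfun m)) fs)) =
      Cmp (acat (wtgt m))
        (FA (wfun m) (FA (op1 (wsrc m) n q) fs)) (wpsi m n q (map (Dom (acat (wsrc m))) fs))"
    and psi_natural_cells: "e \<in> Arr (Lev Q n) \<Longrightarrow> As \<in> Obj (power_cat (acat (wsrc m)) n) \<Longrightarrow>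
      Cmp (acat (wtgt m))
        (wpsi m n (Cod (Lev Q n) e) As) (NCmp (op2 (wtgt m) n e) (map (FO (wfun m)) As)) =
      Cmp (acat (wtgt m))
        (FA (wfun m) (NCmp (op2 (wsrc m) n e) As)) (wpsi m n (Dom (Lev Q n) e) As)"
    and psi_unit: "A \<in> Obj (acat (wsrc m)) \<Longrightarrow>
      wpsi m 1 (unitO Q) [A] = Ide (acat (wtgt m)) (FO (wfun m) A)"
    and psi_comp: "q \<in> Obj (Lev Q (length ks)) \<Longrightarrow>
      list_all2 (\<lambda>k q'. q' \<in> Obj (Lev Q k)) ks qs \<Longrightarrow>
      As \<in> Obj (power_cat (acat (wsrc m)) (sum_list ks)) \<Longrightarrow>
      wpsi m (sum_list ks) (compO Q ks q qs) As =
      Cmp (acat (wtgt m))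
        (wpsi m (length ks) q
          (map2 (\<lambda>(k, q') Bs. FO (op1 (wsrc m) k q') Bs) (zip ks qs) (blocks ks As)))
        (FA (op1 (wtgt m) (length ks) q)
          (map2 (\<lambda>(k, q') Bs. wpsi m k q' Bs) (zip ks qs) (blocks ks As)))"
    and psi_act: "q \<in> Obj (Lev Q n) \<Longrightarrow> \<sigma> permutes {..<n} \<Longrightarrow>
      As \<in> Obj (power_cat (acat (wsrc m)) n) \<Longrightarrow>
      wpsi m n (actO Q n \<sigma> q) As = wpsi m n q (permute_list \<sigma> As)"

definition id_wmor :: "('x, 'y) cat_operad \<Rightarrow> ('x, 'y, 'o, 'a) alg \<Rightarrow> ('x, 'y, 'o, 'a) wmor" where
  "id_wmor Q X = \<lparr>wsrc = X, wtgt = X, wfun = id_func (acat X),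
     wpsi = (\<lambda>n. \<lambda>q\<in>Obj (Lev Q n). \<lambda>As\<in>Obj (power_cat (acat X) n).
       Ide (acat X) (FO (op1 X n q) As))\<rparr>"

definition comp_wmor :: "('x, 'y) cat_operad \<Rightarrow> ('x, 'y, 'o, 'a) wmor \<Rightarrow> ('x, 'y, 'o, 'a) wmor
    \<Rightarrow> ('x, 'y, 'o, 'a) wmor" where
  "comp_wmor Q m' m = \<lparr>wsrc = wsrc m, wtgt = wtgt m',
     wfun = comp_func (acat (wsrc m)) (wfun m') (wfun m),
     wpsi = (\<lambda>n. \<lambda>q\<in>Obj (Lev Q n). \<lambda>As\<in>Obj (power_cat (acat (wsrc m)) n).
       Cmp (acat (wtgt m')) (FA (wfun m') (wpsi m n q As))
         (wpsi m' n q (map (FO (wfun m)) As)))\<rparr>"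

definition Weak_Alg :: "('x, 'y) cat_operad
    \<Rightarrow> (('x, 'y, 'o, 'a) alg, ('x, 'y, 'o, 'a) wmor) cat" where
  "Weak_Alg Q =
    \<lparr>Obj = {X. algebra Q X},
     Arr = {m. weak_morphism Q m},
     Dom = (\<lambda>m\<in>{m. weak_morphism Q m}. wsrc m),
     Cod = (\<lambda>m\<in>{m. weak_morphism Q m}. wtgt m),
     Ide = (\<lambda>X\<in>{X. algebra Q X}. id_wmor Q X),
     Cmp = (\<lambda>m' m. if weak_morphism Q m' \<and> weak_morphism Q m \<and> wsrc m' = wtgt m
       then comp_wmor Q m' m else undefined)\<rparr>"

datatype tree = Unit | Nul | Bin tree tree

fun arity :: "tree \<Rightarrow> nat" where
  "arity Unit = 1"
| "arity Nul = 0"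
| "arity (Bin s t) = arity s + arity t"

text \<open>\<open>(\<sigma>, t)\<close> stands for \<open>\<sigma> \<cdot> t\<close>.\<close>

type_synonym ptree = "(nat \<Rightarrow> nat) \<times> tree"

fun graft :: "tree \<Rightarrow> tree list \<Rightarrow> tree" where
  "graft Unit ts = hd ts"
| "graft Nul ts = Nul"
| "graft (Bin s t) ts = Bin (graft s (take (arity s) ts)) (graft t (drop (arity s) ts))"

text \<open>
  Equivariance forces
  \<open>(\<sigma> \<cdot> t) \<circ> (\<tau>\<^sub>1 \<cdot> t\<^sub>1, \<dots>, \<tau>\<^sub>n \<cdot> t\<^sub>n) = \<rho> \<cdot> (t \<circ> (t\<^bsub>\<sigma>1\<^esub>, \<dots>, t\<^bsub>\<sigma>n\<^esub>))\<close>: leaf \<open>r\<close> of the copy of \<open>t\<^bsub>\<sigma>j\<^esub>\<close>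
  grafted at leaf \<open>j\<close> receives argument number \<open>\<tau>\<^bsub>\<sigma>j\<^esub> r\<close> of the block of arguments number \<open>\<sigma>j\<close>.
\<close>

definition comp_perm :: "nat list \<Rightarrow> (nat \<Rightarrow> nat) \<Rightarrow> (nat \<Rightarrow> nat) list \<Rightarrow> nat \<Rightarrow> nat" where
  "comp_perm ks \<sigma> \<tau>s =
    (let inputs = concat (map (\<lambda>j. map (\<lambda>r. sum_list (take (\<sigma> j) ks) + (\<tau>s ! \<sigma> j) r)
                                      [0..<ks ! \<sigma> j])
                             [0..<length ks])
     in (\<lambda>i. if i < sum_list ks then inputs ! i else i))"

definition free_operad :: "ptree sym_operad" where
  "free_operad =
    \<lparr>Lvl = (\<lambda>n. {(\<sigma>, t). arity t = n \<and> \<sigma> permutes {..<n}}),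
     unitS = (id, Unit),
     compS = (\<lambda>ks (\<sigma>, t) xs.
       (comp_perm ks \<sigma> (map fst xs), graft t (permute_list \<sigma> (map snd xs)))),
     actS = (\<lambda>n \<pi> (\<sigma>, t). (\<pi> \<circ> \<sigma>, t))\<rparr>"

definition terminal_operad :: "unit sym_operad" where
  "terminal_operad =
    \<lparr>Lvl = (\<lambda>n. UNIV), unitS = (), compS = (\<lambda>ks x xs. ()), actS = (\<lambda>n \<sigma> x. ())\<rparr>"

definition \<phi>_gen :: "nat \<Rightarrow> ptree \<Rightarrow> unit" where
  "\<phi>_gen n q = ()"

definition WkP :: "(ptree, ptree \<times> ptree) cat_operad" where
  "WkP = Wk free_operad \<phi>_gen"

type_synonym ('o, 'a) wkp_alg = "(ptree, ptree \<times> ptree, 'o, 'a) alg"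
type_synonym ('o, 'a) wkp_mor = "(ptree, ptree \<times> ptree, 'o, 'a) wmor"

definition WkPCat :: "(('o, 'a) wkp_alg, ('o, 'a) wkp_mor) cat" where
  "WkPCat = Weak_Alg WkP"

record ('o, 'a) smc =
  mcat :: "('o, 'a) cat"
  tensor :: "('o \<times> 'o, 'a \<times> 'a, 'o, 'a) func"
  munit :: 'o
  massoc :: "'o \<times> 'o \<times> 'o \<Rightarrow> 'a"  \<comment> \<open>\<open>A \<otimes> (B \<otimes> C) \<rightarrow> (A \<otimes> B) \<otimes> C\<close>\<close>
  mlunit :: "'o \<Rightarrow> 'a"  \<comment> \<open>\<open>I \<otimes> A \<rightarrow> A\<close>\<close>
  mrunit :: "'o \<Rightarrow> 'a"  \<comment> \<open>\<open>A \<otimes> I \<rightarrow> A\<close>\<close>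
  mswap :: "'o \<times> 'o \<Rightarrow> 'a"  \<comment> \<open>\<open>A \<otimes> B \<rightarrow> B \<otimes> A\<close>\<close>

abbreviation tenO :: "'o \<Rightarrow> ('o, 'a) smc \<Rightarrow> 'o \<Rightarrow> 'o" ("(_ \<otimes>\<^bsub>_\<^esub>/ _)" [71, 0, 70] 70) where
  "A \<otimes>\<^bsub>M\<^esub> B \<equiv> FO (tensor M) (A, B)"

abbreviation tenA :: "'a \<Rightarrow> ('o, 'a) smc \<Rightarrow> 'a \<Rightarrow> 'a" ("(_ \<odot>\<^bsub>_\<^esub>/ _)" [71, 0, 70] 70) where
  "f \<odot>\<^bsub>M\<^esub> g \<equiv> FA (tensor M) (f, g)"

abbreviation mcmp :: "'a \<Rightarrow> ('o, 'a) smc \<Rightarrow> 'a \<Rightarrow> 'a" ("(_ \<cdot>\<^bsub>_\<^esub>/ _)" [56, 0, 55] 55) where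
  "g \<cdot>\<^bsub>M\<^esub> f \<equiv> Cmp (mcat M) g f"

abbreviation "mobj M \<equiv> Obj (mcat M)"
abbreviation "marr M \<equiv> Arr (mcat M)"
abbreviation "mdom M \<equiv> Dom (mcat M)"
abbreviation "mcod M \<equiv> Cod (mcat M)"
abbreviation "mide M \<equiv> Ide (mcat M)"

locale symmetric_monoidal_category =
  fixes M :: "('o, 'a) smc"
  assumes mcat_category: "category (mcat M)"
    and tensor_functor: "cat_functor (prod_cat (mcat M) (mcat M)) (mcat M) (tensor M)"
    and munit_obj: "munit M \<in> mobj M"
    and m_extensional: "massoc M \<in> extensional (mobj M \<times> mobj M \<times> mobj M)"
      "mlunit M \<in> extensional (mobj M)" "mrunit M \<in> extensional (mobj M)"
      "mswap M \<in> extensional (mobj M \<times> mobj M)"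
    and assoc_in_hom: "\<lbrakk>X \<in> mobj M; Y \<in> mobj M; Z \<in> mobj M\<rbrakk> \<Longrightarrow>
      in_hom (mcat M) (massoc M (X, Y, Z)) (X \<otimes>\<^bsub>M\<^esub> (Y \<otimes>\<^bsub>M\<^esub> Z)) ((X \<otimes>\<^bsub>M\<^esub> Y) \<otimes>\<^bsub>M\<^esub> Z)"
    and lunit_in_hom: "X \<in> mobj M \<Longrightarrow> in_hom (mcat M) (mlunit M X) (munit M \<otimes>\<^bsub>M\<^esub> X) X"
    and runit_in_hom: "X \<in> mobj M \<Longrightarrow> in_hom (mcat M) (mrunit M X) (X \<otimes>\<^bsub>M\<^esub> munit M) X"
    and swap_in_hom: "\<lbrakk>X \<in> mobj M; Y \<in> mobj M\<rbrakk> \<Longrightarrow>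
      in_hom (mcat M) (mswap M (X, Y)) (X \<otimes>\<^bsub>M\<^esub> Y) (Y \<otimes>\<^bsub>M\<^esub> X)"
    and assoc_iso: "\<lbrakk>X \<in> mobj M; Y \<in> mobj M; Z \<in> mobj M\<rbrakk> \<Longrightarrow> is_iso (mcat M) (massoc M (X, Y, Z))"
    and lunit_iso: "X \<in> mobj M \<Longrightarrow> is_iso (mcat M) (mlunit M X)"
    and runit_iso: "X \<in> mobj M \<Longrightarrow> is_iso (mcat M) (mrunit M X)"
    and swap_iso: "\<lbrakk>X \<in> mobj M; Y \<in> mobj M\<rbrakk> \<Longrightarrow> is_iso (mcat M) (mswap M (X, Y))"
    and assoc_natural: "\<lbrakk>f \<in> marr M; g \<in> marr M; h \<in> marr M\<rbrakk> \<Longrightarrow>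
      massoc M (mcod M f, mcod M g, mcod M h) \<cdot>\<^bsub>M\<^esub> (f \<odot>\<^bsub>M\<^esub> (g \<odot>\<^bsub>M\<^esub> h)) =
      ((f \<odot>\<^bsub>M\<^esub> g) \<odot>\<^bsub>M\<^esub> h) \<cdot>\<^bsub>M\<^esub> massoc M (mdom M f, mdom M g, mdom M h)"
    and lunit_natural: "f \<in> marr M \<Longrightarrow>
      mlunit M (mcod M f) \<cdot>\<^bsub>M\<^esub> (mide M (munit M) \<odot>\<^bsub>M\<^esub> f) = f \<cdot>\<^bsub>M\<^esub> mlunit M (mdom M f)"
    and runit_natural: "f \<in> marr M \<Longrightarrow>
      mrunit M (mcod M f) \<cdot>\<^bsub>M\<^esub> (f \<odot>\<^bsub>M\<^esub> mide M (munit M)) = f \<cdot>\<^bsub>M\<^esub> mrunit M (mdom M f)"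
    and swap_natural: "\<lbrakk>f \<in> marr M; g \<in> marr M\<rbrakk> \<Longrightarrow>
      mswap M (mcod M f, mcod M g) \<cdot>\<^bsub>M\<^esub> (f \<odot>\<^bsub>M\<^esub> g) =
      (g \<odot>\<^bsub>M\<^esub> f) \<cdot>\<^bsub>M\<^esub> mswap M (mdom M f, mdom M g)"
    and pentagon: "\<lbrakk>W \<in> mobj M; X \<in> mobj M; Y \<in> mobj M; Z \<in> mobj M\<rbrakk> \<Longrightarrow>
      massoc M (W \<otimes>\<^bsub>M\<^esub> X, Y, Z) \<cdot>\<^bsub>M\<^esub> massoc M (W, X, Y \<otimes>\<^bsub>M\<^esub> Z) =
      (massoc M (W, X, Y) \<odot>\<^bsub>M\<^esub> mide M Z) \<cdot>\<^bsub>M\<^esub> massoc M (W, X \<otimes>\<^bsub>M\<^esub> Y, Z)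
        \<cdot>\<^bsub>M\<^esub> (mide M W \<odot>\<^bsub>M\<^esub> massoc M (X, Y, Z))"
    and triangle: "\<lbrakk>X \<in> mobj M; Z \<in> mobj M\<rbrakk> \<Longrightarrow>
      (mrunit M X \<odot>\<^bsub>M\<^esub> mide M Z) \<cdot>\<^bsub>M\<^esub> massoc M (X, munit M, Z) = mide M X \<odot>\<^bsub>M\<^esub> mlunit M Z"
    and unit_unit: "mlunit M (munit M) = mrunit M (munit M)"
    and symmetry: "\<lbrakk>X \<in> mobj M; Y \<in> mobj M\<rbrakk> \<Longrightarrow>
      mswap M (Y, X) \<cdot>\<^bsub>M\<^esub> mswap M (X, Y) = mide M (X \<otimes>\<^bsub>M\<^esub> Y)"
    and unit_symmetry: "X \<in> mobj M \<Longrightarrow> mlunit M X \<cdot>\<^bsub>M\<^esub> mswap M (X, munit M) = mrunit M X"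
    and hexagon: "\<lbrakk>X \<in> mobj M; Y \<in> mobj M; Z \<in> mobj M\<rbrakk> \<Longrightarrow>
      massoc M (Z, X, Y) \<cdot>\<^bsub>M\<^esub> mswap M (X \<otimes>\<^bsub>M\<^esub> Y, Z) \<cdot>\<^bsub>M\<^esub> massoc M (X, Y, Z) =
      (mswap M (X, Z) \<odot>\<^bsub>M\<^esub> mide M Y) \<cdot>\<^bsub>M\<^esub> massoc M (X, Z, Y)
        \<cdot>\<^bsub>M\<^esub> (mide M X \<odot>\<^bsub>M\<^esub> mswap M (Y, Z))"

record ('o, 'a) smf =
  msrc :: "('o, 'a) smc"
  mtgt :: "('o, 'a) smc"
  mfun :: "('o, 'a, 'o, 'a) func"
  mF0 :: 'a
  mF2 :: "'o \<times> 'o \<Rightarrow> 'a"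

abbreviation "smO m \<equiv> FO (mfun m)"
abbreviation "smA m \<equiv> FA (mfun m)"

locale weak_symmetric_monoidal_functor =
  fixes m :: "('o, 'a) smf" and M N :: "('o, 'a) smc"
  assumes src_smc: "symmetric_monoidal_category M"
    and tgt_smc: "symmetric_monoidal_category N"
    and src_tgt: "msrc m = M" "mtgt m = N"
    and mfun_functor: "cat_functor (mcat M) (mcat N) (mfun m)"
    and F2_extensional: "mF2 m \<in> extensional (mobj M \<times> mobj M)"
    and F0_in_hom: "in_hom (mcat N) (mF0 m) (munit N) (smO m (munit M))"
    and F0_iso: "is_iso (mcat N) (mF0 m)"
    and F2_in_hom: "\<lbrakk>X \<in> mobj M; Y \<in> mobj M\<rbrakk> \<Longrightarrow>
      in_hom (mcat N) (mF2 m (X, Y)) (smO m X \<otimes>\<^bsub>N\<^esub> smO m Y) (smO m (X \<otimes>\<^bsub>M\<^esub> Y))"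
    and F2_iso: "\<lbrakk>X \<in> mobj M; Y \<in> mobj M\<rbrakk> \<Longrightarrow> is_iso (mcat N) (mF2 m (X, Y))"
    and F2_natural: "\<lbrakk>f \<in> marr M; g \<in> marr M\<rbrakk> \<Longrightarrow>
      mF2 m (mcod M f, mcod M g) \<cdot>\<^bsub>N\<^esub> (smA m f \<odot>\<^bsub>N\<^esub> smA m g) =
      smA m (f \<odot>\<^bsub>M\<^esub> g) \<cdot>\<^bsub>N\<^esub> mF2 m (mdom M f, mdom M g)"
    and F_assoc: "\<lbrakk>X \<in> mobj M; Y \<in> mobj M; Z \<in> mobj M\<rbrakk> \<Longrightarrow>
      smA m (massoc M (X, Y, Z)) \<cdot>\<^bsub>N\<^esub> mF2 m (X, Y \<otimes>\<^bsub>M\<^esub> Z)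
        \<cdot>\<^bsub>N\<^esub> (mide N (smO m X) \<odot>\<^bsub>N\<^esub> mF2 m (Y, Z)) =
      mF2 m (X \<otimes>\<^bsub>M\<^esub> Y, Z) \<cdot>\<^bsub>N\<^esub> (mF2 m (X, Y) \<odot>\<^bsub>N\<^esub> mide N (smO m Z))
        \<cdot>\<^bsub>N\<^esub> massoc N (smO m X, smO m Y, smO m Z)"
    and F_lunit: "X \<in> mobj M \<Longrightarrow>
      smA m (mlunit M X) \<cdot>\<^bsub>N\<^esub> mF2 m (munit M, X) \<cdot>\<^bsub>N\<^esub> (mF0 m \<odot>\<^bsub>N\<^esub> mide N (smO m X)) =
      mlunit N (smO m X)"
    and F_runit: "X \<in> mobj M \<Longrightarrow>
      smA m (mrunit M X) \<cdot>\<^bsub>N\<^esub> mF2 m (X, munit M) \<cdot>\<^bsub>N\<^esub> (mide N (smO m X) \<odot>\<^bsub>N\<^esub> mF0 m) =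
      mrunit N (smO m X)"
    and F_swap: "\<lbrakk>X \<in> mobj M; Y \<in> mobj M\<rbrakk> \<Longrightarrow>
      smA m (mswap M (X, Y)) \<cdot>\<^bsub>N\<^esub> mF2 m (X, Y) =
      mF2 m (Y, X) \<cdot>\<^bsub>N\<^esub> mswap N (smO m X, smO m Y)"

abbreviation "is_smf m \<equiv> weak_symmetric_monoidal_functor m (msrc m) (mtgt m)"

definition id_smf :: "('o, 'a) smc \<Rightarrow> ('o, 'a) smf" where
  "id_smf M = \<lparr>msrc = M, mtgt = M, mfun = id_func (mcat M),
     mF0 = Ide (mcat M) (munit M),
     mF2 = (\<lambda>(A, B)\<in>Obj (mcat M) \<times> Obj (mcat M). Ide (mcat M) (A \<otimes>\<^bsub>M\<^esub> B))\<rparr>"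

definition comp_smf :: "('o, 'a) smf \<Rightarrow> ('o, 'a) smf \<Rightarrow> ('o, 'a) smf" where
  "comp_smf m' m =
    (let C = mcat (msrc m); E = mcat (mtgt m'); F = mfun m; G = mfun m' in
    \<lparr>msrc = msrc m, mtgt = mtgt m', mfun = comp_func C G F,
     mF0 = Cmp E (FA G (mF0 m)) (mF0 m'),
     mF2 = (\<lambda>(A, B)\<in>Obj C \<times> Obj C.
       Cmp E (FA G (mF2 m (A, B))) (mF2 m' (FO F A, FO F B)))\<rparr>)"

text \<open>
  As usual for a category of small categories, the types \<open>'o\<close> and \<open>'a\<close> bound the size of the
  categories involved: objects and arrows are drawn from arbitrary subsets of them.  An arrow of
  the category records its source and target.
\<close>

definition SMC :: "(('o, 'a) smc, ('o, 'a) smf) cat" where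
  "SMC =
    \<lparr>Obj = {M. symmetric_monoidal_category M},
     Arr = {m. is_smf m},
     Dom = (\<lambda>m\<in>{m. is_smf m}. msrc m),
     Cod = (\<lambda>m\<in>{m. is_smf m}. mtgt m),
     Ide = (\<lambda>M\<in>{M. symmetric_monoidal_category M}. id_smf M),
     Cmp = (\<lambda>m' m. if is_smf m' \<and> is_smf m
         \<and> msrc m' = mtgt m
       then comp_smf m' m else undefined)\<rparr>"

text \<open>
  Canonical maps are indexed by formal words in variables \<open>0, \<dots>, n - 1\<close> rather than by the functors
  these denote, since different words may denote the same functor.
\<close>

datatype word = WVar nat | WNul | WBin word word

fun wvars :: "word \<Rightarrow> nat set" where
  "wvars (WVar i) = {i}"
| "wvars WNul = {}"
| "wvars (WBin u v) = wvars u \<union> wvars v"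

fun wobj :: "('o, 'a) smc \<Rightarrow> word \<Rightarrow> 'o list \<Rightarrow> 'o" where
  "wobj M (WVar i) As = As ! i"
| "wobj M WNul As = munit M"
| "wobj M (WBin u v) As = wobj M u As \<otimes>\<^bsub>M\<^esub> wobj M v As"

inductive canonical :: "('o, 'a) smc \<Rightarrow> nat \<Rightarrow> word \<Rightarrow> word \<Rightarrow> ('o list \<Rightarrow> 'a) \<Rightarrow> bool"
  for M n where
  can_id: "wvars u \<subseteq> {..<n} \<Longrightarrow>
    canonical M n u u (\<lambda>As\<in>Obj (power_cat (mcat M) n). Ide (mcat M) (wobj M u As))"
| can_assoc: "wvars u \<union> wvars v \<union> wvars w \<subseteq> {..<n} \<Longrightarrow>
    canonical M n (WBin u (WBin v w)) (WBin (WBin u v) w)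
      (\<lambda>As\<in>Obj (power_cat (mcat M) n). massoc M (wobj M u As, wobj M v As, wobj M w As))"
| can_lunit: "wvars u \<subseteq> {..<n} \<Longrightarrow>
    canonical M n (WBin WNul u) u (\<lambda>As\<in>Obj (power_cat (mcat M) n). mlunit M (wobj M u As))"
| can_runit: "wvars u \<subseteq> {..<n} \<Longrightarrow>
    canonical M n (WBin u WNul) u (\<lambda>As\<in>Obj (power_cat (mcat M) n). mrunit M (wobj M u As))"
| can_swap: "wvars u \<union> wvars v \<subseteq> {..<n} \<Longrightarrow>
    canonical M n (WBin u v) (WBin v u)
      (\<lambda>As\<in>Obj (power_cat (mcat M) n). mswap M (wobj M u As, wobj M v As))"
| can_inv: "canonical M n u v \<eta> \<Longrightarrow>
    canonical M n v u (\<lambda>As\<in>Obj (power_cat (mcat M) n). inv_arr (mcat M) (\<eta> As))"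
| can_comp: "canonical M n u v \<eta> \<Longrightarrow> canonical M n v w \<theta> \<Longrightarrow>
    canonical M n u w (\<lambda>As\<in>Obj (power_cat (mcat M) n). Cmp (mcat M) (\<theta> As) (\<eta> As))"
| can_tensor: "canonical M n u u' \<eta> \<Longrightarrow> canonical M n v v' \<theta> \<Longrightarrow>
    canonical M n (WBin u v) (WBin u' v')
      (\<lambda>As\<in>Obj (power_cat (mcat M) n). \<eta> As \<odot>\<^bsub>M\<^esub> \<theta> As)"

fun label :: "tree \<Rightarrow> nat list \<Rightarrow> word" where
  "label Unit ls = WVar (hd ls)"
| "label Nul ls = WNul"
| "label (Bin s t) ls = WBin (label s (take (arity s) ls)) (label t (drop (arity s) ls))"

definition word_of :: "ptree \<Rightarrow> word" where
  "word_of = (\<lambda>(\<sigma>, t). label t (map \<sigma> [0..<arity t]))"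

fun tree_obj :: "('o, 'a) smc \<Rightarrow> tree \<Rightarrow> 'o list \<Rightarrow> 'o" where
  "tree_obj M Unit As = hd As"
| "tree_obj M Nul As = munit M"
| "tree_obj M (Bin s t) As =
    tree_obj M s (take (arity s) As) \<otimes>\<^bsub>M\<^esub> tree_obj M t (drop (arity s) As)"

fun tree_arr :: "('o, 'a) smc \<Rightarrow> tree \<Rightarrow> 'a list \<Rightarrow> 'a" where
  "tree_arr M Unit fs = hd fs"
| "tree_arr M Nul fs = Ide (mcat M) (munit M)"
| "tree_arr M (Bin s t) fs =
    tree_arr M s (take (arity s) fs) \<odot>\<^bsub>M\<^esub> tree_arr M t (drop (arity s) fs)"

definition interp :: "('o, 'a) smc \<Rightarrow> ptree \<Rightarrow> ('o list, 'a list, 'o, 'a) func" where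
  "interp M = (\<lambda>(\<sigma>, t). end_actO (mcat M) (arity t) \<sigma>
     \<lparr>FO = (\<lambda>As\<in>Obj (power_cat (mcat M) (arity t)). tree_obj M t As),
      FA = (\<lambda>fs\<in>Arr (power_cat (mcat M) (arity t)). tree_arr M t fs)\<rparr>)"

definition canonical_iso :: "('o, 'a) smc \<Rightarrow> nat \<Rightarrow> ptree \<Rightarrow> ptree
    \<Rightarrow> ('o list, 'a list, 'o, 'a) ntrans" where
  "canonical_iso M n x y =
    (THE \<eta>. in_hom (functor_cat (power_cat (mcat M) n) (mcat M)) \<eta> (interp M x) (interp M y)
       \<and> canonical M n (word_of x) (word_of y) (NCmp \<eta>))"

definition S_obj :: "('o, 'a) smc \<Rightarrow> ('o, 'a) wkp_alg" where
  "S_obj M = \<lparr>acat = mcat M,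
     hat = (\<lambda>n. \<lparr>FO = (\<lambda>x\<in>Obj (Lev WkP n). interp M x),
                 FA = (\<lambda>(x, y)\<in>Arr (Lev WkP n). canonical_iso M n x y)\<rparr>)\<rparr>"

fun tree_psi :: "('o, 'a) smf \<Rightarrow> tree \<Rightarrow> 'o list \<Rightarrow> 'a" where
  "tree_psi m Unit As = Ide (mcat (mtgt m)) (FO (mfun m) (hd As))"
| "tree_psi m Nul As = mF0 m"
| "tree_psi m (Bin s t) As =
    mF2 m (tree_obj (msrc m) s (take (arity s) As), tree_obj (msrc m) t (drop (arity s) As))
      \<cdot>\<^bsub>mtgt m\<^esub> (tree_psi m s (take (arity s) As) \<odot>\<^bsub>mtgt m\<^esub> tree_psi m t (drop (arity s) As))"

definition S_arr :: "('o, 'a) smf \<Rightarrow> ('o, 'a) wkp_mor" where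
  "S_arr m = \<lparr>wsrc = S_obj (msrc m), wtgt = S_obj (mtgt m), wfun = mfun m,
     wpsi = (\<lambda>n. \<lambda>(\<sigma>, t)\<in>Obj (Lev WkP n). \<lambda>As\<in>Obj (power_cat (mcat (msrc m)) n).
       tree_psi m t (permute_list \<sigma> As))\<rparr>"

definition S_functor :: "(('o, 'a) smc, ('o, 'a) smf, ('o, 'a) wkp_alg, ('o, 'a) wkp_mor) func" where
  "S_functor = \<lparr>FO = (\<lambda>M\<in>Obj SMC. S_obj M), FA = (\<lambda>m\<in>Arr SMC. S_arr m)\<rparr>"

abbreviation planar :: "tree \<Rightarrow> ptree" where
  "planar t \<equiv> (id, t)"

definition R_obj :: "('o, 'a) wkp_alg \<Rightarrow> ('o, 'a) smc" where
  "R_obj X = (let C = acat X in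
    \<lparr>mcat = C,
     tensor =
       \<lparr>FO = (\<lambda>(A, B)\<in>Obj C \<times> Obj C. FO (op1 X 2 (planar (Bin Unit Unit))) [A, B]),
        FA = (\<lambda>(f, g)\<in>Arr C \<times> Arr C. FA (op1 X 2 (planar (Bin Unit Unit))) [f, g])\<rparr>,
     munit = FO (op1 X 0 (planar Nul)) [],
     massoc = (\<lambda>(A, B, D)\<in>Obj C \<times> Obj C \<times> Obj C.
       NCmp (op2 X 3 (planar (Bin Unit (Bin Unit Unit)), planar (Bin (Bin Unit Unit) Unit)))
         [A, B, D]),
     mlunit = (\<lambda>A\<in>Obj C. NCmp (op2 X 1 (planar (Bin Nul Unit), planar Unit)) [A]),
     mrunit = (\<lambda>A\<in>Obj C. NCmp (op2 X 1 (planar (Bin Unit Nul), planar Unit)) [A]),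
     mswap = (\<lambda>(A, B)\<in>Obj C \<times> Obj C.
       NCmp (op2 X 2 (planar (Bin Unit Unit), (transpose 0 1, Bin Unit Unit))) [A, B])\<rparr>)"

definition R_arr :: "('o, 'a) wkp_mor \<Rightarrow> ('o, 'a) smf" where
  "R_arr m = (let C = acat (wsrc m) in
    \<lparr>msrc = R_obj (wsrc m), mtgt = R_obj (wtgt m), mfun = wfun m,
     mF0 = wpsi m 0 (planar Nul) [],
     mF2 = (\<lambda>(A, B)\<in>Obj C \<times> Obj C. wpsi m 2 (planar (Bin Unit Unit)) [A, B])\<rparr>)"

definition R_functor :: "(('o, 'a) wkp_alg, ('o, 'a) wkp_mor, ('o, 'a) smc, ('o, 'a) smf) func" where
  "R_functor = \<lparr>FO = (\<lambda>X\<in>Obj WkPCat. R_obj X), FA = (\<lambda>m\<in>Arr WkPCat. R_arr m)\<rparr>"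

end

theory Submission
  imports Defs
begin

text \<open>
  Coherence for symmetric monoidal categories is obtained from insertion sort: by inserting its
  variables, a word acts on right-normed words, and every canonical map \<open>u \<rightarrow> v\<close> between words
  without repeated variables commutes with the actions of \<open>u\<close> and \<open>v\<close>.  As the actions are
  invertible, this determines the map.  The only critical case, the exchange of two variables, is
  the Yang--Baxter equation.

  Conversely, the structure maps of the symmetric monoidal category of an algebra, and all maps
  built from them, are instances of images of 2-cells between permuted trees.  A 2-cell is
  determined by its source and target, which gives the axioms of \<open>R X\<close> as well as \<open>S (R X) = X\<close>.
  The component of a weak morphism at a permuted tree is determined by \<open>F\<^sub>0\<close> and \<open>F\<^sub>2\<close> because
  \<open>\<psi>\<close> is compatible with composition and with the action of the symmetric groups.
\<close>

section \<open>Categories\<close>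

text \<open>Uniqueness can only be expected for words without repeated variables: the swap of
  \<open>x\<close> with itself and the identity are both canonical from \<open>x \<otimes> x\<close>
  to itself. Canonical maps preserve the multiset of variables, so a derivation starting at such a
  word only meets such words, and compatibility with the actions is demanded for these alone.
  Letting words act on lists, instead of reducing each word to a normal form of its own, makes
  tensor products harmless: \<open>WBin u v\<close> acts by \<open>v\<close> and then by
  \<open>u\<close>, and the action on the empty list recovers a map up to tensoring with the unit
  object. Linear words, in which each of \<open>0, ..., n - 1\<close> occurs once, are in bijection
  with the permuted trees of arity \<open>n\<close>; composition becomes substitution and the
  symmetric groups act by renaming. This trades the index computations of the free operad for the
  closure of canonical maps under substitution and whiskering. The equations S (R X) = X and R (S M)
  = M can hold strictly because all structure functions are extensional.\<close>

context category
begin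

lemma Ide_simps [simp]:
  assumes "A \<in> Obj C"
  shows "Ide C A \<in> Arr C" "Dom C (Ide C A) = A" "Cod C (Ide C A) = A"
  using Ide_in_hom[OF assms] by (auto simp: in_hom_def)

lemma Dom_Cod_obj [simp]:
  assumes "f \<in> Arr C"
  shows "Dom C f \<in> Obj C" "Cod C f \<in> Obj C"
  using assms Dom_type Cod_type by auto

lemma Cmp_simps [simp]:
  assumes "g \<in> Arr C" "f \<in> Arr C" "Dom C g = Cod C f"
  shows "Cmp C g f \<in> Arr C" "Dom C (Cmp C g f) = Dom C f" "Cod C (Cmp C g f) = Cod C g"
  using Cmp_in_hom[of g f] assms by (auto simp: in_hom_def composable_def)

lemma Cmp_Cmp [simp]:
  assumes "h \<in> Arr C" "g \<in> Arr C" "f \<in> Arr C" "Dom C h = Cod C g" "Dom C g = Cod C f"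
  shows "Cmp C (Cmp C h g) f = Cmp C h (Cmp C g f)"
  using Cmp_assoc[of h g f] assms by (auto simp: composable_def)

lemma Cmp_Ide [simp]:
  "f \<in> Arr C \<Longrightarrow> Dom C f = A \<Longrightarrow> Cmp C f (Ide C A) = f"
  "f \<in> Arr C \<Longrightarrow> Cod C f = A \<Longrightarrow> Cmp C (Ide C A) f = f"
  using Cmp_Ide_right Cmp_Ide_left by auto

text \<open>\<open>Cmp_Cmp\<close> nests composites to the right, where \<open>g\<close> and
  \<open>f\<close> no longer form a subterm of their own once \<open>k\<close> follows. The equation
  is therefore restated with a tail; many of the diagram chases below go through this form.\<close>

lemma reassoc:
  assumes "Cmp C g f = Cmp C g' f'"
    and "g \<in> Arr C" "f \<in> Arr C" "Dom C g = Cod C f"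
    and "g' \<in> Arr C" "f' \<in> Arr C" "Dom C g' = Cod C f'"
    and "k \<in> Arr C" "Dom C f = Cod C k"
  shows "Cmp C g (Cmp C f k) = Cmp C g' (Cmp C f' k)"
proof -
  have "Dom C f' = Dom C f"
    using assms Cmp_simps(2) by metis
  then have "Cmp C (Cmp C g f) k = Cmp C g (Cmp C f k)" "Cmp C (Cmp C g' f') k = Cmp C g' (Cmp C f' k)"
    using assms(2-) by auto
  then show ?thesis using assms(1) by metis
qed

lemma inverse_arr_unique:
  assumes "f \<in> Arr C" "inverse_arr C f g" "inverse_arr C f h"
  shows "g = h"
proof -
  have "g = Cmp C g (Cmp C f h)"
    using assms by (auto simp: inverse_arr_def in_hom_def)
  also have "\<dots> = Cmp C (Cmp C g f) h"
    using assms by (subst Cmp_Cmp) (auto simp: inverse_arr_def in_hom_def)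
  also have "\<dots> = h"
    using assms by (auto simp: inverse_arr_def in_hom_def)
  finally show ?thesis .
qed

lemma inv_arr_eq:
  assumes "f \<in> Arr C" "inverse_arr C f g"
  shows "inv_arr C f = g"
  unfolding inv_arr_def using assms inverse_arr_unique by blast

lemma inverse_inv_arr: "is_iso C f \<Longrightarrow> inverse_arr C f (inv_arr C f)"
  using inv_arr_eq by (auto simp: is_iso_def)

lemma iso_arr: "is_iso C f \<Longrightarrow> f \<in> Arr C"
  by (simp add: is_iso_def)

lemma inv_simps [simp]:
  assumes "is_iso C f"
  shows "inv_arr C f \<in> Arr C" "Dom C (inv_arr C f) = Cod C f" "Cod C (inv_arr C f) = Dom C f"
    "Cmp C (inv_arr C f) f = Ide C (Dom C f)" "Cmp C f (inv_arr C f) = Ide C (Cod C f)"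
  using inverse_inv_arr[OF assms] by (auto simp: inverse_arr_def in_hom_def)

lemma inv_cancel [simp]:
  assumes "is_iso C f" "k \<in> Arr C"
  shows "Cod C k = Dom C f \<Longrightarrow> Cmp C (inv_arr C f) (Cmp C f k) = k"
    "Cod C k = Cod C f \<Longrightarrow> Cmp C f (Cmp C (inv_arr C f) k) = k"
  using assms iso_arr[OF assms(1)] by (simp_all flip: Cmp_Cmp)

lemma iso_inv [simp]: "is_iso C f \<Longrightarrow> is_iso C (inv_arr C f)"
  unfolding is_iso_def[of C "inv_arr C f"]
  by (auto intro!: exI[of _ f] simp: inverse_arr_def in_hom_def iso_arr)

lemma iso_Ide [simp]: "A \<in> Obj C \<Longrightarrow> is_iso C (Ide C A)"
  unfolding is_iso_def by (auto intro!: exI[of _ "Ide C A"] simp: inverse_arr_def in_hom_def)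

lemma iso_Cmp [simp]:
  assumes "is_iso C g" "is_iso C f" "Dom C g = Cod C f"
  shows "is_iso C (Cmp C g f)"
  unfolding is_iso_def
  using assms by (auto intro!: exI[of _ "Cmp C (inv_arr C f) (inv_arr C g)"]
      simp: inverse_arr_def in_hom_def iso_arr)

lemma iso_cancel_left:
  assumes "is_iso C f" "Cmp C f g = Cmp C f h" "g \<in> Arr C" "h \<in> Arr C" "Cod C g = Dom C f" "Cod C h = Dom C f"
  shows "g = h"
  using assms inv_cancel(1) by metis

lemma iso_cancel_right:
  assumes "is_iso C f" "Cmp C g f = Cmp C h f" "g \<in> Arr C" "h \<in> Arr C" "Dom C g = Cod C f" "Dom C h = Cod C f"
  shows "g = h"
proof -
  have "Cmp C (Cmp C g f) (inv_arr C f) = Cmp C (Cmp C h f) (inv_arr C f)"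
    using assms(2) by simp
  then show ?thesis using assms(1,3-) by (simp add: iso_arr)
qed

lemma iso_move_left:
  assumes "is_iso C f" "Cmp C f g = h" "g \<in> Arr C" "Cod C g = Dom C f"
  shows "g = Cmp C (inv_arr C f) h"
  using assms by auto

end

lemma in_homD:
  assumes "in_hom C f A B"
  shows "f \<in> Arr C" "Dom C f = A" "Cod C f = B"
  using assms by (auto simp: in_hom_def)

context cat_functor
begin

lemma FO_obj [simp]: "A \<in> Obj C \<Longrightarrow> FO F A \<in> Obj D"
  using FO_type by auto

lemma FA_simps [simp]:
  assumes "f \<in> Arr C"
  shows "FA F f \<in> Arr D" "Dom D (FA F f) = FO F (Dom C f)" "Cod D (FA F f) = FO F (Cod C f)"
  using FA_in_hom[OF assms] by (auto simp: in_hom_def)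

lemma FA_Cmp' :
  assumes "g \<in> Arr C" "f \<in> Arr C" "Dom C g = Cod C f"
  shows "FA F (Cmp C g f) = Cmp D (FA F g) (FA F f)"
  using FA_Cmp assms by (auto simp: composable_def)

end

lemma functor_iso:
  assumes "cat_functor C D F" "category C" "category D" "is_iso C f"
  shows "is_iso D (FA F f)" "inv_arr D (FA F f) = FA F (inv_arr C f)"
proof -
  interpret F: cat_functor C D F by fact
  interpret C: category C by fact
  interpret D: category D by fact
  have f: "f \<in> Arr C" using assms(4) C.iso_arr by blast
  have "inverse_arr D (FA F f) (FA F (inv_arr C f))"
    using assms(4) f by (simp add: inverse_arr_def in_hom_def F.FA_Ide flip: F.FA_Cmp')
  then show "is_iso D (FA F f)" "inv_arr D (FA F f) = FA F (inv_arr C f)"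
    using f D.inv_arr_eq by (auto simp: is_iso_def)
qed

lemma prod_cat_simps [simp]:
  "Obj (prod_cat C D) = Obj C \<times> Obj D"
  "Arr (prod_cat C D) = Arr C \<times> Arr D"
  "f \<in> Arr C \<Longrightarrow> g \<in> Arr D \<Longrightarrow> Dom (prod_cat C D) (f, g) = (Dom C f, Dom D g)"
  "f \<in> Arr C \<Longrightarrow> g \<in> Arr D \<Longrightarrow> Cod (prod_cat C D) (f, g) = (Cod C f, Cod D g)"
  "A \<in> Obj C \<Longrightarrow> B \<in> Obj D \<Longrightarrow> Ide (prod_cat C D) (A, B) = (Ide C A, Ide D B)"
  "composable C f' f \<Longrightarrow> composable D g' g \<Longrightarrow>
    Cmp (prod_cat C D) (f', g') (f, g) = (Cmp C f' f, Cmp D g' g)"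
  by (auto simp: prod_cat_def)

lemma power_cat_simps [simp]:
  "Obj (power_cat C n) = {As. length As = n \<and> set As \<subseteq> Obj C}"
  "Arr (power_cat C n) = {fs. length fs = n \<and> set fs \<subseteq> Arr C}"
  "length fs = n \<Longrightarrow> set fs \<subseteq> Arr C \<Longrightarrow> Dom (power_cat C n) fs = map (Dom C) fs"
  "length fs = n \<Longrightarrow> set fs \<subseteq> Arr C \<Longrightarrow> Cod (power_cat C n) fs = map (Cod C) fs"
  "length As = n \<Longrightarrow> set As \<subseteq> Obj C \<Longrightarrow> Ide (power_cat C n) As = map (Ide C) As"
  "length gs = n \<Longrightarrow> length fs = n \<Longrightarrow> list_all2 (composable C) gs fs \<Longrightarrow>
    Cmp (power_cat C n) gs fs = map2 (Cmp C) gs fs"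
  by (auto simp: power_cat_def)

lemma composable_power:
  assumes "category C" "composable (power_cat C n) gs fs"
  shows "length gs = n" "length fs = n" "set gs \<subseteq> Arr C" "set fs \<subseteq> Arr C"
    "list_all2 (composable C) gs fs" "map (Dom C) gs = map (Cod C) fs"
proof -
  show *: "length gs = n" "length fs = n" "set gs \<subseteq> Arr C" "set fs \<subseteq> Arr C"
    "map (Dom C) gs = map (Cod C) fs"
    using assms by (auto simp: composable_def)
  then have "Dom C (gs ! i) = Cod C (fs ! i)" if "i < n" for i
    using that by (metis nth_map)
  then show "list_all2 (composable C) gs fs"
    using * by (auto simp: list_all2_conv_all_nth composable_def subset_iff)
qed

lemma nat_transI:
  assumes "cat_functor C D F" "cat_functor C D G" "c \<in> extensional (Obj C)"
    and "\<And>A. A \<in> Obj C \<Longrightarrow> in_hom D (c A) (FO F A) (FO G A)"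
    and "\<And>f. f \<in> Arr C \<Longrightarrow> Cmp D (c (Cod C f)) (FA F f) = Cmp D (FA G f) (c (Dom C f))"
  shows "nat_trans C D \<lparr>NSrc = F, NTgt = G, NCmp = c\<rparr>"
  by (rule nat_trans.intro) (use assms in \<open>auto simp: PiE_def in_hom_def\<close>)

text \<open>
  A functor with an inverse on objects and arrows carries the category axioms of its domain over
  to its codomain.
\<close>

lemma isomorphism_of_categoriesI:
  assumes "category C"
    and FO: "FO F \<in> Obj C \<rightarrow>\<^sub>E Obj D" and FA: "FA F \<in> Arr C \<rightarrow>\<^sub>E Arr D"
    and GO: "FO G \<in> Obj D \<rightarrow>\<^sub>E Obj C" and GA: "FA G \<in> Arr D \<rightarrow>\<^sub>E Arr C"
    and GFO: "\<And>A. A \<in> Obj C \<Longrightarrow> FO G (FO F A) = A" and GFA: "\<And>f. f \<in> Arr C \<Longrightarrow> FA G (FA F f) = f"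
    and FGO: "\<And>B. B \<in> Obj D \<Longrightarrow> FO F (FO G B) = B" and FGA: "\<And>g. g \<in> Arr D \<Longrightarrow> FA F (FA G g) = g"
    and ext: "Dom D \<in> extensional (Arr D)" "Cod D \<in> extensional (Arr D)" "Ide D \<in> extensional (Obj D)"
    and FDom: "\<And>f. f \<in> Arr C \<Longrightarrow> Dom D (FA F f) = FO F (Dom C f)"
    and FCod: "\<And>f. f \<in> Arr C \<Longrightarrow> Cod D (FA F f) = FO F (Cod C f)"
    and FIde: "\<And>A. A \<in> Obj C \<Longrightarrow> Ide D (FO F A) = FA F (Ide C A)"
    and FCmp: "\<And>g f. composable C g f \<Longrightarrow> Cmp D (FA F g) (FA F f) = FA F (Cmp C g f)"
    and undef: "\<And>g f. \<not> composable D g f \<Longrightarrow> Cmp D g f = undefined"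
  shows "isomorphism_of_categories C D F G"
proof -
  interpret category C by fact
  have FO' [simp]: "A \<in> Obj C \<Longrightarrow> FO F A \<in> Obj D" and FA' [simp]: "f \<in> Arr C \<Longrightarrow> FA F f \<in> Arr D"
    and GO' [simp]: "B \<in> Obj D \<Longrightarrow> FO G B \<in> Obj C" and GA' [simp]: "g \<in> Arr D \<Longrightarrow> FA G g \<in> Arr C" for A B f g
    using FO FA GO GA by auto
  note FDom [simp] FCod [simp] FIde [simp] GFO [simp] GFA [simp] FGO [simp] FGA [simp]
  have DomD: "Dom D g = FO F (Dom C (FA G g))" and CodD: "Cod D g = FO F (Cod C (FA G g))"
    if "g \<in> Arr D" for g
    using that FDom[of "FA G g"] FCod[of "FA G g"] by auto
  have IdeD: "Ide D B = FA F (Ide C (FO G B))" if "B \<in> Obj D" for B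
    using that FIde[of "FO G B"] by auto
  \<comment> \<open>Injectivity on objects lets the equality of a domain and a codomain in
    \<open>D\<close> be tested in \<open>C\<close>, so composability is reflected as well as
    preserved.\<close>
  have inj: "A = B" if "FO F A = FO F B" "A \<in> Obj C" "B \<in> Obj C" for A B
    using that GFO by metis
  have comp: "composable D g f \<longleftrightarrow> g \<in> Arr D \<and> f \<in> Arr D \<and> composable C (FA G g) (FA G f)" for g f
    unfolding composable_def using DomD CodD inj by auto
  have CmpD: "Cmp D g f = FA F (Cmp C (FA G g) (FA G f))" if "composable D g f" for g f
    using that FCmp[of "FA G g" "FA G f"] comp[of g f] by auto
  have "category D"
  proof
    show "Dom D \<in> Arr D \<rightarrow>\<^sub>E Obj D" "Cod D \<in> Arr D \<rightarrow>\<^sub>E Obj D" "Ide D \<in> Obj D \<rightarrow>\<^sub>E Arr D"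
      using ext by (auto simp: PiE_def DomD CodD IdeD)
    show "in_hom D (Ide D A) A A" if "A \<in> Obj D" for A
      using that by (auto simp: in_hom_def IdeD)
    fix g f
    show "in_hom D (Cmp D g f) (Dom D f) (Cod D g)" if "composable D g f"
    proof -
      have *: "g \<in> Arr D" "f \<in> Arr D" "composable C (FA G g) (FA G f)"
        using that comp by auto
      then show ?thesis
        using that by (simp add: CmpD in_hom_def DomD CodD) (simp add: composable_def)
    qed
    show "Cmp D g f = undefined" if "\<not> composable D g f" using undef that by blast
    show "Cmp D f (Ide D (Dom D f)) = f" "Cmp D (Ide D (Cod D f)) f = f" if "f \<in> Arr D"
      using that by (subst CmpD; simp add: DomD CodD IdeD comp composable_def)+
  next
    fix h g f assume hg: "composable D h g" and gf: "composable D g f"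
    then have *: "h \<in> Arr D" "g \<in> Arr D" "f \<in> Arr D"
      "Dom C (FA G h) = Cod C (FA G g)" "Dom C (FA G g) = Cod C (FA G f)"
      by (auto simp: comp composable_def[of C])
    then have "composable D h (FA F (Cmp C (FA G g) (FA G f)))" "composable D (FA F (Cmp C (FA G h) (FA G g))) f"
      by (simp_all add: comp) (simp_all add: composable_def)
    then show "Cmp D h (Cmp D g f) = Cmp D (Cmp D h g) f"
      using hg gf * by (simp add: CmpD)
  qed
  moreover have "cat_functor C D F"
    using FO FA by unfold_locales (auto simp: in_hom_def FCmp)
  moreover have "cat_functor D C G"
    using GO GA by unfold_locales (auto simp: in_hom_def DomD CodD IdeD CmpD comp composable_def[of C])
  moreover have "comp_func C G F = id_func C" "comp_func D F G = id_func D"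
    by (auto simp: comp_func_def id_func_def intro!: restrict_ext)
  ultimately show ?thesis
    using \<open>category C\<close> by (simp add: isomorphism_of_categories_def)
qed

section \<open>Symmetric monoidal categories\<close>

sublocale symmetric_monoidal_category \<subseteq> category "mcat M"
  by (rule mcat_category)

sublocale symmetric_monoidal_category \<subseteq> tensor: cat_functor "prod_cat (mcat M) (mcat M)" "mcat M" "tensor M"
  by (rule tensor_functor)

context symmetric_monoidal_category
begin

abbreviation cmp (infixr "\<cdot>" 55) where "g \<cdot> f \<equiv> Cmp (mcat M) g f"
abbreviation ten (infixr "\<otimes>" 70) where "A \<otimes> B \<equiv> A \<otimes>\<^bsub>M\<^esub> B"
abbreviation tena (infixr "\<odot>" 70) where "f \<odot> g \<equiv> f \<odot>\<^bsub>M\<^esub> g"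
abbreviation unit_obj ("\<I>") where "\<I> \<equiv> munit M"
abbreviation "\<a> X Y Z \<equiv> massoc M (X, Y, Z)"
abbreviation "\<a>i X Y Z \<equiv> inv_arr (mcat M) (massoc M (X, Y, Z))"
abbreviation "\<l> X \<equiv> mlunit M X"
abbreviation "\<r> X \<equiv> mrunit M X"
abbreviation "\<s> X Y \<equiv> mswap M (X, Y)"
abbreviation "ide \<equiv> mide M"
abbreviation "isom \<equiv> is_iso (mcat M)"
abbreviation "inva \<equiv> inv_arr (mcat M)"

declare munit_obj [simp] assoc_iso [simp] lunit_iso [simp] runit_iso [simp] swap_iso [simp]
declare unit_unit [simp]

lemma tensor_obj [simp]: "X \<in> mobj M \<Longrightarrow> Y \<in> mobj M \<Longrightarrow> X \<otimes> Y \<in> mobj M"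
  using tensor.FO_obj[of "(X, Y)"] by simp

lemma tensor_simps [simp]:
  assumes "f \<in> marr M" "g \<in> marr M"
  shows "f \<odot> g \<in> marr M" "mdom M (f \<odot> g) = mdom M f \<otimes> mdom M g"
    "mcod M (f \<odot> g) = mcod M f \<otimes> mcod M g"
  using tensor.FA_simps[of "(f, g)"] assms by simp_all

lemma tensor_Ide [simp]: "X \<in> mobj M \<Longrightarrow> Y \<in> mobj M \<Longrightarrow> ide X \<odot> ide Y = ide (X \<otimes> Y)"
  using tensor.FA_Ide[of "(X, Y)"] by simp

text \<open>Oriented so as to merge tensor products. Where a chase has to keep two factors apart,
  this rule and its form with a tail are switched off.\<close>

lemma interchange [simp]:
  assumes "f \<in> marr M" "g \<in> marr M" "f' \<in> marr M" "g' \<in> marr M"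
    "mdom M f' = mcod M f" "mdom M g' = mcod M g"
  shows "(f' \<odot> g') \<cdot> (f \<odot> g) = (f' \<cdot> f) \<odot> (g' \<cdot> g)"
  using tensor.FA_Cmp[of "(f', g')" "(f, g)"] assms by (simp add: composable_def)

lemma interchange_reassoc [simp]:
  assumes "f \<in> marr M" "g \<in> marr M" "f' \<in> marr M" "g' \<in> marr M"
    "mdom M f' = mcod M f" "mdom M g' = mcod M g" "k \<in> marr M" "mcod M k = mdom M f \<otimes> mdom M g"
  shows "(f' \<odot> g') \<cdot> (f \<odot> g) \<cdot> k = ((f' \<cdot> f) \<odot> (g' \<cdot> g)) \<cdot> k"
  using assms by (simp flip: Cmp_Cmp)

lemma assoc_simps [simp]:
  assumes "X \<in> mobj M" "Y \<in> mobj M" "Z \<in> mobj M"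
  shows "\<a> X Y Z \<in> marr M" "mdom M (\<a> X Y Z) = X \<otimes> (Y \<otimes> Z)" "mcod M (\<a> X Y Z) = (X \<otimes> Y) \<otimes> Z"
  using assoc_in_hom[OF assms] by (auto simp: in_hom_def)

lemma unit_simps [simp]:
  assumes "X \<in> mobj M"
  shows "\<l> X \<in> marr M" "mdom M (\<l> X) = \<I> \<otimes> X" "mcod M (\<l> X) = X"
    "\<r> X \<in> marr M" "mdom M (\<r> X) = X \<otimes> \<I>" "mcod M (\<r> X) = X"
  using lunit_in_hom[OF assms] runit_in_hom[OF assms] by (auto simp: in_hom_def)

lemma swap_simps [simp]:
  assumes "X \<in> mobj M" "Y \<in> mobj M"
  shows "\<s> X Y \<in> marr M" "mdom M (\<s> X Y) = X \<otimes> Y" "mcod M (\<s> X Y) = Y \<otimes> X"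
  using swap_in_hom[OF assms] by (auto simp: in_hom_def)

lemma tensor_iso [simp]:
  assumes "isom f" "isom g"
  shows "isom (f \<odot> g)"
  unfolding is_iso_def
  using assms by (auto intro!: exI[of _ "inva f \<odot> inva g"] simp: inverse_arr_def in_hom_def iso_arr)

lemma assoc_inv_natural:
  assumes "f \<in> marr M" "g \<in> marr M" "h \<in> marr M"
  shows "\<a>i (mcod M f) (mcod M g) (mcod M h) \<cdot> ((f \<odot> g) \<odot> h) =
    (f \<odot> (g \<odot> h)) \<cdot> \<a>i (mdom M f) (mdom M g) (mdom M h)"
proof (rule iso_cancel_left[of "\<a> (mcod M f) (mcod M g) (mcod M h)"])
  show "\<a> (mcod M f) (mcod M g) (mcod M h) \<cdot> \<a>i (mcod M f) (mcod M g) (mcod M h) \<cdot> ((f \<odot> g) \<odot> h)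
     = \<a> (mcod M f) (mcod M g) (mcod M h) \<cdot> (f \<odot> (g \<odot> h)) \<cdot> \<a>i (mdom M f) (mdom M g) (mdom M h)"
    using assms reassoc[OF assoc_natural[OF assms], of "\<a>i (mdom M f) (mdom M g) (mdom M h)"]
    by simp
qed (use assms in simp_all)

text \<open>Tensoring with the unit object is naturally isomorphic to the identity functor through
  \<lambda>, hence faithful. \<open>tensor_unit_cancel\<close> is the same argument with
  \<rho>.\<close>

lemma unit_tensor_cancel:
  assumes "ide \<I> \<odot> f = ide \<I> \<odot> g" "f \<in> marr M" "g \<in> marr M" "mdom M f = mdom M g" "mcod M f = mcod M g"
  shows "f = g"
proof (rule iso_cancel_right[of "\<l> (mdom M f)"])
  show "f \<cdot> \<l> (mdom M f) = g \<cdot> \<l> (mdom M f)"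
    using lunit_natural[of f] lunit_natural[of g] assms by metis
qed (use assms in simp_all)

lemma tensor_unit_cancel:
  assumes "f \<odot> ide \<I> = g \<odot> ide \<I>" "f \<in> marr M" "g \<in> marr M" "mdom M f = mdom M g" "mcod M f = mcod M g"
  shows "f = g"
proof (rule iso_cancel_right[of "\<r> (mdom M f)"])
  show "f \<cdot> \<r> (mdom M f) = g \<cdot> \<r> (mdom M f)"
    using runit_natural[of f] runit_natural[of g] assms by metis
qed (use assms in simp_all)

text \<open>The triangle axiom has the unit in the middle; this is its variant with the unit on the
  left, by the classical argument: after tensoring with the unit object, both sides appear in the
  pentagon for \<open>\<I>, \<I>, X, Y\<close>, the triangle axiom removing the inner unit on either
  path. It makes \<lambda> compatible with the action of words.\<close>

lemma lunit_tensor: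
  assumes X: "X \<in> mobj M" and Y: "Y \<in> mobj M"
  shows "(\<l> X \<odot> ide Y) \<cdot> \<a> \<I> X Y = \<l> (X \<otimes> Y)"
proof (rule unit_tensor_cancel)
  note [simp] = X Y
  let ?R = "(\<r> \<I> \<odot> ide X) \<odot> ide Y"
  have "?R \<cdot> \<a> (\<I> \<otimes> \<I>) X Y \<cdot> \<a> \<I> \<I> (X \<otimes> Y) = \<a> \<I> X Y \<cdot> (\<r> \<I> \<odot> ide (X \<otimes> Y)) \<cdot> \<a> \<I> \<I> (X \<otimes> Y)"
    using reassoc[OF assoc_natural[of "\<r> \<I>" "ide X" "ide Y"], of "\<a> \<I> \<I> (X \<otimes> Y)"] by simp
  also have "\<dots> = \<a> \<I> X Y \<cdot> (ide \<I> \<odot> \<l> (X \<otimes> Y))"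
    using triangle[of \<I> "X \<otimes> Y"] by simp
  finally have 1: "?R \<cdot> \<a> (\<I> \<otimes> \<I>) X Y \<cdot> \<a> \<I> \<I> (X \<otimes> Y) = \<a> \<I> X Y \<cdot> (ide \<I> \<odot> \<l> (X \<otimes> Y))" .
  have "?R \<cdot> (\<a> \<I> \<I> X \<odot> ide Y) \<cdot> \<a> \<I> (\<I> \<otimes> X) Y \<cdot> (ide \<I> \<odot> \<a> \<I> X Y)
    = ((ide \<I> \<odot> \<l> X) \<odot> ide Y) \<cdot> \<a> \<I> (\<I> \<otimes> X) Y \<cdot> (ide \<I> \<odot> \<a> \<I> X Y)"
    using triangle[of \<I> X] by simp
  also have "\<dots> = \<a> \<I> X Y \<cdot> (ide \<I> \<odot> (\<l> X \<odot> ide Y)) \<cdot> (ide \<I> \<odot> \<a> \<I> X Y)"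
    using reassoc[OF assoc_natural[of "ide \<I>" "\<l> X" "ide Y"], of "ide \<I> \<odot> \<a> \<I> X Y"] by simp
  finally have "\<a> \<I> X Y \<cdot> (ide \<I> \<odot> \<l> (X \<otimes> Y)) = \<a> \<I> X Y \<cdot> (ide \<I> \<odot> (\<l> X \<odot> ide Y)) \<cdot> (ide \<I> \<odot> \<a> \<I> X Y)"
    using 1 pentagon[of \<I> \<I> X Y] by simp
  then show "ide \<I> \<odot> ((\<l> X \<odot> ide Y) \<cdot> \<a> \<I> X Y) = ide \<I> \<odot> \<l> (X \<otimes> Y)"
    by - (rule iso_cancel_left[of "\<a> \<I> X Y"]; simp)
qed (use assms in simp_all)

section \<open>Exchanging the first two factors of a right-normed product\<close>

definition past :: "'o \<Rightarrow> 'o \<Rightarrow> 'o \<Rightarrow> 'a" where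
  "past X Y Z = \<a>i Y X Z \<cdot> (\<s> X Y \<odot> ide Z) \<cdot> \<a> X Y Z"

lemma past_simps [simp]:
  assumes "X \<in> mobj M" "Y \<in> mobj M" "Z \<in> mobj M"
  shows "past X Y Z \<in> marr M" "mdom M (past X Y Z) = X \<otimes> (Y \<otimes> Z)" "mcod M (past X Y Z) = Y \<otimes> (X \<otimes> Z)"
    "isom (past X Y Z)"
  using assms by (simp_all add: past_def)

lemma past_past:
  assumes [simp]: "X \<in> mobj M" "Y \<in> mobj M" "Z \<in> mobj M"
  shows "past Y X Z \<cdot> past X Y Z = ide (X \<otimes> (Y \<otimes> Z))"
  by (simp add: past_def symmetry)

lemma past_natural:
  assumes [simp]: "f \<in> marr M" "g \<in> marr M" "h \<in> marr M"
  shows "past (mcod M f) (mcod M g) (mcod M h) \<cdot> (f \<odot> (g \<odot> h)) =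
    (g \<odot> (f \<odot> h)) \<cdot> past (mdom M f) (mdom M g) (mdom M h)"
proof -
  let ?A = "\<a> (mdom M f) (mdom M g) (mdom M h)"
  have "past (mcod M f) (mcod M g) (mcod M h) \<cdot> (f \<odot> (g \<odot> h))
    = \<a>i (mcod M g) (mcod M f) (mcod M h) \<cdot> (\<s> (mcod M f) (mcod M g) \<odot> ide (mcod M h)) \<cdot> ((f \<odot> g) \<odot> h) \<cdot> ?A"
    by (simp add: past_def assoc_natural del: interchange_reassoc)
  also have "\<dots> = \<a>i (mcod M g) (mcod M f) (mcod M h) \<cdot> ((g \<odot> f) \<odot> h) \<cdot> (\<s> (mdom M f) (mdom M g) \<odot> ide (mdom M h)) \<cdot> ?A"
    by (simp add: swap_natural)
  also have "\<dots> = (g \<odot> (f \<odot> h)) \<cdot> \<a>i (mdom M g) (mdom M f) (mdom M h) \<cdot> (\<s> (mdom M f) (mdom M g) \<odot> ide (mdom M h)) \<cdot> ?A"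
    by (rule reassoc[OF assoc_inv_natural]) auto
  finally show ?thesis by (simp add: past_def)
qed

text \<open>The hexagon with a further factor \<open>W\<close> on the right: moving
  \<open>X \<otimes> Y\<close> past \<open>Z\<close> amounts to moving \<open>Y\<close> and then
  \<open>X\<close>. Since \<open>past\<close> associates towards the tail, two solved forms of the
  pentagon are needed before the hexagon, tensored with \<open>W\<close>, can be applied.\<close>

lemma past_tensor:
  assumes [simp]: "X \<in> mobj M" "Y \<in> mobj M" "Z \<in> mobj M" "W \<in> mobj M"
  shows "(ide Z \<odot> \<a> X Y W) \<cdot> past X Z (Y \<otimes> W) \<cdot> (ide X \<odot> past Y Z W) =
    past (X \<otimes> Y) Z W \<cdot> \<a> X Y (Z \<otimes> W)"
proof -
  \<comment> \<open>The pentagon for \<open>X, Z, Y, W\<close>; \<open>2\<close> below is the one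
    for \<open>Z, X, Y, W\<close>. Each is solved for a composite that occurs in the chase.\<close>
  have 1: "\<a> X Z (Y \<otimes> W) \<cdot> (ide X \<odot> \<a>i Z Y W) = \<a>i (X \<otimes> Z) Y W \<cdot> (\<a> X Z Y \<odot> ide W) \<cdot> \<a> X (Z \<otimes> Y) W"
    (is "?l = ?r")
  proof (rule iso_cancel_left[of "\<a> (X \<otimes> Z) Y W"])
    show "\<a> (X \<otimes> Z) Y W \<cdot> ?l = \<a> (X \<otimes> Z) Y W \<cdot> ?r"
      using reassoc[OF pentagon[of X Z Y W], of "ide X \<odot> \<a>i Z Y W"] by simp
  qed auto
  have 2: "(ide Z \<odot> \<a> X Y W) \<cdot> \<a>i Z X (Y \<otimes> W) \<cdot> \<a>i (Z \<otimes> X) Y W = \<a>i Z (X \<otimes> Y) W \<cdot> (inva (\<a> Z X Y) \<odot> ide W)"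
    (is "?l = ?r")
  proof (rule iso_cancel_right[of "\<a> (Z \<otimes> X) Y W \<cdot> \<a> Z X (Y \<otimes> W)"])
    have "?r \<cdot> \<a> (Z \<otimes> X) Y W \<cdot> \<a> Z X (Y \<otimes> W) = ide Z \<odot> \<a> X Y W"
      by (simp add: pentagon)
    then show "?l \<cdot> \<a> (Z \<otimes> X) Y W \<cdot> \<a> Z X (Y \<otimes> W) = ?r \<cdot> \<a> (Z \<otimes> X) Y W \<cdot> \<a> Z X (Y \<otimes> W)"
      by simp
  qed auto
  have s1: "(\<s> X Z \<odot> ide (Y \<otimes> W)) \<cdot> \<a>i (X \<otimes> Z) Y W = \<a>i (Z \<otimes> X) Y W \<cdot> ((\<s> X Z \<odot> ide Y) \<odot> ide W)"
    using assoc_inv_natural[of "\<s> X Z" "ide Y" "ide W"] by simp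
  have s2: "\<a> X (Z \<otimes> Y) W \<cdot> (ide X \<odot> (\<s> Y Z \<odot> ide W)) = ((ide X \<odot> \<s> Y Z) \<odot> ide W) \<cdot> \<a> X (Y \<otimes> Z) W"
    using assoc_natural[of "ide X" "\<s> Y Z" "ide W"] by simp
  let ?k = "ide X \<odot> \<a> Y Z W"
  have "past X Z (Y \<otimes> W) \<cdot> (ide X \<odot> past Y Z W) = \<a>i Z X (Y \<otimes> W) \<cdot> (\<s> X Z \<odot> ide (Y \<otimes> W)) \<cdot>
      \<a> X Z (Y \<otimes> W) \<cdot> (ide X \<odot> \<a>i Z Y W) \<cdot> (ide X \<odot> (\<s> Y Z \<odot> ide W)) \<cdot> ?k"
    by (simp add: past_def)
  also have "\<dots> = \<a>i Z X (Y \<otimes> W) \<cdot> (\<s> X Z \<odot> ide (Y \<otimes> W)) \<cdot>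
      \<a>i (X \<otimes> Z) Y W \<cdot> (\<a> X Z Y \<odot> ide W) \<cdot> \<a> X (Z \<otimes> Y) W \<cdot> (ide X \<odot> (\<s> Y Z \<odot> ide W)) \<cdot> ?k"
    using reassoc[OF 1, of "(ide X \<odot> (\<s> Y Z \<odot> ide W)) \<cdot> ?k"] by (simp del: interchange interchange_reassoc)
  also have "\<dots> = \<a>i Z X (Y \<otimes> W) \<cdot> (\<s> X Z \<odot> ide (Y \<otimes> W)) \<cdot>
      \<a>i (X \<otimes> Z) Y W \<cdot> (\<a> X Z Y \<odot> ide W) \<cdot> ((ide X \<odot> \<s> Y Z) \<odot> ide W) \<cdot> \<a> X (Y \<otimes> Z) W \<cdot> ?k"
    using reassoc[OF s2, of ?k] by (simp del: interchange interchange_reassoc)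
  also have "\<dots> = \<a>i Z X (Y \<otimes> W) \<cdot> \<a>i (Z \<otimes> X) Y W \<cdot> ((\<s> X Z \<odot> ide Y) \<odot> ide W) \<cdot>
      (\<a> X Z Y \<odot> ide W) \<cdot> ((ide X \<odot> \<s> Y Z) \<odot> ide W) \<cdot> \<a> X (Y \<otimes> Z) W \<cdot> ?k"
    using reassoc[OF s1, of "(\<a> X Z Y \<odot> ide W) \<cdot> ((ide X \<odot> \<s> Y Z) \<odot> ide W) \<cdot> \<a> X (Y \<otimes> Z) W \<cdot> ?k"]
    by (simp del: interchange interchange_reassoc)
  also have "\<dots> = \<a>i Z X (Y \<otimes> W) \<cdot> \<a>i (Z \<otimes> X) Y W \<cdot>
      ((\<a> Z X Y \<cdot> \<s> (X \<otimes> Y) Z \<cdot> \<a> X Y Z) \<odot> ide W) \<cdot> \<a> X (Y \<otimes> Z) W \<cdot> ?k"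
    using hexagon[of X Y Z] by simp
  finally have "(ide Z \<odot> \<a> X Y W) \<cdot> past X Z (Y \<otimes> W) \<cdot> (ide X \<odot> past Y Z W) =
      (ide Z \<odot> \<a> X Y W) \<cdot> \<a>i Z X (Y \<otimes> W) \<cdot> \<a>i (Z \<otimes> X) Y W \<cdot>
      ((\<a> Z X Y \<cdot> \<s> (X \<otimes> Y) Z \<cdot> \<a> X Y Z) \<odot> ide W) \<cdot> \<a> X (Y \<otimes> Z) W \<cdot> ?k"
    by simp
  also have "\<dots> = ((ide Z \<odot> \<a> X Y W) \<cdot> \<a>i Z X (Y \<otimes> W) \<cdot> \<a>i (Z \<otimes> X) Y W) \<cdot>
      ((\<a> Z X Y \<cdot> \<s> (X \<otimes> Y) Z \<cdot> \<a> X Y Z) \<odot> ide W) \<cdot> \<a> X (Y \<otimes> Z) W \<cdot> ?k"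
    by simp
  also have "\<dots> = \<a>i Z (X \<otimes> Y) W \<cdot> (\<s> (X \<otimes> Y) Z \<odot> ide W) \<cdot> (\<a> X Y Z \<odot> ide W) \<cdot> \<a> X (Y \<otimes> Z) W \<cdot> ?k"
    unfolding 2 by simp
  also have "\<dots> = \<a>i Z (X \<otimes> Y) W \<cdot> (\<s> (X \<otimes> Y) Z \<odot> ide W) \<cdot> \<a> (X \<otimes> Y) Z W \<cdot> \<a> X Y (Z \<otimes> W)"
    by (simp only: pentagon[OF assms])
  finally show ?thesis
    by (simp add: past_def)
qed

text \<open>Naturality of \<open>past\<close> in its first argument at the swap
  \<open>\<s> X Y\<close>: moving \<open>X \<otimes> Y\<close> past \<open>Z\<close> commutes with
  exchanging \<open>X\<close> and \<open>Y\<close>. By \<open>past_tensor\<close> the two sides of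
  that square unfold to the two ways of reversing three leading factors.\<close>

lemma yang_baxter:
  assumes [simp]: "X \<in> mobj M" "Y \<in> mobj M" "Z \<in> mobj M" "W \<in> mobj M"
  shows "(ide Z \<odot> past X Y W) \<cdot> past X Z (Y \<otimes> W) \<cdot> (ide X \<odot> past Y Z W) =
    past Y Z (X \<otimes> W) \<cdot> (ide Y \<odot> past X Z W) \<cdot> past X Y (Z \<otimes> W)"
proof -
  have "(ide Z \<odot> past X Y W) \<cdot> past X Z (Y \<otimes> W) \<cdot> (ide X \<odot> past Y Z W) =
    (ide Z \<odot> \<a>i Y X W) \<cdot> (ide Z \<odot> (\<s> X Y \<odot> ide W)) \<cdot> (ide Z \<odot> \<a> X Y W) \<cdot> past X Z (Y \<otimes> W) \<cdot> (ide X \<odot> past Y Z W)"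
    by (simp add: past_def[of X Y W])
  also have "\<dots> = (ide Z \<odot> \<a>i Y X W) \<cdot> (ide Z \<odot> (\<s> X Y \<odot> ide W)) \<cdot> past (X \<otimes> Y) Z W \<cdot> \<a> X Y (Z \<otimes> W)"
    by (simp only: past_tensor[OF assms])
  also have "\<dots> = (ide Z \<odot> \<a>i Y X W) \<cdot> past (Y \<otimes> X) Z W \<cdot> (\<s> X Y \<odot> ide (Z \<otimes> W)) \<cdot> \<a> X Y (Z \<otimes> W)"
    using reassoc[OF past_natural[of "\<s> X Y" "ide Z" "ide W"], of "\<a> X Y (Z \<otimes> W)"] by simp
  also have "\<dots> = (ide Z \<odot> \<a>i Y X W) \<cdot> (past (Y \<otimes> X) Z W \<cdot> \<a> Y X (Z \<otimes> W)) \<cdot> past X Y (Z \<otimes> W)"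
    by (simp add: past_def[of X Y])
  also have "\<dots> = (ide Z \<odot> \<a>i Y X W) \<cdot> ((ide Z \<odot> \<a> Y X W) \<cdot> past Y Z (X \<otimes> W) \<cdot> (ide Y \<odot> past X Z W)) \<cdot> past X Y (Z \<otimes> W)"
    by (simp only: past_tensor[OF assms(2,1,3,4)])
  finally show ?thesis by simp
qed

end

section \<open>Words\<close>

fun leaves :: "word \<Rightarrow> nat list" where
  "leaves (WVar i) = [i]"
| "leaves WNul = []"
| "leaves (WBin u v) = leaves u @ leaves v"

fun shape :: "word \<Rightarrow> tree" where
  "shape (WVar i) = Unit"
| "shape WNul = Nul"
| "shape (WBin u v) = Bin (shape u) (shape v)"

fun wsubst :: "word list \<Rightarrow> word \<Rightarrow> word" where
  "wsubst ws (WVar i) = ws ! i"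
| "wsubst ws WNul = WNul"
| "wsubst ws (WBin u v) = WBin (wsubst ws u) (wsubst ws v)"

abbreviation rename :: "nat list \<Rightarrow> word \<Rightarrow> word" where
  "rename js \<equiv> wsubst (map WVar js)"

fun warr :: "('o, 'a) smc \<Rightarrow> word \<Rightarrow> 'a list \<Rightarrow> 'a" where
  "warr M (WVar i) fs = fs ! i"
| "warr M WNul fs = Ide (mcat M) (munit M)"
| "warr M (WBin u v) fs = warr M u fs \<odot>\<^bsub>M\<^esub> warr M v fs"

text \<open>Linear words of arity \<open>n\<close> are the permuted trees of arity \<open>n\<close>
  in another guise: the shape is the tree, and the leaves list the values of the
  permutation.\<close>

definition linear :: "nat \<Rightarrow> word \<Rightarrow> bool" where
  "linear n u \<longleftrightarrow> mset (leaves u) = mset [0..<n]"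

text \<open>Beyond the leaves the permutation is continued by the identity, as
  \<open>permutes\<close> fixes everything outside \<open>{..<n}\<close>; this makes
  \<open>ptree_of\<close> a strict inverse of \<open>word_of\<close>.\<close>

definition ptree_of :: "word \<Rightarrow> ptree" where
  "ptree_of u = (\<lambda>i. if i < length (leaves u) then leaves u ! i else i, shape u)"

lemma wvars_leaves: "wvars u = set (leaves u)"
  by (induction u) auto

lemma arity_shape [simp]: "arity (shape u) = length (leaves u)"
  by (induction u) auto

lemma label_shape [simp]: "label (shape u) (leaves u) = u"
  by (induction u) auto

lemma leaves_label [simp]: "length ls = arity t \<Longrightarrow> leaves (label t ls) = ls"
proof (induction t arbitrary: ls)
  case Unit
  then show ?case by (cases ls) auto
qed auto

lemma shape_label [simp]: "shape (label t ls) = t"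
  by (induction t arbitrary: ls) auto

lemma word_eqI: "shape u = shape v \<Longrightarrow> leaves u = leaves v \<Longrightarrow> u = v"
  by (metis label_shape)

lemma leaves_rename [simp]:
  "set (leaves u) \<subseteq> {..<length js} \<Longrightarrow> leaves (rename js u) = map ((!) js) (leaves u)"
  by (induction u) auto

lemma shape_rename [simp]:
  "set (leaves u) \<subseteq> {..<length js} \<Longrightarrow> shape (rename js u) = shape u"
  by (induction u) auto

lemma rename_label:
  "length ls = arity t \<Longrightarrow> set ls \<subseteq> {..<length js} \<Longrightarrow> rename js (label t ls) = label t (map ((!) js) ls)"
  by (rule word_eqI) auto

lemma wsubst_wsubst:
  "set (leaves u) \<subseteq> {..<length vs} \<Longrightarrow> wsubst ws (wsubst vs u) = wsubst (map (wsubst ws) vs) u"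
  by (induction u) auto

lemma mset_eq_upt:
  assumes "mset xs = mset [0..<n]"
  shows "set xs = {..<n}" "distinct xs" "length xs = n"
proof -
  show "set xs = {..<n}" using mset_eq_setD[OF assms] by (simp only: set_upt atLeast0LessThan)
  show "distinct xs" using mset_eq_imp_distinct_iff[OF assms] by simp
  show "length xs = n" using mset_eq_length[OF assms] by simp
qed

lemma linear_simps:
  assumes "linear n u"
  shows "set (leaves u) = {..<n}" "distinct (leaves u)" "length (leaves u) = n"
  using assms mset_eq_upt unfolding linear_def by blast+

lemma wobj_wsubst:
  "set (leaves u) \<subseteq> {..<length ws} \<Longrightarrow> wobj M (wsubst ws u) As = wobj M u (map (\<lambda>w. wobj M w As) ws)"
  by (induction u) auto

lemma warr_wsubst:
  "set (leaves u) \<subseteq> {..<length ws} \<Longrightarrow> warr M (wsubst ws u) fs = warr M u (map (\<lambda>w. warr M w fs) ws)"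
  by (induction u) auto

lemma tree_obj_label:
  "length ls = arity t \<Longrightarrow> tree_obj M t (map ((!) As) ls) = wobj M (label t ls) As"
proof (induction t arbitrary: ls)
  case Unit
  then show ?case by (cases ls) auto
qed (auto simp: take_map drop_map)

lemma tree_arr_label:
  "length ls = arity t \<Longrightarrow> tree_arr M t (map ((!) fs) ls) = warr M (label t ls) fs"
proof (induction t arbitrary: ls)
  case Unit
  then show ?case by (cases ls) auto
qed (auto simp: take_map drop_map)

lemma mset_concat_map: "mset xs = mset ys \<Longrightarrow> mset (concat (map f xs)) = mset (concat (map f ys))"
  by (simp add: mset_concat) (metis mset_map sum_mset_sum_list)

subsection \<open>Blocks\<close>

lemma length_blocks [simp]: "length (blocks ks xs) = length ks"
  by (induction ks xs rule: blocks.induct) auto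

lemma blocks_map: "blocks ks (map f xs) = map (map f) (blocks ks xs)"
  by (induction ks xs rule: blocks.induct) (auto simp: take_map drop_map)

lemma concat_blocks [simp]: "length xs = sum_list ks \<Longrightarrow> concat (blocks ks xs) = xs"
  by (induction ks xs rule: blocks.induct) auto

lemma nth_blocks:
  "i < length ks \<Longrightarrow> blocks ks xs ! i = take (ks ! i) (drop (sum_list (take i ks)) xs)"
proof (induction ks xs arbitrary: i rule: blocks.induct)
  case (2 k ks xs)
  then show ?case by (cases i) (auto simp: add.commute)
qed auto

lemma sum_list_take_le: "i < length ks \<Longrightarrow> sum_list (take i ks) + ks ! i \<le> (sum_list ks :: nat)"
  by (metis add_le_cancel_left append_take_drop_id le_add1 sum_list.append take_Suc_conv_app_nth
      sum_list.Cons sum_list.Nil add.right_neutral)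

lemma length_nth_blocks [simp]:
  "i < length ks \<Longrightarrow> length xs = sum_list ks \<Longrightarrow> length (blocks ks xs ! i) = ks ! i"
  using sum_list_take_le[of i ks] by (simp add: nth_blocks)

lemma set_nth_blocks: "i < length ks \<Longrightarrow> set (blocks ks xs ! i) \<subseteq> set xs"
  by (metis nth_blocks set_drop_subset set_take_subset subset_trans)

lemma blocks_upt:
  "i < length ks \<Longrightarrow> blocks ks [0..<sum_list ks] ! i = [sum_list (take i ks)..<sum_list (take i ks) + ks ! i]"
  using sum_list_take_le[of i ks] by (simp add: nth_blocks)

lemma map_nth_blocks:
  assumes "length xs = sum_list ks" "i < length ks"
  shows "map ((!) xs) (blocks ks [0..<sum_list ks] ! i) = blocks ks xs ! i"
proof -
  have "blocks ks xs = map (map ((!) xs)) (blocks ks [0..<sum_list ks])"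
    using blocks_map[of ks "(!) xs" "[0..<sum_list ks]"] map_nth[of xs] unfolding assms(1) by simp
  then show ?thesis using assms(2) by simp
qed

subsection \<open>Permuted trees as linear words\<close>

abbreviation level :: "nat \<Rightarrow> ptree set" where
  "level n \<equiv> {(\<sigma>, t). arity t = n \<and> \<sigma> permutes {..<n}}"

text \<open>\<open>\<phi>_gen\<close> is constant, so all pairs of permuted trees of the same arity
  are 2-cells. This is where it matters that \<open>P\<close> is terminal.\<close>

lemma WkP_simps [simp]:
  "Obj (Lev WkP n) = level n"
  "Arr (Lev WkP n) = level n \<times> level n"
  "x \<in> level n \<Longrightarrow> y \<in> level n \<Longrightarrow> Dom (Lev WkP n) (x, y) = x"
  "x \<in> level n \<Longrightarrow> y \<in> level n \<Longrightarrow> Cod (Lev WkP n) (x, y) = y"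
  "x \<in> level n \<Longrightarrow> Ide (Lev WkP n) x = (x, x)"
  "x \<in> level n \<Longrightarrow> y \<in> level n \<Longrightarrow> z \<in> level n \<Longrightarrow> Cmp (Lev WkP n) (y, z) (x, y) = (x, z)"
  "unitO WkP = (id, Unit)"
  "compO WkP = compS free_operad"
  "compA WkP ks (x, y) es = (compS free_operad ks x (map fst es), compS free_operad ks y (map snd es))"
  "actO WkP n \<pi> (\<sigma>, t) = (\<pi> \<circ> \<sigma>, t)"
  "actA WkP n \<pi> (x, y) = (actS free_operad n \<pi> x, actS free_operad n \<pi> y)"
  by (auto simp: WkP_def Wk_def wk_level_def free_operad_def \<phi>_gen_def Let_def)

lemma permutes_map_upt: "\<sigma> permutes {..<n} \<Longrightarrow> mset (map \<sigma> [0..<n]) = mset [0..<n]"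
  by (metis atLeast0LessThan mset_map mset_set_upto_eq_mset_upto permutes_image permutes_inj
      image_mset_mset_set inj_on_subset subset_UNIV lessThan_atLeast0)

lemma upt_permutes:
  assumes "mset xs = mset [0..<n]"
  shows "(\<lambda>i. if i < n then xs ! i else i) permutes {..<n}"
proof (rule bij_imp_permutes)
  note s = mset_eq_upt(1)[OF assms] and d = mset_eq_upt(2)[OF assms] and len = mset_eq_upt(3)[OF assms]
  have "bij_betw ((!) xs) {..<n} {..<n}"
    using bij_betw_nth[OF d, of "{..<n}"] len s by simp
  then show "bij_betw (\<lambda>i. if i < n then xs ! i else i) {..<n} {..<n}"
    by (rule bij_betw_cong[THEN iffD1, rotated]) auto
qed auto

lemma leaves_word_of [simp]: "leaves (word_of (\<sigma>, t)) = map \<sigma> [0..<arity t]"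
  by (simp add: word_of_def)

lemma shape_word_of [simp]: "shape (word_of (\<sigma>, t)) = t"
  by (simp add: word_of_def)

lemma linear_word_of: "x \<in> level n \<Longrightarrow> linear n (word_of x)"
  using permutes_map_upt by (auto simp: linear_def simp del: mset_map)

lemma ptree_of_level: "linear n u \<Longrightarrow> ptree_of u \<in> level n"
  using upt_permutes[of "leaves u" n] linear_simps[of n u] by (simp add: ptree_of_def linear_def)

lemma word_of_ptree_of [simp]: "word_of (ptree_of u) = u"
  by (rule word_eqI) (auto simp: ptree_of_def intro: nth_equalityI)

lemma ptree_of_word_of [simp]: "x \<in> level n \<Longrightarrow> ptree_of (word_of x) = x"
  by (cases x) (auto simp: ptree_of_def permutes_def)

lemma word_of_unit [simp]: "word_of (id, Unit) = WVar 0"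
  by (rule word_eqI) auto

lemma act_level: "x \<in> level n \<Longrightarrow> \<pi> permutes {..<n} \<Longrightarrow> actS free_operad n \<pi> x \<in> level n"
  by (auto simp: free_operad_def permutes_compose)

text \<open>Leaf \<open>i\<close> carries the variable \<open>\<sigma> i\<close>, and after the
  action \<open>\<pi> (\<sigma> i)\<close>: the symmetric group renames variables and leaves the
  shape alone.\<close>

lemma word_of_act:
  assumes "x \<in> level n" "\<pi> permutes {..<n}"
  shows "word_of (actS free_operad n \<pi> x) = rename (map \<pi> [0..<n]) (word_of x)"
proof -
  obtain \<sigma> t where x: "x = (\<sigma>, t)" "arity t = n" "\<sigma> permutes {..<n}" using assms by auto
  then have "\<sigma> i < n" if "i < n" for i using that permutes_in_image[OF x(3)] by simp
  then have "rename (map \<pi> [0..<n]) (label t (map \<sigma> [0..<n])) = label t (map ((!) (map \<pi> [0..<n])) (map \<sigma> [0..<n]))"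
    using x(2) by (intro rename_label) auto
  also have "map ((!) (map \<pi> [0..<n])) (map \<sigma> [0..<n]) = map (\<pi> \<circ> \<sigma>) [0..<n]"
    using \<open>\<And>i. i < n \<Longrightarrow> \<sigma> i < n\<close> by simp
  finally show ?thesis
    using x by (simp add: free_operad_def word_of_def del: map_map)
qed

text \<open>Operadic composition as substitution: the word put in for variable \<open>i\<close> has
  its own variables moved to the \<open>i\<close>-th block of the \<open>sum_list ks\<close> inputs.
  No permutation has to be computed, because the variables of \<open>u\<close> already say which
  word goes where.\<close>

definition wcomp :: "nat list \<Rightarrow> word \<Rightarrow> word list \<Rightarrow> word" where
  "wcomp ks u vs = wsubst (map2 rename (blocks ks [0..<sum_list ks]) vs) u"

lemma arity_graft: "length ts = arity t \<Longrightarrow> arity (graft t ts) = sum_list (map arity ts)"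
proof (induction t arbitrary: ts)
  case Unit
  then show ?case by (cases ts) auto
next
  case (Bin s t)
  have "sum_list (map arity ts) = sum_list (map arity (take (arity s) ts @ drop (arity s) ts))"
    by simp
  then show ?case using Bin by (simp del: append_take_drop_id)
qed auto

text \<open>Grafting is substitution once leaves are labelled. The data are linked only through
  \<open>map2 label ts lss = map ((!) ws) js\<close>: the labelled tree grafted at a leaf is the
  word assigned to the label of that leaf. This is general enough for the induction to cut the lists
  at \<open>arity s\<close>.\<close>

lemma label_graft:
  assumes "length js = arity t" "length ts = arity t"
    and "map arity ts = map length lss" "map2 label ts lss = map ((!) ws) js"
  shows "label (graft t ts) (concat lss) = wsubst ws (label t js)"
  using assms
proof (induction t arbitrary: js ts lss)
  case Unit
  then show ?case by (cases js; cases ts; cases lss) auto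
next
  case Nul
  then show ?case by auto
next
  case (Bin s t)
  let ?n = "arity s"
  have l: "length (concat (take ?n lss)) = arity (graft s (take ?n ts))"
    using Bin.prems by (simp add: arity_graft length_concat take_map flip: take_map)
  have c: "concat lss = concat (take ?n lss) @ concat (drop ?n lss)"
    by (metis append_take_drop_id concat_append)
  have "label (graft s (take ?n ts)) (concat (take ?n lss)) = wsubst ws (label s (take ?n js))"
    using Bin.prems by (intro Bin.IH) (auto simp flip: take_map take_zip)
  moreover have "label (graft t (drop ?n ts)) (concat (drop ?n lss)) = wsubst ws (label t (drop ?n js))"
    using Bin.prems by (intro Bin.IH) (auto simp flip: drop_map drop_zip)
  ultimately show ?case by (simp add: c flip: l)
qed

text \<open>The list of inputs behind \<open>comp_perm\<close> is the list of leaves of the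
  substituted word, so composition in the free operad is \<open>wcomp\<close> read through
  \<open>ptree_of\<close>. Later computations use words instead.\<close>

lemma comp_eq_ptree_of:
  assumes "x \<in> level (length ks)" "list_all2 (\<lambda>k x. x \<in> level k) ks xs"
  shows "compS free_operad ks x xs = ptree_of (wcomp ks (word_of x) (map word_of xs))"
    and "linear (sum_list ks) (wcomp ks (word_of x) (map word_of xs))"
proof -
  let ?n = "length ks"
  obtain \<sigma> t where x: "x = (\<sigma>, t)" "arity t = ?n" "\<sigma> permutes {..<?n}" using assms by auto
  have \<sigma>: "\<sigma> j < ?n" if "j < ?n" for j using that permutes_in_image[OF x(3)] by simp
  have len: "length xs = ?n" using assms(2) by (simp add: list_all2_lengthD)
  have lev: "xs ! i \<in> level (ks ! i)" if "i < ?n" for i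
    using assms(2) that by (simp add: list_all2_conv_all_nth)
  \<comment> \<open>The labels of the \<open>i\<close>-th tree after its variables have been moved
    to the \<open>i\<close>-th block; these are the lists that \<open>comp_perm\<close>
    concatenates.\<close>
  define L where "L i = map (\<lambda>r. sum_list (take i ks) + fst (xs ! i) r) [0..<ks ! i]" for i
  define ws where "ws = map2 rename (blocks ks [0..<sum_list ks]) (map word_of xs)"
  define w where "w = wcomp ks (word_of x) (map word_of xs)"
  have L: "length (L i) = arity (snd (xs ! i))" and ws: "ws ! i = label (snd (xs ! i)) (L i)"
    and msL: "mset (L i) = mset (blocks ks [0..<sum_list ks] ! i)" if i: "i < ?n" for i
  proof -
    obtain \<tau> s where xi: "xs ! i = (\<tau>, s)" "arity s = ks ! i" "\<tau> permutes {..<ks ! i}"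
      using lev[OF i] by auto
    have \<tau>: "\<tau> r < ks ! i" if "r < ks ! i" for r using that permutes_in_image[OF xi(3)] by simp
    show "length (L i) = arity (snd (xs ! i))" using xi by (simp add: L_def)
    have "ws ! i = rename (blocks ks [0..<sum_list ks] ! i) (word_of (xs ! i))"
      using i len by (simp add: ws_def)
    also have "\<dots> = label s (map ((!) (blocks ks [0..<sum_list ks] ! i)) (map \<tau> [0..<ks ! i]))"
      using xi \<tau> i by (simp add: word_of_def rename_label image_subset_iff)
    also have "map ((!) (blocks ks [0..<sum_list ks] ! i)) (map \<tau> [0..<ks ! i]) = L i"
      using xi \<tau> i by (simp add: L_def blocks_upt)
    finally show "ws ! i = label (snd (xs ! i)) (L i)" using xi by simp
    have "L i = map ((+) (sum_list (take i ks))) (map \<tau> [0..<ks ! i])"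
      using xi by (simp add: L_def)
    then have "mset (L i) = image_mset ((+) (sum_list (take i ks))) (mset (map \<tau> [0..<ks ! i]))"
      by (simp only: mset_map)
    also have "\<dots> = mset (map ((+) (sum_list (take i ks))) [0..<ks ! i])"
      by (subst permutes_map_upt[OF xi(3)]) (simp only: mset_map)
    also have "map ((+) (sum_list (take i ks))) [0..<ks ! i] = blocks ks [0..<sum_list ks] ! i"
      using i by (intro nth_equalityI) (simp_all add: blocks_upt)
    finally show "mset (L i) = mset (blocks ks [0..<sum_list ks] ! i)" .
  qed
  \<comment> \<open>Leaf \<open>j\<close> of \<open>t\<close> carries the variable
    \<open>\<sigma> j\<close>, so the tree grafted there is number
    \<open>\<sigma> j\<close>.\<close>
  define lss where "lss = map (\<lambda>j. L (\<sigma> j)) [0..<?n]"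
  define ts where "ts = permute_list \<sigma> (map snd xs)"
  have ts: "ts = map (\<lambda>j. snd (xs ! \<sigma> j)) [0..<?n]"
    using len \<sigma> by (auto simp: ts_def permute_list_def)
  have "label (graft t ts) (concat lss) = wsubst ws (label t (map \<sigma> [0..<?n]))"
    using x \<sigma> by (intro label_graft) (auto simp: ts lss_def L ws intro!: nth_equalityI)
  then have lab: "label (graft t ts) (concat lss) = w"
    by (simp add: w_def wcomp_def ws_def x word_of_def)
  have "map length lss = map arity ts"
    using \<sigma> by (simp add: lss_def ts L)
  then have ar: "length (concat lss) = arity (graft t ts)"
    using x ts by (simp add: arity_graft length_concat)
  then have lw: "leaves w = concat lss" and sw: "shape w = graft t ts"
    by (simp_all flip: lab)
  \<comment> \<open>Each \<open>L i\<close> rearranges the \<open>i\<close>-th block, and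
    \<open>\<sigma>\<close> rearranges the blocks; the multiset of all labels is unchanged, which
    gives linearity.\<close>
  have "mset (concat lss) = mset (concat (map L (map \<sigma> [0..<?n])))"
    by (simp add: lss_def comp_def)
  also have "\<dots> = mset (concat (map L [0..<?n]))"
    by (rule mset_concat_map) (rule permutes_map_upt[OF x(3)])
  also have "\<dots> = mset (concat (blocks ks [0..<sum_list ks]))"
  proof -
    have "map (\<lambda>i. mset (L i)) [0..<?n] = map mset (blocks ks [0..<sum_list ks])"
      by (rule nth_equalityI) (auto simp: msL)
    then show ?thesis by (simp only: mset_concat map_map comp_def)
  qed
  finally have ms: "mset (concat lss) = mset [0..<sum_list ks]"
    by simp
  then show lin: "linear (sum_list ks) (wcomp ks (word_of x) (map word_of xs))"
    by (simp add: linear_def lw flip: w_def)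
  have inp: "concat (map (\<lambda>j. map (\<lambda>r. sum_list (take (\<sigma> j) ks) + (map fst xs ! \<sigma> j) r) [0..<ks ! \<sigma> j]) [0..<?n])
    = concat lss"
    using \<sigma> len by (auto simp: lss_def L_def intro!: arg_cong[of _ _ concat])
  have "comp_perm ks \<sigma> (map fst xs) = (\<lambda>i. if i < sum_list ks then concat lss ! i else i)"
    unfolding comp_perm_def inp by simp
  then show "compS free_operad ks x xs = ptree_of (wcomp ks (word_of x) (map word_of xs))"
    unfolding w_def[symmetric]
    using mset_eq_length[OF ms] by (simp add: free_operad_def x ptree_of_def lw sw ts_def cong: if_cong)
qed

lemma comp_level:
  assumes "x \<in> level (length ks)" "list_all2 (\<lambda>k x. x \<in> level k) ks xs"
  shows "compS free_operad ks x xs \<in> level (sum_list ks)"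
    and "word_of (compS free_operad ks x xs) = wcomp ks (word_of x) (map word_of xs)"
  using comp_eq_ptree_of[OF assms] ptree_of_level by auto

section \<open>Coherence\<close>

text \<open>Insertions commute, so the normal form reached depends on the multiset of variables
  only. This is why the actions of \<open>u\<close> and \<open>v\<close> have the same codomain when
  a canonical map connects the two words.\<close>

lemma foldr_insort_mset:
  fixes xs ys :: "'b::linorder list"
  assumes "mset xs = mset ys"
  shows "foldr insort xs zs = foldr insort ys zs"
proof -
  have "fold insort (rev xs) = fold insort (rev ys)"
    using assms by (intro fold_multiset_equiv) (auto simp: fun_eq_iff intro: insort_left_comm)
  then show ?thesis by (simp add: foldr_conv_fold)
qed

lemma (in symmetric_monoidal_category) pentagon_inv:
  assumes [simp]: "X \<in> mobj M" "Y \<in> mobj M" "Z \<in> mobj M" "W \<in> mobj M"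
  shows "\<a>i X Y (Z \<otimes> W) \<cdot> \<a>i (X \<otimes> Y) Z W \<cdot> (\<a> X Y Z \<odot> ide W) = (ide X \<odot> \<a>i Y Z W) \<cdot> \<a>i X (Y \<otimes> Z) W"
    (is "?l = ?r")
proof (rule iso_cancel_right[of "\<a> X (Y \<otimes> Z) W \<cdot> (ide X \<odot> \<a> Y Z W)"])
  have "?l \<cdot> \<a> X (Y \<otimes> Z) W \<cdot> (ide X \<odot> \<a> Y Z W) = ide (X \<otimes> Y \<otimes> Z \<otimes> W)"
    by (simp flip: pentagon)
  then show "?l \<cdot> \<a> X (Y \<otimes> Z) W \<cdot> (ide X \<odot> \<a> Y Z W) = ?r \<cdot> \<a> X (Y \<otimes> Z) W \<cdot> (ide X \<odot> \<a> Y Z W)"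
    by simp
qed simp_all

text \<open>A total assignment of objects to variables, so that every word and every list of
  variables has a value without side conditions on the range. For a list of objects it will be
  \<open>env\<close>, which continues the list by the unit object.\<close>

locale smc_env = symmetric_monoidal_category M for M :: "('o, 'a) smc" +
  fixes e :: "nat \<Rightarrow> 'o"
  assumes e_obj [simp]: "e i \<in> mobj M"
begin

primrec W :: "word \<Rightarrow> 'o" where
  "W (WVar i) = e i"
| "W WNul = \<I>"
| "W (WBin u v) = W u \<otimes> W v"

primrec nf :: "nat list \<Rightarrow> 'o" where
  "nf [] = \<I>"
| "nf (z # zs) = e z \<otimes> nf zs"

text \<open>Follows \<open>insort\<close> on lists: \<open>x\<close> is carried past each smaller
  entry and stops in front of the first entry that is at least \<open>x\<close>.\<close>

primrec ins :: "nat \<Rightarrow> nat list \<Rightarrow> 'a" where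
  "ins x [] = ide (e x \<otimes> \<I>)"
| "ins x (z # zs) = (if x \<le> z then ide (e x \<otimes> e z \<otimes> nf zs)
     else (ide (e z) \<odot> ins x zs) \<cdot> past (e x) (e z) (nf zs))"

text \<open>
  The action of a word on normal forms, which inserts its variables one after the other.
\<close>

primrec act :: "word \<Rightarrow> nat list \<Rightarrow> 'a" where
  "act (WVar x) zs = ins x zs"
| "act WNul zs = \<l> (nf zs)"
| "act (WBin u v) zs = act u (foldr insort (leaves v) zs) \<cdot> (ide (W u) \<odot> act v zs) \<cdot> \<a>i (W u) (W v) (nf zs)"

lemma W_obj [simp]: "W u \<in> mobj M"
  by (induction u) auto

lemma nf_obj [simp]: "nf zs \<in> mobj M"
  by (induction zs) auto

lemma ins_simps [simp]:
  "ins x zs \<in> marr M" "mdom M (ins x zs) = e x \<otimes> nf zs" "mcod M (ins x zs) = nf (insort x zs)"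
  "isom (ins x zs)"
  by (induction zs) auto

lemma act_simps [simp]:
  "act u zs \<in> marr M" "mdom M (act u zs) = W u \<otimes> nf zs" "mcod M (act u zs) = nf (foldr insort (leaves u) zs)"
  "isom (act u zs)"
  by (induction u arbitrary: zs) auto

text \<open>Two insertions in either order agree up to the exchange of the two variables. It is
  enough to treat \<open>x < y\<close>: the opposite order follows by inverting the swap, and equal
  variables do not occur in a word without repetitions.\<close>

lemma ins_ins:
  assumes "x < y"
  shows "ins x (insort y zs) \<cdot> (ide (e x) \<odot> ins y zs) =
    ins y (insort x zs) \<cdot> (ide (e y) \<odot> ins x zs) \<cdot> past (e x) (e y) (nf zs)"
proof (induction zs)
  case Nil
  then show ?case using assms by (simp add: past_past)
next
  case (Cons z zs)
  show ?case
  proof (cases "x \<le> z")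
    case True
    \<comment> \<open>As \<open>x\<close> is at most \<open>y\<close> and \<open>z\<close>, it stays
      in front in either order. On the right-hand side \<open>y\<close> then has to pass
      \<open>x\<close>, and this cancels against \<open>past (e x) (e y)\<close>.\<close>
    have "ins x (insort y (z # zs)) = ide (e x \<otimes> nf (insort y (z # zs)))"
      using True assms by simp
    moreover have "ins y (insort x (z # zs)) = (ide (e x) \<odot> ins y (z # zs)) \<cdot> past (e y) (e x) (nf (z # zs))"
      using True assms by simp
    moreover have "ins x (z # zs) = ide (e x \<otimes> nf (z # zs))"
      using True by simp
    ultimately show ?thesis
      by (simp add: past_past del: ins.simps insort_key.simps nf.simps)
  next
    \<comment> \<open>Both variables pass \<open>z\<close>. Naturality brings the passages together,
      the induction hypothesis exchanges the insertions into \<open>zs\<close>, and Yang-Baxter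
      reorders the three crossings.\<close>
    case False
    let ?A = "ins y (insort x zs)" and ?B = "ide (e y) \<odot> ins x zs" and ?n = "nf zs"
    have n1: "past (e x) (e z) (nf (insort y zs)) \<cdot> (ide (e x) \<odot> (ide (e z) \<odot> ins y zs))
      = (ide (e z) \<odot> (ide (e x) \<odot> ins y zs)) \<cdot> past (e x) (e z) (e y \<otimes> ?n)"
      using past_natural[of "ide (e x)" "ide (e z)" "ins y zs"] by simp
    have n2: "past (e y) (e z) (nf (insort x zs)) \<cdot> (ide (e y) \<odot> (ide (e z) \<odot> ins x zs))
      = (ide (e z) \<odot> ?B) \<cdot> past (e y) (e z) (e x \<otimes> ?n)"
      using past_natural[of "ide (e y)" "ide (e z)" "ins x zs"] by simp
    have "ins x (insort y (z # zs)) \<cdot> (ide (e x) \<odot> ins y (z # zs)) =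
      (ide (e z) \<odot> ins x (insort y zs)) \<cdot> past (e x) (e z) (nf (insort y zs)) \<cdot>
        (ide (e x) \<odot> (ide (e z) \<odot> ins y zs)) \<cdot> (ide (e x) \<odot> past (e y) (e z) ?n)"
      using False assms by simp
    also have "\<dots> = (ide (e z) \<odot> ins x (insort y zs)) \<cdot> (ide (e z) \<odot> (ide (e x) \<odot> ins y zs)) \<cdot>
        past (e x) (e z) (e y \<otimes> ?n) \<cdot> (ide (e x) \<odot> past (e y) (e z) ?n)"
      using reassoc[OF n1, of "ide (e x) \<odot> past (e y) (e z) ?n"] by (simp del: interchange interchange_reassoc)
    also have "\<dots> = (ide (e z) \<odot> (ins x (insort y zs) \<cdot> (ide (e x) \<odot> ins y zs))) \<cdot>
        past (e x) (e z) (e y \<otimes> ?n) \<cdot> (ide (e x) \<odot> past (e y) (e z) ?n)"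
      by simp
    also have "\<dots> = (ide (e z) \<odot> ?A) \<cdot> (ide (e z) \<odot> ?B) \<cdot> (ide (e z) \<odot> past (e x) (e y) ?n) \<cdot>
        past (e x) (e z) (e y \<otimes> ?n) \<cdot> (ide (e x) \<odot> past (e y) (e z) ?n)"
      unfolding Cons.IH by simp
    also have "\<dots> = (ide (e z) \<odot> ?A) \<cdot> (ide (e z) \<odot> ?B) \<cdot> past (e y) (e z) (e x \<otimes> ?n) \<cdot>
        (ide (e y) \<odot> past (e x) (e z) ?n) \<cdot> past (e x) (e y) (e z \<otimes> ?n)"
      by (subst yang_baxter) simp_all
    also have "\<dots> = (ide (e z) \<odot> ?A) \<cdot> past (e y) (e z) (nf (insort x zs)) \<cdot> (ide (e y) \<odot> (ide (e z) \<odot> ins x zs)) \<cdot>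
        (ide (e y) \<odot> past (e x) (e z) ?n) \<cdot> past (e x) (e y) (e z \<otimes> ?n)"
      using reassoc[OF n2, of "(ide (e y) \<odot> past (e x) (e z) ?n) \<cdot> past (e x) (e y) (e z \<otimes> ?n)"]
      by (simp del: interchange interchange_reassoc)
    also have "\<dots> = ins y (insort x (z # zs)) \<cdot> (ide (e y) \<odot> ins x (z # zs)) \<cdot> past (e x) (e y) (nf (z # zs))"
      using False assms by simp
    finally show ?thesis .
  qed
qed

text \<open>The guard is essential: the swap of \<open>x\<close> with itself runs from
  \<open>WBin (WVar x) (WVar x)\<close> to the same word and need not act as the identity does. The
  equality of multisets passes the guard on from \<open>u\<close> to \<open>v\<close> and makes the
  two actions end at the same normal form.\<close>

definition coherent :: "word \<Rightarrow> word \<Rightarrow> 'a \<Rightarrow> bool" where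
  "coherent u v f \<longleftrightarrow> isom f \<and> mdom M f = W u \<and> mcod M f = W v \<and> mset (leaves u) = mset (leaves v) \<and>
     (distinct (leaves u) \<longrightarrow> (\<forall>zs. act v zs \<cdot> (f \<odot> ide (nf zs)) = act u zs))"

lemma coherentD:
  assumes "coherent u v f"
  shows "isom f" "f \<in> marr M" "mdom M f = W u" "mcod M f = W v" "mset (leaves u) = mset (leaves v)"
    "distinct (leaves u) \<Longrightarrow> distinct (leaves v)"
    "distinct (leaves u) \<Longrightarrow> act v zs \<cdot> (f \<odot> ide (nf zs)) = act u zs"
    "foldr insort (leaves v) zs = foldr insort (leaves u) zs"
  using assms foldr_insort_mset[of "leaves u" "leaves v" zs] mset_eq_imp_distinct_iff[of "leaves u" "leaves v"]
  by (auto simp: coherent_def iso_arr)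

text \<open>As \<open>act v []\<close> is invertible, the action on the empty list determines
  \<open>f\<close> tensored with the identity of the unit object, and tensoring with the unit object
  is faithful.\<close>

lemma coherent_unique:
  assumes f: "coherent u v f" and g: "coherent u v g" and d: "distinct (leaves u)"
  shows "f = g"
proof (rule tensor_unit_cancel)
  note f = coherentD[OF f] and g = coherentD[OF g]
  show "f \<odot> ide \<I> = g \<odot> ide \<I>"
    by (rule iso_cancel_left[of "act v []"])
      (use f(7)[OF d, of "[]"] g(7)[OF d, of "[]"] f(1-4) g(1-4) in simp_all)
qed (use coherentD[OF f] coherentD[OF g] in simp_all)

lemma coherent_id: "coherent u u (ide (W u))"
  by (simp add: coherent_def)

lemma coherent_comp:
  assumes "coherent u v f" "coherent v w g"
  shows "coherent u w (g \<cdot> f)"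
proof -
  note f = coherentD[OF assms(1)] and g = coherentD[OF assms(2)]
  have "act w zs \<cdot> ((g \<cdot> f) \<odot> ide (nf zs)) = act u zs" if d: "distinct (leaves u)" for zs
  proof -
    have "act w zs \<cdot> ((g \<cdot> f) \<odot> ide (nf zs)) = (act w zs \<cdot> (g \<odot> ide (nf zs))) \<cdot> (f \<odot> ide (nf zs))"
      using f(2-4) g(2-4) g(8) by simp
    also have "\<dots> = act u zs"
      using f(7)[OF d] g(7)[OF f(6)[OF d]] by (simp only:)
    finally show ?thesis .
  qed
  then show ?thesis
    using f g by (simp add: coherent_def)
qed

lemma coherent_inv:
  assumes "coherent u v f"
  shows "coherent v u (inva f)"
proof -
  note f = coherentD[OF assms]
  have "act u zs \<cdot> (inva f \<odot> ide (nf zs)) = act v zs" if "distinct (leaves v)" for zs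
  proof -
    have d: "distinct (leaves u)" using that mset_eq_imp_distinct_iff[OF f(5)] by simp
    have "act u zs \<cdot> (inva f \<odot> ide (nf zs)) = (act v zs \<cdot> (f \<odot> ide (nf zs))) \<cdot> (inva f \<odot> ide (nf zs))"
      using f(7)[OF d] by (simp only:)
    also have "\<dots> = act v zs" using f(1-4) by simp
    finally show ?thesis .
  qed
  then show ?thesis
    using f by (simp add: coherent_def)
qed

text \<open>By naturality of the associator \<open>f\<close> and \<open>g\<close> can be treated one
  after the other: \<open>g\<close> in front of the action on \<open>zs\<close>, \<open>f\<close> in
  front of the action on the result.\<close>

lemma coherent_tensor:
  assumes "coherent u u' f" "coherent v v' g"
  shows "coherent (WBin u v) (WBin u' v') (f \<odot> g)"
proof -
  note f = coherentD[OF assms(1)] and g = coherentD[OF assms(2)]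
  have "act (WBin u' v') zs \<cdot> ((f \<odot> g) \<odot> ide (nf zs)) = act (WBin u v) zs"
    if d: "distinct (leaves u)" "distinct (leaves v)" for zs
  proof -
    let ?zs = "foldr insort (leaves v) zs"
    have "act (WBin u' v') zs \<cdot> ((f \<odot> g) \<odot> ide (nf zs))
      = act u' ?zs \<cdot> (ide (W u') \<odot> act v' zs) \<cdot> \<a>i (W u') (W v') (nf zs) \<cdot> ((f \<odot> g) \<odot> ide (nf zs))"
      using f(2-4) g(2-4) g(8) by simp
    also have "\<dots> = act u' ?zs \<cdot> (ide (W u') \<odot> act v' zs) \<cdot> (f \<odot> (g \<odot> ide (nf zs))) \<cdot> \<a>i (W u) (W v) (nf zs)"
      using assoc_inv_natural[of f g "ide (nf zs)"] f(2-4) g(2-4) by simp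
    also have "\<dots> = act u' ?zs \<cdot> (f \<odot> act v zs) \<cdot> \<a>i (W u) (W v) (nf zs)"
      using g(7)[OF d(2)] f(2-4) g(2-4) g(8) by simp
    also have "\<dots> = (act u' ?zs \<cdot> (f \<odot> ide (nf ?zs))) \<cdot> (ide (W u) \<odot> act v zs) \<cdot> \<a>i (W u) (W v) (nf zs)"
      using f(2-4) f(8) by simp
    also have "\<dots> = act (WBin u v) zs"
      using f(7)[OF d(1)] by simp
    finally show ?thesis .
  qed
  then show ?thesis
    using f(1-5) g(1-5) by (auto simp: coherent_def simp del: act.simps)
qed

text \<open>The action of a product is built from associators, so this is the pentagon in the form
  \<open>pentagon_inv\<close>. Likewise \<open>coherent_lunit\<close> rests on
  \<open>lunit_tensor\<close>, and \<open>coherent_runit\<close> on the triangle.\<close>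

lemma coherent_assoc: "coherent (WBin u (WBin v w)) (WBin (WBin u v) w) (\<a> (W u) (W v) (W w))"
proof -
  have "act (WBin (WBin u v) w) zs \<cdot> (\<a> (W u) (W v) (W w) \<odot> ide (nf zs)) = act (WBin u (WBin v w)) zs" for zs
  proof -
    let ?a = "\<a>i (W u) (W v)" and ?n = "nf zs" and ?zs = "foldr insort (leaves w) zs"
    let ?F = "act u (foldr insort (leaves v) ?zs)" and ?G = "ide (W u) \<odot> act v ?zs" and ?H = "act w zs"
    let ?K = "\<a>i (W u \<otimes> W v) (W w) ?n \<cdot> (\<a> (W u) (W v) (W w) \<odot> ide ?n)"
    have n: "?a (nf ?zs) \<cdot> (ide (W u \<otimes> W v) \<odot> ?H) = (ide (W u) \<odot> (ide (W v) \<odot> ?H)) \<cdot> ?a (W w \<otimes> ?n)"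
      using assoc_inv_natural[of "ide (W u)" "ide (W v)" ?H] by simp
    have "act (WBin (WBin u v) w) zs \<cdot> (\<a> (W u) (W v) (W w) \<odot> ide ?n)
      = ?F \<cdot> ?G \<cdot> ?a (nf ?zs) \<cdot> (ide (W u \<otimes> W v) \<odot> ?H) \<cdot> ?K"
      by simp
    also have "\<dots> = ?F \<cdot> ?G \<cdot> (ide (W u) \<odot> (ide (W v) \<odot> ?H)) \<cdot> ?a (W w \<otimes> ?n) \<cdot> ?K"
      using reassoc[OF n, of ?K] by simp
    also have "\<dots> = ?F \<cdot> ?G \<cdot> (ide (W u) \<odot> (ide (W v) \<odot> ?H)) \<cdot> (ide (W u) \<odot> \<a>i (W v) (W w) ?n) \<cdot> \<a>i (W u) (W v \<otimes> W w) ?n"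
      by (simp only: pentagon_inv W_obj nf_obj)
    also have "\<dots> = act (WBin u (WBin v w)) zs"
      by simp
    finally show ?thesis .
  qed
  then show ?thesis by (simp add: coherent_def del: act.simps)
qed

lemma coherent_lunit: "coherent (WBin WNul u) u (\<l> (W u))"
proof -
  have "act u zs \<cdot> (\<l> (W u) \<odot> ide (nf zs)) = act (WBin WNul u) zs" for zs
  proof -
    have "act (WBin WNul u) zs = act u zs \<cdot> \<l> (W u \<otimes> nf zs) \<cdot> \<a>i \<I> (W u) (nf zs)"
      using reassoc[OF lunit_natural[of "act u zs"], of "\<a>i \<I> (W u) (nf zs)"] by simp
    also have "\<dots> = act u zs \<cdot> (\<l> (W u) \<odot> ide (nf zs))"
      by (simp flip: lunit_tensor)
    finally show ?thesis by simp
  qed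
  then show ?thesis by (simp add: coherent_def del: act.simps)
qed

lemma coherent_runit: "coherent (WBin u WNul) u (\<r> (W u))"
proof -
  have "act u zs \<cdot> (\<r> (W u) \<odot> ide (nf zs)) = act (WBin u WNul) zs" for zs
    by (simp flip: triangle)
  then show ?thesis by (simp add: coherent_def del: act.simps)
qed

lemma inv_swap: "X \<in> mobj M \<Longrightarrow> Y \<in> mobj M \<Longrightarrow> inva (\<s> X Y) = \<s> Y X"
  by (rule inv_arr_eq) (auto simp: inverse_arr_def in_hom_def symmetry)

lemma coherent_swap_sym:
  "coherent (WBin u v) (WBin v u) (\<s> (W u) (W v)) \<Longrightarrow> coherent (WBin v u) (WBin u v) (\<s> (W v) (W u))"
  using coherent_inv[of "WBin u v" "WBin v u" "\<s> (W u) (W v)"] by (simp add: inv_swap)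

text \<open>The place where \<open>ins_ins\<close>, and with it Yang-Baxter, enters.\<close>

lemma coherent_swap_less:
  assumes "x < y"
  shows "coherent (WBin (WVar x) (WVar y)) (WBin (WVar y) (WVar x)) (\<s> (e x) (e y))"
proof -
  have "act (WBin (WVar y) (WVar x)) zs \<cdot> (\<s> (e x) (e y) \<odot> ide (nf zs)) = act (WBin (WVar x) (WVar y)) zs" for zs
  proof -
    have "act (WBin (WVar x) (WVar y)) zs = (ins x (insort y zs) \<cdot> (ide (e x) \<odot> ins y zs)) \<cdot> \<a>i (e x) (e y) (nf zs)"
      by simp
    also have "\<dots> = act (WBin (WVar y) (WVar x)) zs \<cdot> (\<s> (e x) (e y) \<odot> ide (nf zs))"
      unfolding ins_ins[OF assms] by (simp add: past_def insort_left_comm)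
    finally show ?thesis by simp
  qed
  then show ?thesis by (simp add: coherent_def del: act.simps)
qed

text \<open>The source repeats its variable, so no compatibility with the actions is
  demanded.\<close>

lemma coherent_swap_nonlinear: "coherent (WBin (WVar x) (WVar x)) (WBin (WVar x) (WVar x)) (\<s> (e x) (e x))"
  by (simp add: coherent_def)

lemma coherent_swap_unit: "coherent (WBin u WNul) (WBin WNul u) (\<s> (W u) \<I>)"
proof -
  have "\<s> (W u) \<I> = inva (\<l> (W u)) \<cdot> \<r> (W u)"
    using unit_symmetry[of "W u"] by (intro iso_move_left) auto
  then show ?thesis
    using coherent_comp[OF coherent_runit coherent_inv[OF coherent_lunit]] by simp
qed

text \<open>The hexagon solved for the swap of \<open>u \<otimes> v\<close> with \<open>w\<close>;
  the other factors are coherent by assumption or by the closure properties.\<close>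

lemma coherent_swap_tensor:
  assumes "coherent (WBin u w) (WBin w u) (\<s> (W u) (W w))" "coherent (WBin v w) (WBin w v) (\<s> (W v) (W w))"
  shows "coherent (WBin (WBin u v) w) (WBin w (WBin u v)) (\<s> (W u \<otimes> W v) (W w))"
proof -
  have "\<s> (W u \<otimes> W v) (W w) = \<a>i (W w) (W u) (W v) \<cdot>
    ((\<s> (W u) (W w) \<odot> ide (W v)) \<cdot> \<a> (W u) (W w) (W v) \<cdot> (ide (W u) \<odot> \<s> (W v) (W w))) \<cdot> \<a>i (W u) (W v) (W w)"
    by (simp flip: hexagon)
  moreover have "coherent (WBin (WBin u v) w) (WBin w (WBin u v)) \<dots>"
    by (rule coherent_comp[OF coherent_comp[OF coherent_inv[OF coherent_assoc]
      coherent_comp[OF coherent_comp[OF coherent_tensor[OF coherent_id assms(2)] coherent_assoc]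
        coherent_tensor[OF assms(1) coherent_id]]] coherent_inv[OF coherent_assoc]])
  ultimately show ?thesis by simp
qed

text \<open>The hexagon splits a product in the first argument only. A product in the second
  argument is moved to the first by symmetry, which explains the outer induction on \<open>v\<close>
  and, for a single variable, the inner one on \<open>u\<close>.\<close>

lemma coherent_swap: "coherent (WBin u v) (WBin v u) (\<s> (W u) (W v))"
proof (induction v arbitrary: u)
  case (WVar y)
  show ?case
  proof (induction u)
    case (WVar x)
    consider "x < y" | "y < x" | "x = y" by linarith
    then show ?case
      using coherent_swap_less[of x y] coherent_swap_less[of y x, THEN coherent_swap_sym[of "WVar y" "WVar x", simplified]]
        coherent_swap_nonlinear by cases simp_all
  next
    case WNul
    then show ?case using coherent_swap_sym[OF coherent_swap_unit[of "WVar y", folded W.simps]] by simp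
  next
    case (WBin u v)
    then show ?case using coherent_swap_tensor[of u "WVar y" v] by simp
  qed
next
  case WNul
  then show ?case using coherent_swap_unit by simp
next
  case (WBin v w)
  have "coherent (WBin (WBin v w) u) (WBin u (WBin v w)) (\<s> (W v \<otimes> W w) (W u))"
    using WBin.IH by (intro coherent_swap_tensor) (rule coherent_swap_sym; simp)+
  then show ?case using coherent_swap_sym[of "WBin v w" u] by simp
qed

lemma wobj_W:
  "(\<And>i. i < length As \<Longrightarrow> e i = As ! i) \<Longrightarrow> wvars u \<subseteq> {..<length As} \<Longrightarrow> wobj M u As = W u"
  by (induction u) auto

end

section \<open>Uniqueness of canonical maps\<close>

lemma canonical_wvars:
  "canonical M n u v \<eta> \<Longrightarrow> wvars u \<subseteq> {..<n} \<and> wvars v \<subseteq> {..<n}"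
  by (induction rule: canonical.induct) auto

lemma canonical_extensional: "canonical M n u v \<eta> \<Longrightarrow> \<eta> \<in> extensional (Obj (power_cat (mcat M) n))"
  by (cases rule: canonical.cases) auto

lemma (in smc_env) canonical_coherent:
  assumes "canonical M n u v \<eta>" "length As = n" "\<And>i. i < n \<Longrightarrow> e i = As ! i"
  shows "coherent u v (\<eta> As)"
proof -
  have As [simp]: "set As \<subseteq> mobj M"
    using assms(2,3) e_obj by (metis in_set_conv_nth subsetI)
  note [simp] = assms(2)
  have W: "wobj M u As = W u" if "wvars u \<subseteq> {..<n}" for u
    using wobj_W[of As u] assms(2,3) that by simp
  show ?thesis
    using assms(1)
  proof (induction rule: canonical.induct)
    case (can_inv u v \<eta>)
    then show ?case using coherent_inv by simp
  next
    case (can_comp u v \<eta> w \<theta>)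
    then show ?case using coherent_comp by simp
  next
    case (can_tensor u u' \<eta> v v' \<theta>)
    then show ?case using coherent_tensor by simp
  qed (simp_all add: W coherent_id coherent_assoc coherent_lunit coherent_runit coherent_swap)
qed

context symmetric_monoidal_category
begin

definition env :: "'o list \<Rightarrow> nat \<Rightarrow> 'o" where
  "env As i = (if i < length As then As ! i else \<I>)"

lemma env: "set As \<subseteq> mobj M \<Longrightarrow> smc_env M (env As)"
  by unfold_locales (auto simp: env_def)

text \<open>Distinctness is demanded of the formal variables; the list \<open>As\<close> may still
  repeat objects, because each list is treated through its own environment.\<close>

theorem coherence:
  assumes "canonical M n u v \<eta>" "canonical M n u v \<theta>" "distinct (leaves u)"
  shows "\<eta> = \<theta>"
proof (rule extensionalityI)
  show "\<eta> \<in> extensional (Obj (power_cat (mcat M) n))" "\<theta> \<in> extensional (Obj (power_cat (mcat M) n))"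
    using assms canonical_extensional by auto
  fix As assume As: "As \<in> Obj (power_cat (mcat M) n)"
  then interpret smc_env M "env As" by (intro env) auto
  show "\<eta> As = \<theta> As"
    using As assms by (intro coherent_unique canonical_coherent) (auto simp: env_def)
qed

text \<open>Source, target and invertibility are part of \<open>coherent\<close>, so they follow
  without a further induction over the derivation.\<close>

lemma canonical_in_hom:
  assumes "canonical M n u v \<eta>" "length As = n" "set As \<subseteq> mobj M"
  shows "\<eta> As \<in> marr M" "mdom M (\<eta> As) = wobj M u As" "mcod M (\<eta> As) = wobj M v As" "isom (\<eta> As)"
proof -
  interpret smc_env M "env As" by (rule env) fact
  have "coherent u v (\<eta> As)"
    using assms by (intro canonical_coherent) (auto simp: env_def)
  moreover have "wobj M u As = W u" "wobj M v As = W v"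
    using canonical_wvars[OF assms(1)] assms by (auto intro!: wobj_W simp: env_def)
  ultimately show "\<eta> As \<in> marr M" "mdom M (\<eta> As) = wobj M u As" "mcod M (\<eta> As) = wobj M v As" "isom (\<eta> As)"
    using coherentD by simp_all
qed

end

section \<open>The algebra of a symmetric monoidal category\<close>

lemma functor_cat_simps [simp]:
  "Obj (functor_cat C D) = {F. cat_functor C D F}"
  "Arr (functor_cat C D) = {\<eta>. nat_trans C D \<eta>}"
  "nat_trans C D \<eta> \<Longrightarrow> Dom (functor_cat C D) \<eta> = NSrc \<eta>"
  "nat_trans C D \<eta> \<Longrightarrow> Cod (functor_cat C D) \<eta> = NTgt \<eta>"
  "cat_functor C D F \<Longrightarrow> Ide (functor_cat C D) F =
    \<lparr>NSrc = F, NTgt = F, NCmp = (\<lambda>A\<in>Obj C. Ide D (FO F A))\<rparr>"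
  "nat_trans C D \<theta> \<Longrightarrow> nat_trans C D \<eta> \<Longrightarrow> NSrc \<theta> = NTgt \<eta> \<Longrightarrow> Cmp (functor_cat C D) \<theta> \<eta> =
    \<lparr>NSrc = NSrc \<eta>, NTgt = NTgt \<theta>, NCmp = (\<lambda>A\<in>Obj C. Cmp D (NCmp \<theta> A) (NCmp \<eta> A))\<rparr>"
  by (auto simp: functor_cat_def)

lemma in_hom_functor_cat:
  "in_hom (functor_cat C D) \<eta> F G \<longleftrightarrow> nat_trans C D \<eta> \<and> NSrc \<eta> = F \<and> NTgt \<eta> = G"
  by (auto simp: in_hom_def)

lemma End_simps [simp]:
  "Lev (End C) n = functor_cat (power_cat C n) C"
  "unitO (End C) = \<lparr>FO = (\<lambda>As\<in>Obj (power_cat C 1). hd As), FA = (\<lambda>fs\<in>Arr (power_cat C 1). hd fs)\<rparr>"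
  "compO (End C) = end_compO C" "compA (End C) = end_compA C"
  "actO (End C) = end_actO C" "actA (End C) = end_actA C"
  by (auto simp: End_def)

definition interpw :: "('o, 'a) smc \<Rightarrow> nat \<Rightarrow> word \<Rightarrow> ('o list, 'a list, 'o, 'a) func" where
  "interpw M n u = \<lparr>FO = (\<lambda>As\<in>Obj (power_cat (mcat M) n). wobj M u As),
     FA = (\<lambda>fs\<in>Arr (power_cat (mcat M) n). warr M u fs)\<rparr>"

lemma permute_list_map_nth: "length As = n \<Longrightarrow> permute_list \<sigma> As = map ((!) As) (map \<sigma> [0..<n])"
  by (simp add: permute_list_def)

lemma permute_list_in:
  assumes "\<sigma> permutes {..<n}" "length As = n" "set As \<subseteq> X"
  shows "length (permute_list \<sigma> As) = n" "set (permute_list \<sigma> As) \<subseteq> X"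
  using assms by auto

text \<open>Evaluating the tree at the permuted arguments is evaluating the labelled word at the
  given ones: the permutation is absorbed by the labels.\<close>

lemma interp_eq:
  assumes "x \<in> level n"
  shows "interp M x = interpw M n (word_of x)"
proof -
  obtain \<sigma> t where x: "x = (\<sigma>, t)" "arity t = n" "\<sigma> permutes {..<n}" using assms by auto
  have "tree_obj M t (permute_list \<sigma> As) = wobj M (word_of x) As" if "length As = n" for As
    using x that by (simp only: permute_list_map_nth word_of_def prod.case) (rule tree_obj_label, simp)
  moreover have "tree_arr M t (permute_list \<sigma> fs) = warr M (word_of x) fs" if "length fs = n" for fs
    using x that by (simp only: permute_list_map_nth word_of_def prod.case) (rule tree_arr_label, simp)
  ultimately show ?thesis
    using x by (auto simp: interp_def interpw_def end_actO_def intro!: restrict_ext)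
qed

section \<open>Existence of canonical maps\<close>

abbreviation linked :: "('o, 'a) smc \<Rightarrow> nat \<Rightarrow> word \<Rightarrow> word \<Rightarrow> bool" where
  "linked M n u v \<equiv> \<exists>\<eta>. canonical M n u v \<eta>"

abbreviation word_list :: "nat list \<Rightarrow> word" where
  "word_list xs \<equiv> foldr (\<lambda>x. WBin (WVar x)) xs WNul"

lemma wvars_word_list [simp]: "wvars (word_list xs) = set xs"
  by (induction xs) auto

lemma linked_refl: "wvars u \<subseteq> {..<n} \<Longrightarrow> linked M n u u"
  using can_id by blast

lemma linked_trans: "linked M n u v \<Longrightarrow> linked M n v w \<Longrightarrow> linked M n u w"
  using can_comp by blast

lemma linked_sym: "linked M n u v \<Longrightarrow> linked M n v u"
  using can_inv by blast

lemma linked_tensor: "linked M n u u' \<Longrightarrow> linked M n v v' \<Longrightarrow> linked M n (WBin u v) (WBin u' v')"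
  using can_tensor by blast

lemma linked_word_list_append:
  "set xs \<union> set ys \<subseteq> {..<n} \<Longrightarrow> linked M n (WBin (word_list xs) (word_list ys)) (word_list (xs @ ys))"
proof (induction xs)
  case Nil
  have "linked M n (WBin WNul (word_list ys)) (word_list ys)"
    by (rule exI, rule can_lunit) (use Nil in auto)
  then show ?case by simp
next
  case (Cons x xs)
  have 1: "linked M n (WBin (WBin (WVar x) (word_list xs)) (word_list ys)) (WBin (WVar x) (WBin (word_list xs) (word_list ys)))"
    by (rule exI, rule can_inv[OF can_assoc]) (use Cons.prems in auto)
  have 2: "linked M n (WBin (WVar x) (WBin (word_list xs) (word_list ys))) (WBin (WVar x) (word_list (xs @ ys)))"
    using Cons by (intro linked_tensor linked_refl) auto
  show ?case using linked_trans[OF 1 2] by simp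
qed

lemma linked_word_list_leaves: "wvars u \<subseteq> {..<n} \<Longrightarrow> linked M n u (word_list (leaves u))"
proof (induction u)
  case (WVar i)
  then show ?case using can_inv[OF can_runit[of "WVar i" n M]] by auto
next
  case WNul
  then show ?case using linked_refl[of WNul n M] by simp
next
  case (WBin u v)
  then have "linked M n (WBin u v) (WBin (word_list (leaves u)) (word_list (leaves v)))"
    by (intro linked_tensor) auto
  then show ?case
    using linked_trans linked_word_list_append[of "leaves u" "leaves v" n M] WBin.prems
    by (fastforce simp: wvars_leaves)
qed

text \<open>The head of \<open>xs\<close> is brought to the front of \<open>ys\<close> by one swap
  with the whole segment \<open>as\<close> before it; the remaining lists are matched by
  induction.\<close>

lemma linked_word_list_mset:
  "mset xs = mset ys \<Longrightarrow> set xs \<subseteq> {..<n} \<Longrightarrow> linked M n (word_list xs) (word_list ys)"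
proof (induction xs arbitrary: ys)
  case Nil
  then show ?case using linked_refl[of WNul n M] by simp
next
  case (Cons x xs)
  have "x \<in> set ys" using mset_eq_setD[OF Cons.prems(1)] by auto
  then obtain as bs where ys: "ys = as @ x # bs" by (meson split_list)
  have sub: "x < n" "set as \<subseteq> {..<n}" "set bs \<subseteq> {..<n}"
    using Cons.prems(2) mset_eq_setD[OF Cons.prems(1)] ys by auto
  have 1: "linked M n (word_list ys) (WBin (word_list as) (WBin (WVar x) (word_list bs)))"
    using linked_word_list_append[of as "x # bs" n M, THEN linked_sym] sub ys by auto
  have 2: "linked M n (WBin (word_list as) (WBin (WVar x) (word_list bs))) (WBin (WBin (word_list as) (WVar x)) (word_list bs))"
    by (rule exI, rule can_assoc) (use sub in auto)
  have 3: "linked M n (WBin (WBin (word_list as) (WVar x)) (word_list bs)) (WBin (WBin (WVar x) (word_list as)) (word_list bs))"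
    by (rule exI, rule can_tensor[OF can_swap can_id]) (use sub in auto)
  have 4: "linked M n (WBin (WBin (WVar x) (word_list as)) (word_list bs)) (WBin (WVar x) (WBin (word_list as) (word_list bs)))"
    by (rule exI, rule can_inv[OF can_assoc]) (use sub in auto)
  have 5: "linked M n (WBin (WVar x) (WBin (word_list as) (word_list bs))) (WBin (WVar x) (word_list (as @ bs)))"
    using sub by (intro linked_tensor linked_word_list_append linked_refl) auto
  have "linked M n (word_list (as @ bs)) (word_list xs)"
    using Cons ys by (intro linked_sym[OF Cons.IH]) auto
  then have 6: "linked M n (WBin (WVar x) (word_list (as @ bs))) (word_list (x # xs))"
    using sub linked_tensor[OF linked_refl, of "WVar x" n M] by simp
  show ?case
    by (rule linked_sym[OF linked_trans[OF 1 linked_trans[OF 2 linked_trans[OF 3 linked_trans[OF 4 linked_trans[OF 5 6]]]]]])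
qed

lemma canonical_exists:
  assumes "mset (leaves u) = mset (leaves v)" "wvars u \<subseteq> {..<n}"
  obtains \<eta> where "canonical M n u v \<eta>"
proof -
  have "wvars v \<subseteq> {..<n}" using assms mset_eq_setD[OF assms(1)] by (simp add: wvars_leaves)
  then have "linked M n u v"
    using linked_trans[OF linked_trans[OF linked_word_list_leaves linked_word_list_mset] linked_sym[OF linked_word_list_leaves]]
      assms by (simp add: wvars_leaves)
  then show ?thesis using that by blast
qed

text \<open>The rules for \<open>canonical\<close> produce component functions of a fixed form.
  Since these are extensional, any description that agrees on lists of objects may be used
  instead.\<close>

lemma canonical_cong:
  assumes "canonical M n u v \<eta>" "\<And>As. length As = n \<Longrightarrow> set As \<subseteq> mobj M \<Longrightarrow> \<eta> As = \<theta> As"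
  shows "canonical M n u v (\<lambda>As\<in>Obj (power_cat (mcat M) n). \<theta> As)"
proof -
  have "\<eta> = (\<lambda>As\<in>Obj (power_cat (mcat M) n). \<theta> As)"
    using assms canonical_extensional[OF assms(1)] by (intro extensionalityI) auto
  then show ?thesis using assms(1) by simp
qed

section \<open>Naturality and substitution of canonical maps\<close>

context symmetric_monoidal_category
begin

lemma wobj_obj [simp]:
  "set As \<subseteq> mobj M \<Longrightarrow> wvars u \<subseteq> {..<length As} \<Longrightarrow> wobj M u As \<in> mobj M"
  by (induction u) auto

lemma warr_simps [simp]:
  assumes "set fs \<subseteq> marr M" "wvars u \<subseteq> {..<length fs}"
  shows "warr M u fs \<in> marr M" "mdom M (warr M u fs) = wobj M u (map (mdom M) fs)"
    "mcod M (warr M u fs) = wobj M u (map (mcod M) fs)"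
  using assms by (induction u) auto

lemma warr_Cmp:
  assumes "set gs \<subseteq> marr M" "set fs \<subseteq> marr M" "map (mdom M) gs = map (mcod M) fs" "wvars u \<subseteq> {..<length fs}"
  shows "warr M u (map2 (Cmp (mcat M)) gs fs) = warr M u gs \<cdot> warr M u fs"
proof -
  have "length gs = length fs" using assms(3) by (metis length_map)
  then show ?thesis using assms by (induction u) auto
qed

lemma warr_Ide:
  assumes "set As \<subseteq> mobj M" "wvars u \<subseteq> {..<length As}"
  shows "warr M u (map ide As) = ide (wobj M u As)"
  using assms by (induction u) auto

lemma interpw_functor:
  assumes "wvars u \<subseteq> {..<n}"
  shows "cat_functor (power_cat (mcat M) n) (mcat M) (interpw M n u)"
proof
  fix g f assume "composable (power_cat (mcat M) n) g f"
  note * = composable_power[OF mcat_category this]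
  then have "set (map2 (Cmp (mcat M)) g f) \<subseteq> marr M"
    by (auto simp: set_zip list_all2_conv_all_nth composable_def subset_iff in_set_conv_nth)
  then show "FA (interpw M n u) (Cmp (power_cat (mcat M) n) g f) = FA (interpw M n u) g \<cdot> FA (interpw M n u) f"
    using * assms by (simp add: interpw_def warr_Cmp)
qed (use assms in \<open>auto simp: interpw_def in_hom_def warr_Ide image_subset_iff subset_iff\<close>)

lemma interp_functor: "x \<in> level n \<Longrightarrow> cat_functor (power_cat (mcat M) n) (mcat M) (interp M x)"
  using interpw_functor[of "word_of x" n] linear_simps(1)[OF linear_word_of, of x n]
  by (simp add: interp_eq wvars_leaves)

text \<open>Induction over the derivation; for an inverse, the square is obtained by cancelling the
  component at the domains.\<close>

lemma canonical_natural:
  assumes "canonical M n u v \<eta>" "length fs = n" "set fs \<subseteq> marr M"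
  shows "\<eta> (map (mcod M) fs) \<cdot> warr M u fs = warr M v fs \<cdot> \<eta> (map (mdom M) fs)"
proof -
  have fs [simp]: "length fs = n" "set fs \<subseteq> marr M" "mcod M ` set fs \<subseteq> mobj M" "mdom M ` set fs \<subseteq> mobj M"
    using assms by auto
  let ?D = "map (mdom M) fs" and ?E = "map (mcod M) fs"
  show ?thesis using assms(1)
  proof (induction rule: canonical.induct)
    case (can_assoc u v w)
    then show ?case
      using assoc_natural[of "warr M u fs" "warr M v fs" "warr M w fs"] by simp
  next
    case (can_lunit u)
    then show ?case using lunit_natural[of "warr M u fs"] by simp
  next
    case (can_runit u)
    then show ?case using runit_natural[of "warr M u fs"] by simp
  next
    case (can_swap u v)
    then show ?case using swap_natural[of "warr M u fs" "warr M v fs"] by simp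
  next
    case (can_inv u v \<eta>)
    note w [simp] = canonical_wvars[OF can_inv(1), THEN conjunct1] canonical_wvars[OF can_inv(1), THEN conjunct2]
    note h [simp] = canonical_in_hom[OF can_inv(1), of ?D, simplified] canonical_in_hom[OF can_inv(1), of ?E, simplified]
    have "inva (\<eta> ?E) \<cdot> warr M v fs = warr M u fs \<cdot> inva (\<eta> ?D)"
    proof (rule iso_cancel_right[of "\<eta> ?D"])
      have "(inva (\<eta> ?E) \<cdot> warr M v fs) \<cdot> \<eta> ?D = inva (\<eta> ?E) \<cdot> \<eta> ?E \<cdot> warr M u fs"
        using can_inv by (simp del: inv_cancel)
      then show "(inva (\<eta> ?E) \<cdot> warr M v fs) \<cdot> \<eta> ?D = (warr M u fs \<cdot> inva (\<eta> ?D)) \<cdot> \<eta> ?D"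
        by simp
    qed simp_all
    then show ?case by simp
  next
    case (can_comp u v \<eta> w \<theta>)
    note w [simp] = canonical_wvars[OF can_comp(1), THEN conjunct1] canonical_wvars[OF can_comp(2), THEN conjunct1]
      canonical_wvars[OF can_comp(2), THEN conjunct2]
    note h [simp] = canonical_in_hom[OF can_comp(1), of ?D, simplified] canonical_in_hom[OF can_comp(1), of ?E, simplified]
      canonical_in_hom[OF can_comp(2), of ?D, simplified] canonical_in_hom[OF can_comp(2), of ?E, simplified]
    have "(\<theta> ?E \<cdot> \<eta> ?E) \<cdot> warr M u fs = \<theta> ?E \<cdot> warr M v fs \<cdot> \<eta> ?D"
      using can_comp.IH by simp
    also have "\<dots> = warr M w fs \<cdot> \<theta> ?D \<cdot> \<eta> ?D"
      by (rule reassoc[OF can_comp.IH(2)]) simp_all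
    finally show ?case by simp
  next
    case (can_tensor u u' \<eta> v v' \<theta>)
    note w [simp] = canonical_wvars[OF can_tensor(1), THEN conjunct1] canonical_wvars[OF can_tensor(1), THEN conjunct2]
      canonical_wvars[OF can_tensor(2), THEN conjunct1] canonical_wvars[OF can_tensor(2), THEN conjunct2]
    note h [simp] = canonical_in_hom[OF can_tensor(1), of ?D, simplified] canonical_in_hom[OF can_tensor(1), of ?E, simplified]
      canonical_in_hom[OF can_tensor(2), of ?D, simplified] canonical_in_hom[OF can_tensor(2), of ?E, simplified]
    show ?case using can_tensor.IH by simp
  qed simp_all
qed

text \<open>Instances of canonical maps are canonical. With variables for \<open>ws\<close> this
  gives equivariance, and with words for \<open>ws\<close> the outer factor of a horizontal
  composite.\<close>

lemma canonical_wsubst: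
  assumes "canonical M n u v \<eta>" "length ws = n" "\<And>w. w \<in> set ws \<Longrightarrow> wvars w \<subseteq> {..<k}"
  shows "canonical M k (wsubst ws u) (wsubst ws v)
    (\<lambda>As\<in>Obj (power_cat (mcat M) k). \<eta> (map (\<lambda>w. wobj M w As) ws))"
  using assms(1)
proof (induction rule: canonical.induct)
  have ws: "wvars (wsubst ws u) \<subseteq> {..<k}" if "wvars u \<subseteq> {..<n}" for u
    using that assms(2,3) by (induction u) auto
  have wo [simp]: "wobj M (wsubst ws u) As = wobj M u (map (\<lambda>w. wobj M w As) ws)" if "wvars u \<subseteq> {..<n}" for u As
    using that assms(2) by (intro wobj_wsubst) (simp add: wvars_leaves)
  have ob [simp]: "(\<lambda>w. wobj M w As) ` set ws \<subseteq> mobj M" if "set As \<subseteq> mobj M" "length As = k" for As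
    using that assms(3) by auto
  note [simp] = assms(2)
  {
    case (can_id u)
    then show ?case by (intro canonical_cong[OF canonical.can_id[OF ws]]) auto
  next
    case (can_assoc u v w)
    then show ?case unfolding wsubst.simps by (intro canonical_cong[OF canonical.can_assoc]) (auto simp: ws)
  next
    case (can_lunit u)
    then show ?case unfolding wsubst.simps by (intro canonical_cong[OF canonical.can_lunit]) (auto simp: ws)
  next
    case (can_runit u)
    then show ?case unfolding wsubst.simps by (intro canonical_cong[OF canonical.can_runit]) (auto simp: ws)
  next
    case (can_swap u v)
    then show ?case unfolding wsubst.simps by (intro canonical_cong[OF canonical.can_swap]) (auto simp: ws)
  next
    case (can_inv u v \<eta>)
    then show ?case by (intro canonical_cong[OF canonical.can_inv[OF can_inv.IH]]) auto
  next
    case (can_comp u v \<eta> w \<theta>)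
    then show ?case by (intro canonical_cong[OF canonical.can_comp[OF can_comp.IH]]) auto
  next
    case (can_tensor u u' \<eta> v v' \<theta>)
    then show ?case
      unfolding wsubst.simps by (intro canonical_cong[OF canonical.can_tensor[OF can_tensor.IH]]) auto
  }
qed

text \<open>A word, applied as a functor to canonical maps, yields a canonical map: the inner factor
  of a horizontal composite.\<close>

lemma canonical_warr:
  assumes "\<And>i. i < n \<Longrightarrow> canonical M k (ws ! i) (ws' ! i) (\<theta> i)" "wvars u \<subseteq> {..<n}"
  shows "canonical M k (wsubst ws u) (wsubst ws' u)
    (\<lambda>As\<in>Obj (power_cat (mcat M) k). warr M u (map (\<lambda>i. \<theta> i As) [0..<n]))"
  using assms(2)
proof (induction u)
  case (WVar i)
  then show ?case unfolding wsubst.simps by (intro canonical_cong[OF assms(1)[of i]]) auto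
next
  case WNul
  then show ?case unfolding wsubst.simps by (intro canonical_cong[OF can_id[of WNul k M]]) auto
next
  case (WBin u v)
  then have "wvars u \<subseteq> {..<n}" "wvars v \<subseteq> {..<n}" by auto
  note IH = WBin.IH(1)[OF this(1)] WBin.IH(2)[OF this(2)]
  show ?case unfolding wsubst.simps by (intro canonical_cong[OF can_tensor[OF IH]]) auto
qed

text \<open>Resolves the description in \<open>canonical_iso\<close>: naturality makes \<eta> a
  transformation, and \<open>coherence\<close> makes it the only one, as linear words do not repeat
  variables. To identify the image of a 2-cell it now suffices to exhibit some canonical map between
  the two words.\<close>

lemma canonical_iso_eq:
  assumes x: "x \<in> level n" and y: "y \<in> level n" and \<eta>: "canonical M n (word_of x) (word_of y) \<eta>"
  shows "canonical_iso M n x y = \<lparr>NSrc = interp M x, NTgt = interp M y, NCmp = \<eta>\<rparr>"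
    and "nat_trans (power_cat (mcat M) n) (mcat M) (canonical_iso M n x y)"
proof -
  let ?\<eta> = "\<lparr>NSrc = interp M x, NTgt = interp M y, NCmp = \<eta>\<rparr>"
  have nt: "nat_trans (power_cat (mcat M) n) (mcat M) ?\<eta>"
  proof (rule nat_transI)
    show "\<eta> \<in> extensional (Obj (power_cat (mcat M) n))"
      using \<eta> by (rule canonical_extensional)
    show "in_hom (mcat M) (\<eta> As) (FO (interp M x) As) (FO (interp M y) As)"
      if "As \<in> Obj (power_cat (mcat M) n)" for As
      using canonical_in_hom[OF \<eta>, of As] that
      by (simp add: in_hom_def interp_eq[OF x] interp_eq[OF y] interpw_def)
    show "\<eta> (Cod (power_cat (mcat M) n) fs) \<cdot> FA (interp M x) fs = FA (interp M y) fs \<cdot> \<eta> (Dom (power_cat (mcat M) n) fs)"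
      if "fs \<in> Arr (power_cat (mcat M) n)" for fs
      using canonical_natural[OF \<eta>, of fs] that
      by (simp add: interp_eq[OF x] interp_eq[OF y] interpw_def)
  qed (use x y interp_functor in auto)
  moreover have "\<theta> = ?\<eta>" if "in_hom (functor_cat (power_cat (mcat M) n) (mcat M)) \<theta> (interp M x) (interp M y)"
    and "canonical M n (word_of x) (word_of y) (NCmp \<theta>)" for \<theta>
    using coherence[OF that(2) \<eta>] linear_simps(2)[OF linear_word_of[OF x]] that(1)
    by (simp add: in_hom_functor_cat)
  ultimately show eq: "canonical_iso M n x y = ?\<eta>"
    unfolding canonical_iso_def using \<eta> by (intro the_equality) (auto simp: in_hom_functor_cat)
  show "nat_trans (power_cat (mcat M) n) (mcat M) (canonical_iso M n x y)"
    unfolding eq by (rule nt)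
qed

lemma canonical_isoE:
  assumes x: "x \<in> level n" and y: "y \<in> level n"
  obtains \<eta> where "canonical M n (word_of x) (word_of y) \<eta>"
    "canonical_iso M n x y = \<lparr>NSrc = interp M x, NTgt = interp M y, NCmp = \<eta>\<rparr>"
    "nat_trans (power_cat (mcat M) n) (mcat M) (canonical_iso M n x y)"
proof -
  have "mset (leaves (word_of x)) = mset (leaves (word_of y))" "wvars (word_of x) \<subseteq> {..<n}"
    using linear_word_of[OF x] linear_word_of[OF y] linear_simps(1)[OF linear_word_of[OF x]]
    by (simp_all add: linear_def wvars_leaves)
  then obtain \<eta> where "canonical M n (word_of x) (word_of y) \<eta>"
    using canonical_exists by blast
  then show ?thesis using that canonical_iso_eq[OF x y] by blast
qed

end

section \<open>The interpretation is a map of operads\<close>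

lemma list_all2_level_nth:
  assumes "list_all2 (\<lambda>k x. x \<in> level k) ks xs"
  shows "length xs = length ks" "i < length ks \<Longrightarrow> xs ! i \<in> level (ks ! i)"
  using assms by (auto simp: list_all2_conv_all_nth)

lemma wvars_word_of: "x \<in> level n \<Longrightarrow> wvars (word_of x) = {..<n}"
  using linear_simps(1)[OF linear_word_of] by (simp add: wvars_leaves)

lemma set_blocks_subset:
  assumes "length As = sum_list ks" "set As \<subseteq> X" "i < length ks"
  shows "set (blocks ks As ! i) \<subseteq> X"
  using set_nth_blocks[of i ks As] assms by auto

lemma WkP_composableE:
  assumes "composable (Lev WkP n) g f"
  obtains x y z where "f = (x, y)" "g = (y, z)" "x \<in> level n" "y \<in> level n" "z \<in> level n"
proof -
  have gf: "f \<in> level n \<times> level n" "g \<in> level n \<times> level n" "Dom (Lev WkP n) g = Cod (Lev WkP n) f"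
    using assms unfolding composable_def WkP_simps(2) by blast+
  obtain x y where f: "f = (x, y)" "x \<in> level n" "y \<in> level n" using gf(1) by blast
  obtain y' z where g: "g = (y', z)" "y' \<in> level n" "z \<in> level n" using gf(2) by blast
  have "y' = y"
    using gf(3) unfolding f(1) g(1) WkP_simps(3)[OF g(2,3)] WkP_simps(4)[OF f(2,3)] .
  then show ?thesis using that f g by blast
qed

lemma wobj_rename:
  "wvars u \<subseteq> {..<length js} \<Longrightarrow> wobj M (rename js u) As = wobj M u (map ((!) As) js)"
  by (simp add: wobj_wsubst wvars_leaves comp_def)

lemma warr_rename:
  "wvars u \<subseteq> {..<length js} \<Longrightarrow> warr M (rename js u) fs = warr M u (map ((!) fs) js)"
  by (simp add: warr_wsubst wvars_leaves comp_def)

abbreviation block_words :: "nat list \<Rightarrow> ptree list \<Rightarrow> word list" where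
  "block_words ks xs \<equiv> map2 rename (blocks ks [0..<sum_list ks]) (map word_of xs)"

lemma block_words_nth:
  assumes "list_all2 (\<lambda>k x. x \<in> level k) ks xs" "i < length ks"
  shows "block_words ks xs ! i = rename (blocks ks [0..<sum_list ks] ! i) (word_of (xs ! i))"
  using assms list_all2_level_nth[OF assms(1)] by simp

lemma wvars_block_words:
  assumes "list_all2 (\<lambda>k x. x \<in> level k) ks xs" "w \<in> set (block_words ks xs)"
  shows "wvars w \<subseteq> {..<sum_list ks}"
proof -
  note xs = list_all2_level_nth[OF assms(1)]
  obtain i where i: "i < length ks" "w = block_words ks xs ! i"
    using assms(2) xs(1) by (auto simp: in_set_conv_nth)
  have l: "set (leaves (word_of (xs ! i))) = {..<length (blocks ks [0..<sum_list ks] ! i)}"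
    using wvars_word_of[OF xs(2)[OF i(1)]] i(1) by (simp add: wvars_leaves)
  have "wvars w \<subseteq> set (blocks ks [0..<sum_list ks] ! i)"
    unfolding i(2) block_words_nth[OF assms(1) i(1)] wvars_leaves leaves_rename[OF equalityD1[OF l]] set_map l
    by auto
  then show ?thesis using set_nth_blocks[OF i(1), of "[0..<sum_list ks]"] by auto
qed

lemma wobj_block_words:
  assumes "list_all2 (\<lambda>k x. x \<in> level k) ks xs" "length As = sum_list ks"
  shows "map (\<lambda>w. wobj M w As) (block_words ks xs) = map2 (\<lambda>x. wobj M (word_of x)) xs (blocks ks As)"
proof (rule nth_equalityI)
  note xs = list_all2_level_nth[OF assms(1)]
  fix i assume "i < length (map (\<lambda>w. wobj M w As) (block_words ks xs))"
  then have i: "i < length ks" using xs by simp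
  then show "map (\<lambda>w. wobj M w As) (block_words ks xs) ! i = map2 (\<lambda>x. wobj M (word_of x)) xs (blocks ks As) ! i"
    using xs wvars_word_of[OF xs(2)[OF i]] assms(2)
    by (simp add: wobj_rename map_nth_blocks del: map_map)
qed (use list_all2_level_nth[OF assms(1)] in simp)

lemma warr_block_words:
  assumes "list_all2 (\<lambda>k x. x \<in> level k) ks xs" "length fs = sum_list ks"
  shows "map (\<lambda>w. warr M w fs) (block_words ks xs) = map2 (\<lambda>x. warr M (word_of x)) xs (blocks ks fs)"
proof (rule nth_equalityI)
  note xs = list_all2_level_nth[OF assms(1)]
  fix i assume "i < length (map (\<lambda>w. warr M w fs) (block_words ks xs))"
  then have i: "i < length ks" using xs by simp
  then show "map (\<lambda>w. warr M w fs) (block_words ks xs) ! i = map2 (\<lambda>x. warr M (word_of x)) xs (blocks ks fs) ! i"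
    using xs wvars_word_of[OF xs(2)[OF i]] assms(2)
    by (simp add: warr_rename map_nth_blocks del: map_map)
qed (use list_all2_level_nth[OF assms(1)] in simp)

context symmetric_monoidal_category
begin

lemma FO_interp:
  assumes "x \<in> level n" "length As = n" "set As \<subseteq> mobj M"
  shows "FO (interp M x) As = wobj M (word_of x) As" "wobj M (word_of x) As \<in> mobj M"
  using assms by (auto simp: interp_eq[OF assms(1)] interpw_def wvars_word_of[OF assms(1)])

lemma FA_interp:
  assumes "x \<in> level n" "length fs = n" "set fs \<subseteq> marr M"
  shows "FA (interp M x) fs = warr M (word_of x) fs" "warr M (word_of x) fs \<in> marr M"
  using assms by (auto simp: interp_eq[OF assms(1)] interpw_def wvars_word_of[OF assms(1)])

lemma set_map_wobj:
  "set As \<subseteq> mobj M \<Longrightarrow> (\<And>w. w \<in> set ws \<Longrightarrow> wvars w \<subseteq> {..<length As}) \<Longrightarrow>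
    set (map (\<lambda>w. wobj M w As) ws) \<subseteq> mobj M"
  by auto

lemma set_map_warr:
  "set fs \<subseteq> marr M \<Longrightarrow> (\<And>w. w \<in> set ws \<Longrightarrow> wvars w \<subseteq> {..<length fs}) \<Longrightarrow>
    set (map (\<lambda>w. warr M w fs) ws) \<subseteq> marr M"
  by auto

lemma FO_interp_blocks:
  assumes "list_all2 (\<lambda>k x. x \<in> level k) ks xs" "length As = sum_list ks" "set As \<subseteq> mobj M"
  shows "map2 FO (map (interp M) xs) (blocks ks As) = map (\<lambda>w. wobj M w As) (block_words ks xs)"
    and "set (map (\<lambda>w. wobj M w As) (block_words ks xs)) \<subseteq> mobj M"
proof -
  note xs = list_all2_level_nth[OF assms(1)]
  show "map2 FO (map (interp M) xs) (blocks ks As) = map (\<lambda>w. wobj M w As) (block_words ks xs)"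
    unfolding wobj_block_words[OF assms(1,2)]
  proof (rule nth_equalityI)
    fix i assume "i < length (map2 FO (map (interp M) xs) (blocks ks As))"
    then have i: "i < length ks" using xs by simp
    show "map2 FO (map (interp M) xs) (blocks ks As) ! i = map2 (\<lambda>x. wobj M (word_of x)) xs (blocks ks As) ! i"
      using FO_interp(1)[OF xs(2)[OF i], of "blocks ks As ! i"] set_blocks_subset[OF assms(2,3) i] xs(1) i assms(2) by simp
  qed (use xs in simp)
  show "set (map (\<lambda>w. wobj M w As) (block_words ks xs)) \<subseteq> mobj M"
    unfolding assms(2)[symmetric]
    using wvars_block_words[OF assms(1), unfolded assms(2)[symmetric]] assms(3) by (intro set_map_wobj) blast+
qed

lemma FA_interp_blocks:
  assumes "list_all2 (\<lambda>k x. x \<in> level k) ks xs" "length fs = sum_list ks" "set fs \<subseteq> marr M"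
  shows "map2 FA (map (interp M) xs) (blocks ks fs) = map (\<lambda>w. warr M w fs) (block_words ks xs)"
    and "set (map (\<lambda>w. warr M w fs) (block_words ks xs)) \<subseteq> marr M"
proof -
  note xs = list_all2_level_nth[OF assms(1)]
  show "map2 FA (map (interp M) xs) (blocks ks fs) = map (\<lambda>w. warr M w fs) (block_words ks xs)"
    unfolding warr_block_words[OF assms(1,2)]
  proof (rule nth_equalityI)
    fix i assume "i < length (map2 FA (map (interp M) xs) (blocks ks fs))"
    then have i: "i < length ks" using xs by simp
    show "map2 FA (map (interp M) xs) (blocks ks fs) ! i = map2 (\<lambda>x. warr M (word_of x)) xs (blocks ks fs) ! i"
      using FA_interp(1)[OF xs(2)[OF i], of "blocks ks fs ! i"] set_blocks_subset[OF assms(2,3) i] xs(1) i assms(2) by simp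
  qed (use xs in simp)
  show "set (map (\<lambda>w. warr M w fs) (block_words ks xs)) \<subseteq> marr M"
    unfolding assms(2)[symmetric]
    using wvars_block_words[OF assms(1), unfolded assms(2)[symmetric]] assms(3) by (intro set_map_warr) blast+
qed

lemma interp_comp:
  assumes x: "x \<in> level (length ks)" and xs: "list_all2 (\<lambda>k x. x \<in> level k) ks xs"
  shows "interp M (compS free_operad ks x xs) = end_compO (mcat M) ks (interp M x) (map (interp M) xs)"
proof -
  note c = comp_level[OF x xs]
  have "FO (interp M (compS free_operad ks x xs)) = FO (end_compO (mcat M) ks (interp M x) (map (interp M) xs))"
    "FA (interp M (compS free_operad ks x xs)) = FA (end_compO (mcat M) ks (interp M x) (map (interp M) xs))"
    using FO_interp_blocks[OF xs] FA_interp_blocks[OF xs] list_all2_level_nth(1)[OF xs]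
      wvars_word_of[OF x, unfolded wvars_leaves]
    by (auto simp: end_compO_def interp_eq[OF c(1)] interpw_def c(2) wcomp_def FO_interp[OF x] FA_interp[OF x]
        wobj_wsubst warr_wsubst intro!: restrict_ext simp del: map_map)
  then show ?thesis by simp
qed

lemma interp_act:
  assumes x: "x \<in> level n" and \<pi>: "\<pi> permutes {..<n}"
  shows "interp M (actS free_operad n \<pi> x) = end_actO (mcat M) n \<pi> (interp M x)"
proof -
  note c = act_level[OF x \<pi>] word_of_act[OF x \<pi>]
  have "wobj M (word_of (actS free_operad n \<pi> x)) As = FO (interp M x) (permute_list \<pi> As)"
    if "length As = n" "set As \<subseteq> mobj M" for As
    using that permute_list_in[OF \<pi> that] wvars_word_of[OF x]
    by (simp add: c(2) FO_interp[OF x] permute_list_map_nth wobj_rename del: map_map)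
  moreover have "warr M (word_of (actS free_operad n \<pi> x)) fs = FA (interp M x) (permute_list \<pi> fs)"
    if "length fs = n" "set fs \<subseteq> marr M" for fs
    using that permute_list_in[OF \<pi> that] wvars_word_of[OF x]
    by (simp add: c(2) FA_interp[OF x] permute_list_map_nth warr_rename del: map_map)
  ultimately show ?thesis
    by (auto simp: end_actO_def interp_eq[OF c(1)] interpw_def intro!: restrict_ext)
qed

text \<open>A horizontal composite of canonical isomorphisms is canonical again, hence the chosen
  one. It factors through the word of \<open>x\<close> with the words of \<open>ys\<close>
  substituted: first the components \<theta> inside \<open>x\<close>, then \<eta> at the values of
  \<open>ys\<close>.\<close>

lemma canonical_iso_comp:
  assumes x: "x \<in> level (length ks)" and y: "y \<in> level (length ks)"
    and xs: "list_all2 (\<lambda>k x. x \<in> level k) ks xs" and ys: "list_all2 (\<lambda>k x. x \<in> level k) ks ys"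
  shows "canonical_iso M (sum_list ks) (compS free_operad ks x xs) (compS free_operad ks y ys) =
    end_compA (mcat M) ks (canonical_iso M (length ks) x y)
      (map (\<lambda>i. canonical_iso M (ks ! i) (xs ! i) (ys ! i)) [0..<length ks])"
proof -
  let ?n = "length ks" and ?s = "sum_list ks"
  note cx = comp_level[OF x xs] and cy = comp_level[OF y ys]
  note lx = list_all2_level_nth[OF xs] and ly = list_all2_level_nth[OF ys]
  obtain \<eta> where \<eta>: "canonical M ?n (word_of x) (word_of y) \<eta>"
    "canonical_iso M ?n x y = \<lparr>NSrc = interp M x, NTgt = interp M y, NCmp = \<eta>\<rparr>"
    using canonical_isoE[OF x y] by blast
  have "\<exists>\<theta>. canonical M (ks ! i) (word_of (xs ! i)) (word_of (ys ! i)) \<theta> \<and>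
      canonical_iso M (ks ! i) (xs ! i) (ys ! i) = \<lparr>NSrc = interp M (xs ! i), NTgt = interp M (ys ! i), NCmp = \<theta>\<rparr>"
    if "i < ?n" for i
    using canonical_isoE[OF lx(2) ly(2), OF that that] by blast
  then obtain \<theta> where \<theta>: "\<And>i. i < ?n \<Longrightarrow> canonical M (ks ! i) (word_of (xs ! i)) (word_of (ys ! i)) (\<theta> i)"
    "\<And>i. i < ?n \<Longrightarrow> canonical_iso M (ks ! i) (xs ! i) (ys ! i) =
      \<lparr>NSrc = interp M (xs ! i), NTgt = interp M (ys ! i), NCmp = \<theta> i\<rparr>"
    by metis
  let ?\<theta>s = "map (\<lambda>i. canonical_iso M (ks ! i) (xs ! i) (ys ! i)) [0..<?n]"
  have src: "map NSrc ?\<theta>s = map (interp M) xs" and tgt: "map NTgt ?\<theta>s = map (interp M) ys"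
    using lx(1) ly(1) by (auto simp: \<theta> intro: nth_equalityI)
  \<comment> \<open>The component \<open>\<theta> i\<close> as a map in all
    \<open>sum_list ks\<close> variables, reading only the \<open>i\<close>-th block of
    them.\<close>
  define \<theta>' where "\<theta>' i = (\<lambda>As\<in>Obj (power_cat (mcat M) ?s). \<theta> i (blocks ks As ! i))" for i
  have \<theta>': "canonical M ?s (block_words ks xs ! i) (block_words ks ys ! i) (\<theta>' i)" if i: "i < ?n" for i
  proof -
    have "map (\<lambda>w. wobj M w As) (map WVar (blocks ks [0..<?s] ! i)) = blocks ks As ! i" if "length As = ?s" for As
      using map_nth_blocks[OF that i] by (simp add: comp_def)
    moreover have "set (blocks ks [0..<?s] ! i) \<subseteq> {..<?s}"
      using set_nth_blocks[OF i, of "[0..<?s]"] by auto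
    ultimately show ?thesis
      unfolding \<theta>'_def block_words_nth[OF xs i] block_words_nth[OF ys i]
      using i by (intro canonical_cong[OF canonical_wsubst[OF \<theta>(1)[OF i]]]) auto
  qed
  define \<zeta> where "\<zeta> = NCmp (end_compA (mcat M) ks (canonical_iso M ?n x y) ?\<theta>s)"
  have 1: "canonical M ?s (wcomp ks (word_of x) (map word_of xs)) (wsubst (block_words ks ys) (word_of x))
      (\<lambda>As\<in>Obj (power_cat (mcat M) ?s). warr M (word_of x) (map (\<lambda>i. \<theta>' i As) [0..<?n]))"
    unfolding wcomp_def using \<theta>' by (intro canonical_warr) (simp_all add: wvars_word_of[OF x])
  have 2: "canonical M ?s (wsubst (block_words ks ys) (word_of x)) (wcomp ks (word_of y) (map word_of ys))
      (\<lambda>As\<in>Obj (power_cat (mcat M) ?s). \<eta> (map (\<lambda>w. wobj M w As) (block_words ks ys)))"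
    unfolding wcomp_def using wvars_block_words[OF ys] ly(1) by (intro canonical_wsubst[OF \<eta>(1)]) simp_all
  \<comment> \<open>\<open>canonical_cong\<close> concludes for a restricted function, so \<zeta> is
    first written as its own restriction.\<close>
  have \<zeta>: "\<zeta> = (\<lambda>As\<in>Obj (power_cat (mcat M) ?s). \<zeta> As)"
    by (auto simp: \<zeta>_def end_compA_def intro!: restrict_ext)
  have "canonical M ?s (wcomp ks (word_of x) (map word_of xs)) (wcomp ks (word_of y) (map word_of ys)) \<zeta>"
  proof (subst \<zeta>, rule canonical_cong[OF can_comp[OF 1 2]])
    fix As assume As: "length As = ?s" "set As \<subseteq> mobj M"
    have "map2 (\<lambda>\<theta>. FO (NTgt \<theta>)) ?\<theta>s (blocks ks As) = map2 FO (map NTgt ?\<theta>s) (blocks ks As)"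
      by (rule nth_equalityI) auto
    also have "\<dots> = map (\<lambda>w. wobj M w As) (block_words ks ys)"
      unfolding tgt by (rule FO_interp_blocks[OF ys As])
    finally have a: "map2 (\<lambda>\<theta>. FO (NTgt \<theta>)) ?\<theta>s (blocks ks As) = map (\<lambda>w. wobj M w As) (block_words ks ys)" .
    have b: "map2 NCmp ?\<theta>s (blocks ks As) = map (\<lambda>i. \<theta>' i As) [0..<?n]"
      using As by (intro nth_equalityI) (auto simp: \<theta> \<theta>'_def)
    have c: "set (map (\<lambda>i. \<theta>' i As) [0..<?n]) \<subseteq> marr M"
      using canonical_in_hom(1)[OF \<theta>' As] by auto
    have "\<zeta> As = NCmp (canonical_iso M ?n x y) (map2 (\<lambda>\<theta>. FO (NTgt \<theta>)) ?\<theta>s (blocks ks As)) \<cdot>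
        FA (NSrc (canonical_iso M ?n x y)) (map2 NCmp ?\<theta>s (blocks ks As))"
      using As by (simp add: \<zeta>_def end_compA_def)
    also have "\<dots> = \<eta> (map (\<lambda>w. wobj M w As) (block_words ks ys)) \<cdot>
        warr M (word_of x) (map (\<lambda>i. \<theta>' i As) [0..<?n])"
      unfolding a b \<eta>(2) using FA_interp(1)[OF x _ c] by simp
    finally show "(\<lambda>As\<in>Obj (power_cat (mcat M) ?s).
        (\<lambda>As\<in>Obj (power_cat (mcat M) ?s). \<eta> (map (\<lambda>w. wobj M w As) (block_words ks ys))) As \<cdot>
        (\<lambda>As\<in>Obj (power_cat (mcat M) ?s). warr M (word_of x) (map (\<lambda>i. \<theta>' i As) [0..<?n])) As) As = \<zeta> As"
      using As by simp
  qed
  then have "canonical_iso M ?s (compS free_operad ks x xs) (compS free_operad ks y ys) =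
    \<lparr>NSrc = interp M (compS free_operad ks x xs), NTgt = interp M (compS free_operad ks y ys), NCmp = \<zeta>\<rparr>"
    using canonical_iso_eq(1)[OF cx(1) cy(1), of \<zeta>] by (simp add: cx(2) cy(2))
  then show ?thesis
    by (simp add: \<zeta>_def end_compA_def interp_comp[OF x xs] interp_comp[OF y ys] src tgt \<eta>(2) del: map_map)
qed

text \<open>The substitution that renames variables by \<open>\<pi>\<close>: the values of the
  renamed variables form \<open>permute_list \<pi> As\<close>.\<close>

lemma canonical_iso_act:
  assumes x: "x \<in> level n" and y: "y \<in> level n" and \<pi>: "\<pi> permutes {..<n}"
  shows "canonical_iso M n (actS free_operad n \<pi> x) (actS free_operad n \<pi> y) =
    end_actA (mcat M) n \<pi> (canonical_iso M n x y)"
proof -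
  obtain \<eta> where \<eta>: "canonical M n (word_of x) (word_of y) \<eta>"
    "canonical_iso M n x y = \<lparr>NSrc = interp M x, NTgt = interp M y, NCmp = \<eta>\<rparr>"
    using canonical_isoE[OF x y] by blast
  have p: "\<pi> i < n" if "i < n" for i using permutes_in_image[OF \<pi>] that by simp
  have "canonical M n (word_of (actS free_operad n \<pi> x)) (word_of (actS free_operad n \<pi> y))
    (\<lambda>As\<in>Obj (power_cat (mcat M) n). \<eta> (permute_list \<pi> As))"
    unfolding word_of_act[OF x \<pi>] word_of_act[OF y \<pi>]
    by (rule canonical_cong[OF canonical_wsubst[OF \<eta>(1)]])
      (auto simp: permute_list_map_nth comp_def p)
  from canonical_iso_eq(1)[OF act_level[OF x \<pi>] act_level[OF y \<pi>] this]
  show ?thesis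
    by (simp add: end_actA_def \<eta>(2) interp_act[OF x \<pi>] interp_act[OF y \<pi>])
qed

lemma hat_S_obj [simp]:
  "acat (S_obj M) = mcat M"
  "x \<in> level n \<Longrightarrow> FO (hat (S_obj M) n) x = interp M x"
  "x \<in> level n \<Longrightarrow> y \<in> level n \<Longrightarrow> FA (hat (S_obj M) n) (x, y) = canonical_iso M n x y"
  by (auto simp: S_obj_def)

text \<open>Identities and composites of canonical maps are canonical, so uniqueness gives
  functoriality on each level.\<close>

lemma S_obj_functor: "cat_functor (Lev WkP n) (Lev (End (mcat M)) n) (hat (S_obj M) n)"
proof
  show "FO (hat (S_obj M) n) \<in> Obj (Lev WkP n) \<rightarrow>\<^sub>E Obj (Lev (End (mcat M)) n)"
    using interp_functor by (auto simp: S_obj_def)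
  have nt: "nat_trans (power_cat (mcat M) n) (mcat M) (canonical_iso M n x y)"
    and hom: "NSrc (canonical_iso M n x y) = interp M x" "NTgt (canonical_iso M n x y) = interp M y"
    if "x \<in> level n" "y \<in> level n" for x y
    using canonical_isoE[OF that] by (metis ntrans.select_convs)+
  show "FA (hat (S_obj M) n) \<in> Arr (Lev WkP n) \<rightarrow>\<^sub>E Arr (Lev (End (mcat M)) n)"
    using nt by (auto simp: S_obj_def)
  show "in_hom (Lev (End (mcat M)) n) (FA (hat (S_obj M) n) f)
      (FO (hat (S_obj M) n) (Dom (Lev WkP n) f)) (FO (hat (S_obj M) n) (Cod (Lev WkP n) f))"
    if f: "f \<in> Arr (Lev WkP n)" for f
  proof -
    obtain x y where "f = (x, y)" "x \<in> level n" "y \<in> level n" using f by (cases f) auto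
    then show ?thesis using nt hom by (simp add: in_hom_functor_cat)
  qed
  show "FA (hat (S_obj M) n) (Ide (Lev WkP n) x) = Ide (Lev (End (mcat M)) n) (FO (hat (S_obj M) n) x)"
    if x: "x \<in> Obj (Lev WkP n)" for x
  proof -
    have x: "x \<in> level n" using x by simp
    have "canonical M n (word_of x) (word_of x)
      (\<lambda>As\<in>Obj (power_cat (mcat M) n). ide (FO (interp M x) As))"
      using x by (intro canonical_cong[OF can_id]) (auto simp: wvars_word_of FO_interp[OF x])
    from canonical_iso_eq(1)[OF x x this] show ?thesis
      using x interp_functor by simp
  qed
  show "FA (hat (S_obj M) n) (Cmp (Lev WkP n) g f) =
      Cmp (Lev (End (mcat M)) n) (FA (hat (S_obj M) n) g) (FA (hat (S_obj M) n) f)"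
    if gf: "composable (Lev WkP n) g f" for g f
  proof -
    obtain x y z where f: "f = (x, y)" and g: "g = (y, z)" and lev: "x \<in> level n" "y \<in> level n" "z \<in> level n"
      using gf by (rule WkP_composableE)
    obtain \<eta> where \<eta>: "canonical M n (word_of x) (word_of y) \<eta>"
      "canonical_iso M n x y = \<lparr>NSrc = interp M x, NTgt = interp M y, NCmp = \<eta>\<rparr>"
      using canonical_isoE[OF lev(1,2)] by blast
    obtain \<theta> where \<theta>: "canonical M n (word_of y) (word_of z) \<theta>"
      "canonical_iso M n y z = \<lparr>NSrc = interp M y, NTgt = interp M z, NCmp = \<theta>\<rparr>"
      using canonical_isoE[OF lev(2,3)] by blast
    show ?thesis
      using canonical_iso_eq(1)[OF lev(1,3) can_comp[OF \<eta>(1) \<theta>(1)]] lev nt hom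
      by (simp add: f g) (simp add: \<eta>(2) \<theta>(2))
  qed
qed

theorem S_obj_algebra: "algebra WkP (S_obj M)"
  unfolding algebra_def
proof
  show "category (acat (S_obj M))" using mcat_category by simp
  show "cat_operad_map WkP (End (acat (S_obj M))) (hat (S_obj M))"
    unfolding hat_S_obj(1)
  proof (rule cat_operad_map.intro)
    show "cat_functor (Lev WkP n) (Lev (End (mcat M)) n) (hat (S_obj M) n)" for n
      by (rule S_obj_functor)
    have u: "(id, Unit) \<in> level 1" by (simp add: permutes_id)
    show "FO (hat (S_obj M) 1) (unitO WkP) = unitO (End (mcat M))"
      using hat_S_obj(2)[OF u] by (simp del: hat_S_obj) (auto simp: interp_def end_actO_def intro!: restrict_ext)
  next
    fix x ks xs
    assume x: "x \<in> Obj (Lev WkP (length ks))" and xs: "list_all2 (\<lambda>k x. x \<in> Obj (Lev WkP k)) ks xs"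
    then have x: "x \<in> level (length ks)" and xs: "list_all2 (\<lambda>k x. x \<in> level k) ks xs" by simp_all
    have "map2 (\<lambda>k. FO (hat (S_obj M) k)) ks xs = map (interp M) xs"
      using list_all2_level_nth[OF xs] by (intro nth_equalityI) simp_all
    then show "FO (hat (S_obj M) (sum_list ks)) (compO WkP ks x xs) =
        compO (End (mcat M)) ks (FO (hat (S_obj M) (length ks)) x) (map2 (\<lambda>k. FO (hat (S_obj M) k)) ks xs)"
      using hat_S_obj(2)[OF comp_level(1)[OF x xs]] x by (simp add: interp_comp[OF x xs])
  next
    fix e ks es
    assume e: "e \<in> Arr (Lev WkP (length ks))" and es: "list_all2 (\<lambda>k y. y \<in> Arr (Lev WkP k)) ks es"
    obtain x y where e': "e = (x, y)" "x \<in> level (length ks)" "y \<in> level (length ks)" using e by (cases e) auto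
    have len: "length es = length ks" and lev: "\<And>i. i < length ks \<Longrightarrow> es ! i \<in> level (ks ! i) \<times> level (ks ! i)"
      using es by (auto simp: list_all2_conv_all_nth)
    have xs: "list_all2 (\<lambda>k x. x \<in> level k) ks (map fst es)" and ys: "list_all2 (\<lambda>k x. x \<in> level k) ks (map snd es)"
      using len lev by (auto simp: list_all2_conv_all_nth mem_Times_iff)
    have "map2 (\<lambda>k. FA (hat (S_obj M) k)) ks es =
        map (\<lambda>i. canonical_iso M (ks ! i) (map fst es ! i) (map snd es ! i)) [0..<length ks]"
    proof (rule nth_equalityI)
      fix i assume "i < length (map2 (\<lambda>k. FA (hat (S_obj M) k)) ks es)"
      then have i: "i < length ks" by simp
      then obtain a b where "es ! i = (a, b)" "a \<in> level (ks ! i)" "b \<in> level (ks ! i)" using lev[OF i] by blast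
      then show "map2 (\<lambda>k. FA (hat (S_obj M) k)) ks es ! i =
          map (\<lambda>i. canonical_iso M (ks ! i) (map fst es ! i) (map snd es ! i)) [0..<length ks] ! i"
        using i len hat_S_obj(3)[of a "ks ! i" b] by simp
    qed (simp add: len)
    then show "FA (hat (S_obj M) (sum_list ks)) (compA WkP ks e es) =
        compA (End (mcat M)) ks (FA (hat (S_obj M) (length ks)) e) (map2 (\<lambda>k. FA (hat (S_obj M) k)) ks es)"
      using hat_S_obj(3)[OF comp_level(1)[OF e'(2) xs] comp_level(1)[OF e'(3) ys]] hat_S_obj(3)[OF e'(2,3)]
      by (simp add: e'(1) canonical_iso_comp[OF e'(2,3) xs ys])
  next
    fix x n \<pi> assume "x \<in> Obj (Lev WkP n)" and \<pi>: "\<pi> permutes {..<n}"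
    then have x: "x \<in> level n" by simp
    show "FO (hat (S_obj M) n) (actO WkP n \<pi> x) = actO (End (mcat M)) n \<pi> (FO (hat (S_obj M) n) x)"
      using hat_S_obj(2)[OF act_level[OF x \<pi>]] hat_S_obj(2)[OF x] interp_act[OF x \<pi>]
      by (cases x) (simp add: free_operad_def)
  next
    fix e n \<pi> assume "e \<in> Arr (Lev WkP n)" and \<pi>: "\<pi> permutes {..<n}"
    then obtain x y where e: "e = (x, y)" and x: "x \<in> level n" and y: "y \<in> level n" by (cases e) auto
    show "FA (hat (S_obj M) n) (actA WkP n \<pi> e) = actA (End (mcat M)) n \<pi> (FA (hat (S_obj M) n) e)"
      using hat_S_obj(3)[OF act_level[OF x \<pi>] act_level[OF y \<pi>]] hat_S_obj(3)[OF x y] canonical_iso_act[OF x y \<pi>]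
      by (simp add: e)
  qed
qed

end

section \<open>The symmetric monoidal category of an algebra\<close>

text \<open>Each inner word is renamed by its own block of \<open>js\<close>. This is how words with
  repetitions are written over one linear composite.\<close>

lemma rename_wcomp:
  assumes "linear (length ks) u" "list_all2 linear ks vs" "length js = sum_list ks"
  shows "rename js (wcomp ks u vs) = wsubst (map2 rename (blocks ks js) vs) u"
proof -
  have len: "length vs = length ks" using assms(2) by (simp add: list_all2_lengthD)
  have "rename js (wcomp ks u vs) = wsubst (map (rename js) (map2 rename (blocks ks [0..<sum_list ks]) vs)) u"
    unfolding wcomp_def using linear_simps(1)[OF assms(1)] len by (intro wsubst_wsubst) simp
  also have "map (rename js) (map2 rename (blocks ks [0..<sum_list ks]) vs) = map2 rename (blocks ks js) vs"
  proof (rule nth_equalityI)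
    fix i assume "i < length (map (rename js) (map2 rename (blocks ks [0..<sum_list ks]) vs))"
    then have i: "i < length ks" using len by simp
    have s: "set (leaves (vs ! i)) = {..<ks ! i}"
      using assms(2) i by (intro linear_simps(1)) (simp add: list_all2_conv_all_nth)
    have b: "set (blocks ks [0..<sum_list ks] ! i) \<subseteq> {..<sum_list ks}"
      using set_nth_blocks[OF i, of "[0..<sum_list ks]"] by auto
    have "rename js (rename (blocks ks [0..<sum_list ks] ! i) (vs ! i)) =
      wsubst (map (rename js) (map WVar (blocks ks [0..<sum_list ks] ! i))) (vs ! i)"
      using s i by (intro wsubst_wsubst) simp
    also have "map (rename js) (map WVar (blocks ks [0..<sum_list ks] ! i)) = map WVar (map ((!) js) (blocks ks [0..<sum_list ks] ! i))"
      using b assms(3) by auto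
    also have "\<dots> = map WVar (blocks ks js ! i)"
      by (simp only: map_nth_blocks[OF assms(3) i])
    finally show "map (rename js) (map2 rename (blocks ks [0..<sum_list ks]) vs) ! i = map2 rename (blocks ks js) vs ! i"
      using i len by (simp del: map_map)
  qed (use len in simp)
  finally show ?thesis .
qed

lemma blocks_concat: "blocks (map length xss) (concat xss) = xss"
  by (induction xss) auto

text \<open>The leaves are numbered from left to right; every word, repetitions included, is a
  renaming of such a linear word by the list of its leaves.\<close>

definition standard :: "word \<Rightarrow> word" where
  "standard u = label (shape u) [0..<length (leaves u)]"

lemma linear_standard: "linear (length (leaves u)) (standard u)"
  by (simp add: linear_def standard_def)

lemma rename_standard [simp]: "rename (leaves u) (standard u) = u"
  unfolding standard_def by (subst rename_label) (auto simp: map_nth)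

text \<open>Linear words of the same shape are one tree with two permutations \<sigma> and \<tau>,
  which differ by \<open>\<tau> \<circ> inv \<sigma>\<close>.\<close>

lemma linear_relabel:
  assumes u: "linear n u" and v: "linear n v" and "shape u = shape v"
  obtains \<pi> where "\<pi> permutes {..<n}" "rename (map \<pi> [0..<n]) u = v" "map \<pi> (leaves u) = leaves v"
proof -
  obtain \<sigma> s where su: "ptree_of u = (\<sigma>, s)" by (cases "ptree_of u")
  obtain \<tau> t where tv: "ptree_of v = (\<tau>, t)" by (cases "ptree_of v")
  have lu: "leaves u = map \<sigma> [0..<n]" and \<sigma>: "\<sigma> permutes {..<n}"
    using ptree_of_level[OF u] word_of_ptree_of[of u] leaves_word_of[of \<sigma> s] unfolding su by auto
  have lv: "leaves v = map \<tau> [0..<n]" and \<tau>: "\<tau> permutes {..<n}"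
    using ptree_of_level[OF v] word_of_ptree_of[of v] leaves_word_of[of \<tau> t] unfolding tv by auto
  let ?\<pi> = "\<tau> \<circ> inv \<sigma>"
  have \<pi>: "?\<pi> permutes {..<n}" by (rule permutes_compose[OF permutes_inv[OF \<sigma>] \<tau>])
  have m: "map ?\<pi> (leaves u) = leaves v"
    unfolding lu lv using permutes_inverses(2)[OF \<sigma>] by simp
  have "map ((!) (map ?\<pi> [0..<n])) (leaves u) = map ?\<pi> (leaves u)"
    using linear_simps(1)[OF u] by (intro map_cong) auto
  then have "rename (map ?\<pi> [0..<n]) u = v"
    using linear_simps(1)[OF u] assms(3) m
    by (intro word_eqI) (subst shape_rename leaves_rename; simp del: map_map)+
  then show ?thesis using that \<pi> m by blast
qed

lemma rename_upt: "linear n u \<Longrightarrow> rename [0..<n] u = u"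
proof -
  assume u: "linear n u"
  have "map ((!) [0..<n]) (leaves u) = leaves u"
    using linear_simps(1)[OF u] by (intro map_idI) auto
  then show ?thesis
    using linear_simps(1)[OF u] by (intro word_eqI) (simp_all add: leaves_rename shape_rename)
qed

text \<open>The trees in the definition of \<open>R_obj\<close> as images of linear words; the
  transposition comes from listing two variables in reverse.\<close>

lemma ptree_of_planar:
  "ptree_of (WBin (WVar 0) (WVar (Suc 0))) = planar (Bin Unit Unit)"
  "ptree_of (WBin (WVar (Suc 0)) (WVar 0)) = (transpose 0 1, Bin Unit Unit)"
  "ptree_of (WBin (WVar 0) (WBin (WVar (Suc 0)) (WVar 2))) = planar (Bin Unit (Bin Unit Unit))"
  "ptree_of (WBin (WBin (WVar 0) (WVar (Suc 0))) (WVar 2)) = planar (Bin (Bin Unit Unit) Unit)"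
  "ptree_of (WVar 0) = planar Unit" "ptree_of WNul = planar Nul"
  "ptree_of (WBin WNul (WVar 0)) = planar (Bin Nul Unit)"
  "ptree_of (WBin (WVar 0) WNul) = planar (Bin Unit Nul)"
  by (auto simp: ptree_of_def fun_eq_iff less_Suc_eq numeral_2_eq_2 numeral_3_eq_3 transpose_def)

lemma linear_planar:
  "linear 2 (WBin (WVar 0) (WVar (Suc 0)))"
  "linear 2 (WBin (WVar (Suc 0)) (WVar 0))"
  "linear 3 (WBin (WVar 0) (WBin (WVar (Suc 0)) (WVar 2)))"
  "linear 3 (WBin (WBin (WVar 0) (WVar (Suc 0))) (WVar 2))"
  "linear 1 (WVar 0)" "linear 0 WNul" "linear 1 (WBin WNul (WVar 0))" "linear 1 (WBin (WVar 0) WNul)"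
  by (auto simp: linear_def upt_rec numeral_2_eq_2 numeral_3_eq_3)

lemma planar_level:
  "planar t \<in> level (arity t)"
  by (simp add: permutes_id)

text \<open>The blocks keep their order, so composing planar trees under the symbol \<open>.\<close>
  produces no permutation. By this recursion an algebra is determined on planar trees by its values
  at the two generators.\<close>

lemma comp_planar:
  "compS free_operad [arity s, arity t] (planar (Bin Unit Unit)) [planar s, planar t] = planar (Bin s t)"
proof -
  have w: "word_of (planar u) = label u [0..<arity u]" for u by (simp add: word_of_def)
  have r: "rename [a..<a + arity u] (label u [0..<arity u]) = label u [a..<a + arity u]" for a u
    by (subst rename_label) (auto intro!: arg_cong[of _ _ "label u"] nth_equalityI)
  have "wcomp [arity s, arity t] (word_of (planar (Bin Unit Unit))) [word_of (planar s), word_of (planar t)]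
      = WBin (rename [0..<arity s] (label s [0..<arity s])) (rename [arity s..<arity s + arity t] (label t [0..<arity t]))"
    by (simp add: w wcomp_def)
  also have "\<dots> = word_of (planar (Bin s t))"
    using r[of 0 s] r[of "arity s" t] by (simp add: w)
  finally have "ptree_of (wcomp [arity s, arity t] (word_of (planar (Bin Unit Unit))) [word_of (planar s), word_of (planar t)])
      = planar (Bin s t)"
    using ptree_of_word_of[OF planar_level] by simp
  then show ?thesis
    using comp_eq_ptree_of(1)[of "planar (Bin Unit Unit)" "[arity s, arity t]" "[planar s, planar t]"]
      planar_level[of "Bin Unit Unit"] planar_level[of s] planar_level[of t] by simp
qed

lemma R_obj_simps [simp]:
  "mcat (R_obj X) = acat X"
  "munit (R_obj X) = FO (op1 X 0 (planar Nul)) []"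
  by (auto simp: R_obj_def Let_def)

section \<open>Images of 1-cells and 2-cells in an algebra\<close>

locale wk_algebra =
  fixes X :: "('o, 'a) wkp_alg"
  assumes algebra: "algebra WkP X"

sublocale wk_algebra \<subseteq> category "acat X"
  using algebra by (simp add: algebra_def)

sublocale wk_algebra \<subseteq> hat: cat_operad_map WkP "End (acat X)" "hat X"
  using algebra by (simp add: algebra_def)

context wk_algebra
begin

abbreviation "C \<equiv> acat X"
abbreviation "M \<equiv> R_obj X"

lemma op1_functor: "x \<in> level n \<Longrightarrow> cat_functor (power_cat C n) C (op1 X n x)"
  using cat_functor.FO_obj[OF hat.levelwise_functor[of n], of x] by (simp add: op1_def)

lemma op2_nat_trans:
  assumes "x \<in> level n" "y \<in> level n"
  shows "nat_trans (power_cat C n) C (op2 X n (x, y))"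
    "NSrc (op2 X n (x, y)) = op1 X n x" "NTgt (op2 X n (x, y)) = op1 X n y"
proof -
  have xy: "(x, y) \<in> Arr (Lev WkP n)" using assms by simp
  note f = cat_functor.FA_simps[OF hat.levelwise_functor[of n] xy]
  show nt: "nat_trans (power_cat C n) C (op2 X n (x, y))"
    using f(1) by (simp add: op2_def)
  show "NSrc (op2 X n (x, y)) = op1 X n x"
    using f(2) nt unfolding WkP_simps(3)[OF assms] End_simps op2_def op1_def by simp
  show "NTgt (op2 X n (x, y)) = op1 X n y"
    using f(3) nt unfolding WkP_simps(4)[OF assms] End_simps op2_def op1_def by simp
qed

lemma op2_in_hom:
  assumes "x \<in> level n" "y \<in> level n" "length As = n" "set As \<subseteq> Obj C"
  shows "NCmp (op2 X n (x, y)) As \<in> Arr C" "Dom C (NCmp (op2 X n (x, y)) As) = FO (op1 X n x) As"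
    "Cod C (NCmp (op2 X n (x, y)) As) = FO (op1 X n y) As"
  using nat_trans.NCmp_in_hom[OF op2_nat_trans(1)[OF assms(1,2)], of As] assms(3,4)
  by (simp_all add: in_hom_def op2_nat_trans(2,3)[OF assms(1,2)])

lemma op2_id:
  assumes "x \<in> level n" "length As = n" "set As \<subseteq> Obj C"
  shows "NCmp (op2 X n (x, x)) As = Ide C (FO (op1 X n x) As)"
proof -
  have "op2 X n (x, x) = Ide (functor_cat (power_cat C n) C) (op1 X n x)"
    using cat_functor.FA_Ide[OF hat.levelwise_functor[of n], of x] WkP_simps(1)[of n] WkP_simps(5)[OF assms(1)] assms(1)
    unfolding op1_def op2_def End_simps by simp
  then show ?thesis using op1_functor[OF assms(1)] assms(2,3) by simp
qed

lemma op2_Cmp: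
  assumes "x \<in> level n" "y \<in> level n" "z \<in> level n" "length As = n" "set As \<subseteq> Obj C"
  shows "Cmp C (NCmp (op2 X n (y, z)) As) (NCmp (op2 X n (x, y)) As) = NCmp (op2 X n (x, z)) As"
proof -
  have "composable (Lev WkP n) (y, z) (x, y)"
    using assms(1-3) WkP_simps(3)[OF assms(2,3)] WkP_simps(4)[OF assms(1,2)] by (simp add: composable_def)
  from cat_functor.FA_Cmp[OF hat.levelwise_functor this]
  have "op2 X n (x, z) = Cmp (functor_cat (power_cat C n) C) (op2 X n (y, z)) (op2 X n (x, y))"
    unfolding WkP_simps(6)[OF assms(1-3)] op2_def End_simps .
  then show ?thesis using op2_nat_trans assms by simp
qed

lemma op1_comp:
  assumes "x \<in> level (length ks)" "list_all2 (\<lambda>k x. x \<in> level k) ks xs"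
  shows "op1 X (sum_list ks) (compS free_operad ks x xs) = end_compO C ks (op1 X (length ks) x) (map2 (op1 X) ks xs)"
proof -
  have "op1 X = (\<lambda>k. FO (hat X k))" by (intro ext) (simp add: op1_def)
  then show ?thesis
    using hat.preserves_compO[of x ks xs] assms unfolding WkP_simps(1,8) End_simps by simp
qed

lemma op2_comp:
  assumes "x \<in> level (length ks)" "y \<in> level (length ks)"
    and "list_all2 (\<lambda>k e. e \<in> level k \<times> level k) ks es"
  shows "op2 X (sum_list ks) (compS free_operad ks x (map fst es), compS free_operad ks y (map snd es)) =
    end_compA C ks (op2 X (length ks) (x, y)) (map2 (op2 X) ks es)"
proof -
  have "op2 X = (\<lambda>k. FA (hat X k))" by (intro ext) (simp add: op2_def)
  then show ?thesis
    using hat.preserves_compA[of "(x, y)" ks es] assms unfolding WkP_simps(2,9) End_simps by simp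
qed

lemma op1_act:
  assumes "x \<in> level n" "\<pi> permutes {..<n}"
  shows "op1 X n (actS free_operad n \<pi> x) = end_actO C n \<pi> (op1 X n x)"
  using hat.preserves_actO[of x n \<pi>] assms unfolding op1_def End_simps WkP_simps(1)
  by (cases x) (simp add: free_operad_def)

lemma op2_act:
  assumes "x \<in> level n" "y \<in> level n" "\<pi> permutes {..<n}"
  shows "op2 X n (actS free_operad n \<pi> x, actS free_operad n \<pi> y) = end_actA C n \<pi> (op2 X n (x, y))"
  using hat.preserves_actA[of "(x, y)" n \<pi>] assms unfolding op2_def End_simps WkP_simps(2,11) by simp

lemma op1_unit: "op1 X 1 (planar Unit) = \<lparr>FO = (\<lambda>As\<in>Obj (power_cat C 1). hd As), FA = (\<lambda>fs\<in>Arr (power_cat C 1). hd fs)\<rparr>"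
  using hat.preserves_unit unfolding op1_def End_simps WkP_simps(7) .

lemma tensor_R_obj:
  "A \<in> Obj C \<Longrightarrow> B \<in> Obj C \<Longrightarrow> A \<otimes>\<^bsub>M\<^esub> B = FO (op1 X 2 (planar (Bin Unit Unit))) [A, B]"
  "f \<in> Arr C \<Longrightarrow> g \<in> Arr C \<Longrightarrow> f \<odot>\<^bsub>M\<^esub> g = FA (op1 X 2 (planar (Bin Unit Unit))) [f, g]"
  by (auto simp: R_obj_def Let_def)

definition planar_op :: "tree \<Rightarrow> ('o list, 'a list, 'o, 'a) func" where
  "planar_op t = op1 X (arity t) (planar t)"

lemma planar_op_functor: "cat_functor (power_cat C (arity t)) C (planar_op t)"
  unfolding planar_op_def by (rule op1_functor[OF planar_level])

lemma planar_op_Bin: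
  "planar_op (Bin s t) = end_compO C [arity s, arity t] (op1 X 2 (planar (Bin Unit Unit))) [planar_op s, planar_op t]"
proof -
  have lev: "list_all2 (\<lambda>k x. x \<in> level k) [arity s, arity t] [planar s, planar t]"
    using planar_level[of s] planar_level[of t] by simp
  show ?thesis
    using op1_comp[OF _ lev, of "planar (Bin Unit Unit)"] planar_level[of "Bin Unit Unit"]
    by (simp add: comp_planar numeral_2_eq_2 planar_op_def)
qed

text \<open>Compatibility with composition yields the recursion for \<open>Bin\<close>, and
  preservation of the operadic unit the case of a single leaf.\<close>

lemma planar_op_tree:
  "length As = arity t \<Longrightarrow> set As \<subseteq> Obj C \<Longrightarrow> FO (planar_op t) As = tree_obj M t As"
  "length fs = arity t \<Longrightarrow> set fs \<subseteq> Arr C \<Longrightarrow> FA (planar_op t) fs = tree_arr M t fs"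
proof (induction t arbitrary: As fs)
  case Unit
  have "planar_op Unit = op1 X 1 (planar Unit)" by (simp add: planar_op_def)
  note [simp] = this[unfolded op1_unit]
  {
    case 1
    then show ?case by simp
  next
    case 2
    then show ?case by simp
  }
next
  case Nul
  interpret F: cat_functor "power_cat C 0" C "planar_op Nul"
    using planar_op_functor[of Nul] by simp
  have u: "munit M = FO (planar_op Nul) []" by (simp add: planar_op_def)
  {
    case 1
    then show ?case by (simp add: u del: R_obj_simps(2))
  next
    case 2
    \<comment> \<open>The empty list of arrows is the identity of the empty list of objects, so
      functoriality fixes the value.\<close>
    then show ?case using F.FA_Ide[of "[]"] by (simp add: u del: R_obj_simps(2))
  }
next
  case (Bin s t)
  interpret F: cat_functor "power_cat C (arity s)" C "planar_op s"
    by (rule planar_op_functor)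
  interpret G: cat_functor "power_cat C (arity t)" C "planar_op t"
    by (rule planar_op_functor)
  have sub: "set (take n xs) \<subseteq> Y" "set (drop n xs) \<subseteq> Y" if "set xs \<subseteq> Y" for n Y and xs :: "'c list"
    using that set_take_subset set_drop_subset by fast+
  {
    case 1
    then show ?case
      using Bin.IH(1)[of "take (arity s) As"] Bin.IH(3)[of "drop (arity s) As"] sub[OF 1(2), of "arity s"]
        F.FO_obj[of "take (arity s) As"] G.FO_obj[of "drop (arity s) As"]
      by (simp add: planar_op_Bin end_compO_def tensor_R_obj)
  next
    case 2
    then show ?case
      using Bin.IH(2)[of "take (arity s) fs"] Bin.IH(4)[of "drop (arity s) fs"] sub[OF 2(2), of "arity s"]
        F.FA_simps(1)[of "take (arity s) fs"] G.FA_simps(1)[of "drop (arity s) fs"]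
      by (simp add: planar_op_Bin end_compO_def tensor_R_obj)
  }
qed

text \<open>A permuted tree is \<open>\<sigma>\<close> acting on a planar one, so equivariance
  extends \<open>planar_op_tree\<close> to all 1-cells; extensionality turns agreement on objects
  and arrows into equality of functors.\<close>

lemma op1_eq_interp:
  assumes x: "x \<in> level n"
  shows "op1 X n x = interp M x"
proof -
  obtain \<sigma> t where x': "x = (\<sigma>, t)" "arity t = n" "\<sigma> permutes {..<n}" using x by auto
  interpret F: cat_functor "power_cat C n" C "op1 X n (planar t)"
    using op1_functor[OF planar_level[of t]] x' by simp
  have "op1 X n (planar t) = \<lparr>FO = (\<lambda>As\<in>Obj (power_cat C n). tree_obj M t As),
      FA = (\<lambda>fs\<in>Arr (power_cat C n). tree_arr M t fs)\<rparr>" (is "_ = ?r")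
  proof -
    have "FO (op1 X n (planar t)) = FO ?r"
      using F.FO_type planar_op_tree(1)[of _ t, unfolded planar_op_def] x'(2) by (intro extensionalityI[of _ "Obj (power_cat C n)"]) (auto simp: PiE_def)
    moreover have "FA (op1 X n (planar t)) = FA ?r"
      using F.FA_type planar_op_tree(2)[of _ t, unfolded planar_op_def] x'(2) by (intro extensionalityI[of _ "Arr (power_cat C n)"]) (auto simp: PiE_def)
    ultimately show ?thesis by simp
  qed
  moreover have "actS free_operad n \<sigma> (planar t) = (\<sigma>, t)" by (simp add: free_operad_def)
  moreover have "planar t \<in> level n" using planar_level[of t] x'(2) by simp
  ultimately show ?thesis
    using op1_act[of "planar t" n \<sigma>] x'(2,3) by (simp add: interp_def x'(1))
qed

lemma FO_op1:
  assumes "x \<in> level n" "length As = n" "set As \<subseteq> Obj C"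
  shows "FO (op1 X n x) As = wobj M (word_of x) As" "wobj M (word_of x) As \<in> Obj C"
proof -
  show eq: "FO (op1 X n x) As = wobj M (word_of x) As"
    using assms by (simp add: op1_eq_interp[OF assms(1)] interp_eq[OF assms(1)] interpw_def)
  show "wobj M (word_of x) As \<in> Obj C"
    using cat_functor.FO_obj[OF op1_functor[OF assms(1)], of As] assms by (simp flip: eq)
qed

lemma FA_op1:
  assumes "x \<in> level n" "length fs = n" "set fs \<subseteq> Arr C"
  shows "FA (op1 X n x) fs = warr M (word_of x) fs"
  using assms by (simp add: op1_eq_interp[OF assms(1)] interp_eq[OF assms(1)] interpw_def)

definition cell :: "nat \<Rightarrow> word \<Rightarrow> word \<Rightarrow> 'o list \<Rightarrow> 'a" where
  "cell n u v = NCmp (op2 X n (ptree_of u, ptree_of v))"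

lemma cell_in_hom:
  assumes "linear n u" "linear n v" "length As = n" "set As \<subseteq> Obj C"
  shows "cell n u v As \<in> Arr C" "Dom C (cell n u v As) = wobj M u As" "Cod C (cell n u v As) = wobj M v As"
  using op2_in_hom[OF ptree_of_level[OF assms(1)] ptree_of_level[OF assms(2)] assms(3,4)]
    FO_op1(1)[OF ptree_of_level[OF assms(1)] assms(3,4)] FO_op1(1)[OF ptree_of_level[OF assms(2)] assms(3,4)]
  by (simp_all add: cell_def)

lemma cell_id:
  assumes "linear n u" "length As = n" "set As \<subseteq> Obj C"
  shows "cell n u u As = Ide C (wobj M u As)"
  using op2_id[OF ptree_of_level[OF assms(1)] assms(2,3)] FO_op1(1)[OF ptree_of_level[OF assms(1)] assms(2,3)]
  by (simp add: cell_def)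

lemma cell_Cmp:
  assumes "linear n u" "linear n v" "linear n w" "length As = n" "set As \<subseteq> Obj C"
  shows "Cmp C (cell n v w As) (cell n u v As) = cell n u w As"
  unfolding cell_def by (intro op2_Cmp ptree_of_level assms)

lemma cell_natural:
  assumes "linear n u" "linear n v" "length fs = n" "set fs \<subseteq> Arr C"
  shows "Cmp C (cell n u v (map (Cod C) fs)) (warr M u fs) = Cmp C (warr M v fs) (cell n u v (map (Dom C) fs))"
proof -
  note l = ptree_of_level[OF assms(1)] ptree_of_level[OF assms(2)]
  show ?thesis
    using nat_trans.naturality[OF op2_nat_trans(1)[OF l], of fs] assms(3,4) FA_op1[OF l(1) assms(3,4)] FA_op1[OF l(2) assms(3,4)]
    by (simp add: cell_def op2_nat_trans(2,3)[OF l])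
qed

text \<open>Renaming both words by \<open>\<pi>\<close> is the action on their trees, which the
  algebra turns into a permutation of the arguments.\<close>

lemma cell_act:
  assumes "linear n u" "linear n v" "\<pi> permutes {..<n}" "length As = n" "set As \<subseteq> Obj C"
  shows "cell n (rename (map \<pi> [0..<n]) u) (rename (map \<pi> [0..<n]) v) As = cell n u v (permute_list \<pi> As)"
proof -
  note l = ptree_of_level[OF assms(1)] ptree_of_level[OF assms(2)]
  have p: "ptree_of (rename (map \<pi> [0..<n]) w) = actS free_operad n \<pi> (ptree_of w)" if "linear n w" for w
    using word_of_act[OF ptree_of_level[OF that] assms(3)] ptree_of_word_of[OF act_level[OF ptree_of_level[OF that] assms(3)]]
    by (simp del: map_map)
  show ?thesis
    unfolding cell_def p[OF assms(1)] p[OF assms(2)] op2_act[OF l assms(3)]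
    using assms(4,5) by (simp add: end_actA_def)
qed

end

section \<open>Realized arrows: images of 2-cells at words with repetitions\<close>

lemma in_Obj_nth: "set As \<subseteq> X \<Longrightarrow> set js \<subseteq> {..<length As} \<Longrightarrow> set (map ((!) As) js) \<subseteq> X"
  by (force simp: subset_iff)

lemma set_rename:
  assumes "linear n u" "length js = n"
  shows "set (leaves (rename js u)) = set js" "wvars (rename js u) = set js"
proof -
  show "set (leaves (rename js u)) = set js"
    using linear_simps(1)[OF assms(1)] assms(2) by (auto simp: set_conv_nth[of js])
  then show "wvars (rename js u) = set js" by (simp add: wvars_leaves)
qed

lemma rename_linear:
  assumes "linear n u" "length js = n"
  shows "leaves (rename js u) = map ((!) js) (leaves u)" "shape (rename js u) = shape u"
  using linear_simps(1)[OF assms(1)] assms(2) by simp_all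

context wk_algebra
begin

text \<open>
  Words with repeated variables are admitted, so that the structure maps can be instantiated at
  arbitrary words; only for a source without repetitions is a realized arrow unique.
\<close>

definition realized :: "'o list \<Rightarrow> word \<Rightarrow> word \<Rightarrow> 'a \<Rightarrow> bool" where
  "realized As u v f \<longleftrightarrow> (\<exists>n u' v' js. linear n u' \<and> linear n v' \<and> length js = n \<and> set js \<subseteq> {..<length As} \<and>
     u = rename js u' \<and> v = rename js v' \<and> f = cell n u' v' (map ((!) As) js))"

lemma realizedI:
  assumes "linear n u" "linear n v" "length js = n" "set js \<subseteq> {..<length As}"
  shows "realized As (rename js u) (rename js v) (cell n u v (map ((!) As) js))"
  unfolding realized_def using assms by blast

text \<open>A realized arrow can be presented over any linear presentation \<open>u'\<close>,
  \<open>js\<close> of its source: two presentations have the same shape, so they differ by a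
  permutation, which equivariance moves from the words to the arguments. Composition needs this, as
  the middle word arrives with two presentations.\<close>

lemma realizedE:
  assumes r: "realized As u v f" and As: "set As \<subseteq> Obj C"
    and u: "linear n u'" "length js = n" "u = rename js u'"
  obtains v' where "linear n v'" "v = rename js v'" "f = cell n u' v' (map ((!) As) js)" "set js \<subseteq> {..<length As}"
proof -
  obtain m u0 v0 ls where 0: "linear m u0" "linear m v0" "length ls = m" "set ls \<subseteq> {..<length As}"
    "u = rename ls u0" "v = rename ls v0" "f = cell m u0 v0 (map ((!) As) ls)"
    using r unfolding realized_def by blast
  note l0 = linear_simps[OF 0(1)] and l = linear_simps[OF u(1)]
  have eq: "leaves u = map ((!) ls) (leaves u0)" "leaves u = map ((!) js) (leaves u')"
    "shape u = shape u0" "shape u = shape u'"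
    using rename_linear[OF 0(1,3)] rename_linear[OF u(1,2)] unfolding 0(5)[symmetric] u(3)[symmetric] by simp_all
  have m: "m = n" using arg_cong[OF eq(1), of length] arg_cong[OF eq(2), of length] l0(3) l(3) by simp
  obtain \<pi> where \<pi>: "\<pi> permutes {..<n}" "rename (map \<pi> [0..<n]) u0 = u'" "map \<pi> (leaves u0) = leaves u'"
    using linear_relabel[of n u0 u'] 0(1) u(1) eq(3,4) m by metis
  \<comment> \<open>Comparing the labels of \<open>u\<close> leaf by leaf expresses
    \<open>ls\<close> through \<open>js\<close> and \<open>\<pi>\<close>.\<close>
  have "map ((!) ls) (leaves u0) = map (\<lambda>i. js ! \<pi> i) (leaves u0)"
    using eq(1,2) by (simp add: comp_def flip: \<pi>(3))
  then have "ls ! i = js ! \<pi> i" if "i < n" for i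
    using that l0(1) m by (simp add: map_eq_conv)
  then have ls: "ls = map ((!) js) (map \<pi> [0..<n])"
    using 0(3) m by (intro nth_equalityI) auto
  have p: "\<pi> i < n" if "i < n" for i using permutes_in_image[OF \<pi>(1)] that by simp
  have sub: "rename js (rename (map \<pi> [0..<n]) w) = rename ls w" if "linear n w" for w
  proof -
    have "rename js (rename (map \<pi> [0..<n]) w) = wsubst (map (rename js) (map WVar (map \<pi> [0..<n]))) w"
      using linear_simps(1)[OF that] by (intro wsubst_wsubst) simp
    also have "map (rename js) (map WVar (map \<pi> [0..<n])) = map WVar ls"
      using u(2) p by (simp add: ls)
    finally show ?thesis .
  qed
  have si: "set ls = set js"
    using set_rename(1)[OF 0(1,3)] set_rename(1)[OF u(1,2)] 0(5) u(3) by simp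
  define v' where "v' = rename (map \<pi> [0..<n]) v0"
  have lv: "linear n v'"
    using linear_word_of[OF act_level[OF ptree_of_level[of n v0] \<pi>(1)]] word_of_act[OF ptree_of_level[of n v0] \<pi>(1)] 0(2) m
    unfolding v'_def by simp
  have vv: "v = rename js v'"
    using sub[of v0] 0(2,6) m by (simp only: v'_def)
  have "map ((!) As) ls = permute_list \<pi> (map ((!) As) js)"
    using u(2) p by (intro nth_equalityI) (simp_all add: ls permute_list_def)
  then have "f = cell n u0 v0 (permute_list \<pi> (map ((!) As) js))"
    using 0(7) m by simp
  also have "\<dots> = cell n u' v' (map ((!) As) js)"
    unfolding \<pi>(2)[symmetric] v'_def
    using 0(1,2,4) m \<pi>(1) u(2) si in_Obj_nth[OF As, of js] by (intro cell_act[symmetric]) auto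
  finally show ?thesis
    using that lv vv si 0(4) by blast
qed

lemma realizedE_standard:
  assumes "realized As u v f" "set As \<subseteq> Obj C"
  obtains v' where "linear (length (leaves u)) v'" "v = rename (leaves u) v'"
    "f = cell (length (leaves u)) (standard u) v' (map ((!) As) (leaves u))" "set (leaves u) \<subseteq> {..<length As}"
  using realizedE[OF assms linear_standard refl, of u] by auto

lemma wobj_rename_linear:
  "linear n u \<Longrightarrow> length js = n \<Longrightarrow> wobj M (rename js u) As = wobj M u (map ((!) As) js)"
  using linear_simps(1) by (intro wobj_rename) (simp add: wvars_leaves)

lemma wobj_M_obj:
  assumes "set As \<subseteq> Obj C" "wvars u \<subseteq> {..<length As}"
  shows "wobj M u As \<in> Obj C"
proof -
  have s: "set (leaves u) \<subseteq> {..<length As}" using assms by (simp add: wvars_leaves)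
  have "wobj M (standard u) (map ((!) As) (leaves u)) \<in> Obj C"
    using FO_op1(2)[OF ptree_of_level[OF linear_standard], of "map ((!) As) (leaves u)" u] in_Obj_nth[OF assms(1) s]
    by simp
  then show ?thesis
    using wobj_rename_linear[OF linear_standard refl, of u As] by simp
qed

lemma realized_in_hom:
  assumes "realized As u v f" "set As \<subseteq> Obj C"
  shows "f \<in> Arr C" "Dom C f = wobj M u As" "Cod C f = wobj M v As"
    "wvars u \<subseteq> {..<length As}" "wvars v \<subseteq> {..<length As}"
proof -
  obtain n u' v' js where 0: "linear n u'" "linear n v'" "length js = n" "set js \<subseteq> {..<length As}"
    "u = rename js u'" "v = rename js v'" "f = cell n u' v' (map ((!) As) js)"
    using assms unfolding realized_def by blast
  note h = cell_in_hom[OF 0(1,2), of "map ((!) As) js"]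
  show "f \<in> Arr C" "Dom C f = wobj M u As" "Cod C f = wobj M v As"
    using h 0(3) in_Obj_nth[OF assms(2) 0(4)] wobj_rename_linear[OF 0(1,3)] wobj_rename_linear[OF 0(2,3)]
    by (simp_all add: 0(5-7))
  show "wvars u \<subseteq> {..<length As}" "wvars v \<subseteq> {..<length As}"
    using set_rename(2)[OF 0(1,3)] set_rename(2)[OF 0(2,3)] 0(4-6) by simp_all
qed

lemma realized_id:
  assumes "set As \<subseteq> Obj C" "wvars u \<subseteq> {..<length As}"
  shows "realized As u u (Ide C (wobj M u As))"
proof -
  have s: "set (leaves u) \<subseteq> {..<length As}" using assms by (simp add: wvars_leaves)
  have "cell (length (leaves u)) (standard u) (standard u) (map ((!) As) (leaves u)) = Ide C (wobj M u As)"
    using cell_id[OF linear_standard, of "map ((!) As) (leaves u)" u] in_Obj_nth[OF assms(1) s]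
      wobj_rename_linear[OF linear_standard refl, of u As] by simp
  then show ?thesis
    using realizedI[OF linear_standard linear_standard refl s] by simp
qed

lemma realized_Cmp:
  assumes f: "realized As u v f" and g: "realized As v w g" and As: "set As \<subseteq> Obj C"
  shows "realized As u w (Cmp C g f)"
proof -
  obtain n u' v' js where 0: "linear n u'" "linear n v'" "length js = n" "set js \<subseteq> {..<length As}"
    "u = rename js u'" "v = rename js v'" "f = cell n u' v' (map ((!) As) js)"
    using f unfolding realized_def by blast
  obtain w' where w: "linear n w'" "w = rename js w'" "g = cell n v' w' (map ((!) As) js)"
    using realizedE[OF g As 0(2,3,6)] by blast
  have "Cmp C g f = cell n u' w' (map ((!) As) js)"
    unfolding 0(7) w(3) using in_Obj_nth[OF As 0(4)] 0(3) by (intro cell_Cmp 0 w) auto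
  then show ?thesis
    using realizedI[OF 0(1) w(1) 0(3,4)] 0(5) w(2) by simp
qed

text \<open>Any two 1-cells of equal arity are joined by 2-cells in both directions, and the image
  of the reversed 2-cell is the inverse.\<close>

lemma realized_iso:
  assumes f: "realized As u v f" and As: "set As \<subseteq> Obj C"
  shows "is_iso C f" "realized As v u (inv_arr C f)"
proof -
  obtain n u' v' js where 0: "linear n u'" "linear n v'" "length js = n" "set js \<subseteq> {..<length As}"
    "u = rename js u'" "v = rename js v'" "f = cell n u' v' (map ((!) As) js)"
    using f unfolding realized_def by blast
  let ?As = "map ((!) As) js" and ?g = "cell n v' u' (map ((!) As) js)"
  have As': "length ?As = n" "set ?As \<subseteq> Obj C" using in_Obj_nth[OF As 0(4)] 0(3) by auto
  have "inverse_arr C f ?g"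
    unfolding inverse_arr_def in_hom_def 0(7)
    using cell_in_hom[OF 0(1,2) As'] cell_in_hom[OF 0(2,1) As'] cell_Cmp[OF 0(1,2,1) As'] cell_Cmp[OF 0(2,1,2) As']
      cell_id[OF 0(1) As'] cell_id[OF 0(2) As'] by simp
  moreover have "f \<in> Arr C" using realized_in_hom[OF f As] by simp
  ultimately show "is_iso C f" "realized As v u (inv_arr C f)"
    using realizedI[OF 0(2,1,3,4)] inv_arr_eq[of f ?g] 0(5,6) by (auto simp: is_iso_def)
qed

text \<open>Presented over the standard word of \<open>u\<close>, both arrows are values of 2-cells
  with the same source. Without repetitions renaming by the leaves of \<open>u\<close> is injective,
  so the targets agree too, and there is only one 2-cell between two given trees.\<close>

lemma realized_unique:
  assumes f: "realized As u v f" and g: "realized As u v g" and "distinct (leaves u)" and As: "set As \<subseteq> Obj C"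
  shows "f = g"
proof -
  obtain v1 where 1: "linear (length (leaves u)) v1" "v = rename (leaves u) v1"
    "f = cell (length (leaves u)) (standard u) v1 (map ((!) As) (leaves u))"
    using realizedE_standard[OF f As] by blast
  obtain v2 where 2: "linear (length (leaves u)) v2" "v = rename (leaves u) v2"
    "g = cell (length (leaves u)) (standard u) v2 (map ((!) As) (leaves u))"
    using realizedE_standard[OF g As] by blast
  have "shape v1 = shape v2" "map ((!) (leaves u)) (leaves v1) = map ((!) (leaves u)) (leaves v2)"
    using rename_linear[OF 1(1) refl] rename_linear[OF 2(1) refl] unfolding 1(2)[symmetric] 2(2)[symmetric] by simp_all
  moreover have "inj_on ((!) (leaves u)) (set (leaves v1) \<union> set (leaves v2))"
    using assms(3) linear_simps(1)[OF 1(1)] linear_simps(1)[OF 2(1)] by (auto simp: inj_on_def nth_eq_iff_index_eq)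
  ultimately have "v1 = v2"
    by (intro word_eqI) (auto dest: map_inj_on)
  then show ?thesis using 1 2 by simp
qed

text \<open>Preservation of horizontal composition in terms of words: the inner cells are applied
  under the functor of \<open>u\<close>, then the outer cell at their targets.\<close>

lemma op2_comp_cell:
  assumes u: "linear (length ks) u" "linear (length ks) v" and us: "list_all2 linear ks us" and vs: "list_all2 linear ks vs"
    and As: "length As = sum_list ks" "set As \<subseteq> Obj C"
  shows "cell (sum_list ks) (wcomp ks u us) (wcomp ks v vs) As =
      Cmp C (cell (length ks) u v (map2 (wobj M) vs (blocks ks As)))
        (warr M u (map (\<lambda>i. cell (ks ! i) (us ! i) (vs ! i) (blocks ks As ! i)) [0..<length ks]))"
    and "linear (sum_list ks) (wcomp ks u us)"
proof -
  let ?n = "length ks"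
  have len: "length us = ?n" "length vs = ?n" using list_all2_lengthD[OF us] list_all2_lengthD[OF vs] by simp_all
  have lin: "linear (ks ! i) (us ! i)" "linear (ks ! i) (vs ! i)" if "i < ?n" for i
    using us vs that by (simp_all add: list_all2_conv_all_nth)
  note pu = ptree_of_level[OF u(1)] and pv = ptree_of_level[OF u(2)]
  have xs: "list_all2 (\<lambda>k x. x \<in> level k) ks (map ptree_of us)" "list_all2 (\<lambda>k x. x \<in> level k) ks (map ptree_of vs)"
    using len ptree_of_level[OF lin(1)] ptree_of_level[OF lin(2)] by (auto simp: list_all2_conv_all_nth)
  have cu: "compS free_operad ks (ptree_of u) (map ptree_of us) = ptree_of (wcomp ks u us)"
    and cv: "compS free_operad ks (ptree_of v) (map ptree_of vs) = ptree_of (wcomp ks v vs)"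
    and l: "linear (sum_list ks) (wcomp ks u us)"
    using comp_eq_ptree_of[OF pu xs(1)] comp_eq_ptree_of(1)[OF pv xs(2)] by (simp_all add: comp_def)
  show "linear (sum_list ks) (wcomp ks u us)" by (rule l)
  let ?es = "zip (map ptree_of us) (map ptree_of vs)"
  have es: "list_all2 (\<lambda>k e. e \<in> level k \<times> level k) ks ?es"
    using len ptree_of_level[OF lin(1)] ptree_of_level[OF lin(2)] by (auto simp: list_all2_conv_all_nth)
  have op: "op2 X (sum_list ks) (ptree_of (wcomp ks u us), ptree_of (wcomp ks v vs)) =
      end_compA C ks (op2 X ?n (ptree_of u, ptree_of v)) (map2 (op2 X) ks ?es)"
    using op2_comp[OF pu pv es] len by (simp add: cu cv)
  have bl: "length (blocks ks As ! i) = ks ! i" "set (blocks ks As ! i) \<subseteq> Obj C" if "i < ?n" for i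
    using that As set_blocks_subset[OF As] by simp_all
  have a: "map2 (\<lambda>\<theta>. FO (NTgt \<theta>)) (map2 (op2 X) ks ?es) (blocks ks As) = map2 (wobj M) vs (blocks ks As)"
  proof (rule nth_equalityI)
    fix i assume "i < length (map2 (\<lambda>\<theta>. FO (NTgt \<theta>)) (map2 (op2 X) ks ?es) (blocks ks As))"
    then have i: "i < ?n" by simp
    show "map2 (\<lambda>\<theta>. FO (NTgt \<theta>)) (map2 (op2 X) ks ?es) (blocks ks As) ! i = map2 (wobj M) vs (blocks ks As) ! i"
      using i len FO_op1(1)[OF ptree_of_level[OF lin(2)[OF i]] bl[OF i]]
        op2_nat_trans(3)[OF ptree_of_level[OF lin(1)[OF i]] ptree_of_level[OF lin(2)[OF i]]]
      by simp
  qed (simp add: len)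
  have b: "map2 NCmp (map2 (op2 X) ks ?es) (blocks ks As) =
      map (\<lambda>i. cell (ks ! i) (us ! i) (vs ! i) (blocks ks As ! i)) [0..<?n]"
    using len by (intro nth_equalityI) (simp_all add: cell_def)
  have c: "set (map (\<lambda>i. cell (ks ! i) (us ! i) (vs ! i) (blocks ks As ! i)) [0..<?n]) \<subseteq> Arr C"
    using cell_in_hom(1)[OF lin bl] by auto
  have "cell (sum_list ks) (wcomp ks u us) (wcomp ks v vs) As =
     Cmp C (NCmp (op2 X ?n (ptree_of u, ptree_of v)) (map2 (\<lambda>\<theta>. FO (NTgt \<theta>)) (map2 (op2 X) ks ?es) (blocks ks As)))
      (FA (op1 X ?n (ptree_of u)) (map2 NCmp (map2 (op2 X) ks ?es) (blocks ks As)))"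
    unfolding cell_def op end_compA_def using As op2_nat_trans(2)[OF pu pv] by simp
  then show "cell (sum_list ks) (wcomp ks u us) (wcomp ks v vs) As =
      Cmp C (cell (length ks) u v (map2 (wobj M) vs (blocks ks As)))
        (warr M u (map (\<lambda>i. cell (ks ! i) (us ! i) (vs ! i) (blocks ks As ! i)) [0..<length ks]))"
    unfolding a b using FA_op1[OF pu _ c] by (simp add: cell_def)
qed

lemma warr_M_Ide:
  assumes "linear n u" "length As = n" "set As \<subseteq> Obj C"
  shows "warr M u (map (Ide C) As) = Ide C (wobj M u As)"
proof -
  note l = ptree_of_level[OF assms(1)]
  have "FA (op1 X n (ptree_of u)) (map (Ide C) As) = Ide C (FO (op1 X n (ptree_of u)) As)"
    using cat_functor.FA_Ide[OF op1_functor[OF l], of As] assms by simp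
  moreover have "set (map (Ide C) As) \<subseteq> Arr C" using assms by auto
  ultimately show ?thesis
    using FA_op1[OF l, of "map (Ide C) As"] FO_op1(1)[OF l assms(2,3)] assms by simp
qed

text \<open>The 2-cell is composed with identity 2-cells of the standard words of \<open>ws\<close>,
  and the inputs are renamed by the concatenated leaves. As the inner factor is an identity, the
  composite is the component of the given cell at the values of \<open>ws\<close>; so the structure
  maps may be instantiated at arbitrary words.\<close>

lemma realized_cell:
  assumes u: "linear (length ws) u" "linear (length ws) v" and As: "set As \<subseteq> Obj C"
    and ws: "\<And>w. w \<in> set ws \<Longrightarrow> wvars w \<subseteq> {..<length As}"
  shows "realized As (wsubst ws u) (wsubst ws v) (cell (length ws) u v (map (\<lambda>w. wobj M w As) ws))"
proof -
  let ?n = "length ws" and ?ks = "map length (map leaves ws)" and ?js = "concat (map leaves ws)" and ?us = "map standard ws"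
  have u': "linear (length ?ks) u" "linear (length ?ks) v" using u by auto
  have us: "list_all2 linear ?ks ?us"
    using linear_standard by (simp add: list_all2_conv_all_nth)
  have js: "length ?js = sum_list ?ks" "set ?js \<subseteq> {..<length As}"
    using ws by (auto simp: length_concat comp_def wvars_leaves)
  let ?As = "map ((!) As) ?js"
  have As': "length ?As = sum_list ?ks" "set ?As \<subseteq> Obj C"
    using js in_Obj_nth[OF As js(2)] by simp_all
  have bl: "blocks ?ks ?js = map leaves ws" by (rule blocks_concat)
  then have blA: "blocks ?ks ?As = map (\<lambda>w. map ((!) As) (leaves w)) ws"
    by (simp only: blocks_map) simp
  have r: "rename ?js (wcomp ?ks w ?us) = wsubst ws w" if "linear ?n w" for w
  proof -
    have "map2 rename (map leaves ws) ?us = ws"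
      by (rule nth_equalityI) auto
    then show ?thesis using rename_wcomp[of ?ks w ?us ?js] us js that by (simp only: bl) simp
  qed
  have wob: "wobj M w As \<in> Obj C" if "w \<in> set ws" for w
    using ws[OF that] As by (rule wobj_M_obj[rotated])
  have w: "map2 (wobj M) ?us (blocks ?ks ?As) = map (\<lambda>w. wobj M w As) ws"
    unfolding blA using wobj_rename_linear[OF linear_standard refl, of _ As] by (intro nth_equalityI) auto
  have "cell (?ks ! i) (?us ! i) (?us ! i) (blocks ?ks ?As ! i) = Ide C (wobj M (ws ! i) As)" if i: "i < ?n" for i
  proof -
    have s: "set (leaves (ws ! i)) \<subseteq> {..<length As}" using ws[of "ws ! i"] i by (simp add: wvars_leaves)
    show ?thesis
      unfolding blA using i cell_id[OF linear_standard, of "map ((!) As) (leaves (ws ! i))"] in_Obj_nth[OF As s]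
        wobj_rename_linear[OF linear_standard refl, of "ws ! i" As] by simp
  qed
  then have ids: "map (\<lambda>i. cell (?ks ! i) (?us ! i) (?us ! i) (blocks ?ks ?As ! i)) [0..<length ?ks] =
      map (Ide C) (map (\<lambda>w. wobj M w As) ws)"
    by (intro nth_equalityI) simp_all
  have S: "length (map (\<lambda>w. wobj M w As) ws) = ?n" "set (map (\<lambda>w. wobj M w As) ws) \<subseteq> Obj C"
    using wob by auto
  have "cell (sum_list ?ks) (wcomp ?ks u ?us) (wcomp ?ks v ?us) ?As = cell ?n u v (map (\<lambda>w. wobj M w As) ws)"
    unfolding op2_comp_cell(1)[OF u' us us As'] w ids warr_M_Ide[OF u(1) S]
    using cell_in_hom[OF u S] by simp
  moreover have "realized As (rename ?js (wcomp ?ks u ?us)) (rename ?js (wcomp ?ks v ?us))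
      (cell (sum_list ?ks) (wcomp ?ks u ?us) (wcomp ?ks v ?us) ?As)"
    by (intro realizedI op2_comp_cell(2)[OF u'(1,1) us us As'] op2_comp_cell(2)[OF u'(2,2) us us As'] js)
  ultimately show ?thesis
    unfolding r[OF u(1)] r[OF u(2)] by simp
qed

text \<open>The horizontal composite of the two 2-cells with the identity 2-cell of the symbol
  \<open>.\<close>, the lists of names being put side by side.\<close>

lemma realized_tensor:
  assumes f: "realized As u v f" and g: "realized As u' v' g" and As: "set As \<subseteq> Obj C"
  shows "realized As (WBin u u') (WBin v v') (f \<odot>\<^bsub>M\<^esub> g)"
proof -
  obtain m u1 v1 ls where 1: "linear m u1" "linear m v1" "length ls = m" "set ls \<subseteq> {..<length As}"
    "u = rename ls u1" "v = rename ls v1" "f = cell m u1 v1 (map ((!) As) ls)"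
    using f unfolding realized_def by blast
  obtain n u2 v2 js where 2: "linear n u2" "linear n v2" "length js = n" "set js \<subseteq> {..<length As}"
    "u' = rename js u2" "v' = rename js v2" "g = cell n u2 v2 (map ((!) As) js)"
    using g unfolding realized_def by blast
  let ?p = "WBin (WVar 0) (WVar (Suc 0))" and ?ks = "[m, n]" and ?js = "ls @ js"
  have p: "linear (length ?ks) ?p" using linear_planar(1) by (simp add: numeral_2_eq_2)
  have us: "list_all2 linear ?ks [u1, u2]" and vs: "list_all2 linear ?ks [v1, v2]" using 1 2 by simp_all
  have js: "length ?js = sum_list ?ks" "set ?js \<subseteq> {..<length As}" using 1 2 by simp_all
  have As': "length (map ((!) As) ?js) = sum_list ?ks" "set (map ((!) As) ?js) \<subseteq> Obj C"
    using js in_Obj_nth[OF As js(2)] by (simp_all del: map_append)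
  have r: "rename ?js (wcomp ?ks ?p [u1, u2]) = WBin u u'" "rename ?js (wcomp ?ks ?p [v1, v2]) = WBin v v'"
    using rename_wcomp[OF p us js(1)] rename_wcomp[OF p vs js(1)] 1 2 by simp_all
  have fg: "f \<in> Arr C" "g \<in> Arr C" "Cod C f = wobj M v As" "Cod C g = wobj M v' As"
    using realized_in_hom[OF f As] realized_in_hom[OF g As] by simp_all
  have w: "wobj M v As = wobj M v1 (map ((!) As) ls)" "wobj M v' As = wobj M v2 (map ((!) As) js)"
    using wobj_rename_linear[OF 1(2,3)] wobj_rename_linear[OF 2(2,3)] 1(6) 2(6) by simp_all
  have vo: "wobj M v As \<in> Obj C" "wobj M v' As \<in> Obj C"
    using fg Dom_Cod_obj(2) by metis+
  have T: "cat_functor (power_cat C 2) C (op1 X 2 (planar (Bin Unit Unit)))"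
    using op1_functor[OF planar_level[of "Bin Unit Unit"]] by (simp add: numeral_2_eq_2)
  have fgM: "f \<odot>\<^bsub>M\<^esub> g \<in> Arr C" "Cod C (f \<odot>\<^bsub>M\<^esub> g) = wobj M v As \<otimes>\<^bsub>M\<^esub> wobj M v' As"
    using cat_functor.FA_simps[OF T, of "[f, g]"] fg vo by (simp_all add: tensor_R_obj numeral_2_eq_2)
  have "cell (length ?ks) ?p ?p [wobj M v As, wobj M v' As] = Ide C (wobj M v As \<otimes>\<^bsub>M\<^esub> wobj M v' As)"
    using cell_id[OF p, of "[wobj M v As, wobj M v' As]"] vo by simp
  then have "cell (sum_list ?ks) (wcomp ?ks ?p [u1, u2]) (wcomp ?ks ?p [v1, v2]) (map ((!) As) ?js) = f \<odot>\<^bsub>M\<^esub> g"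
    unfolding op2_comp_cell(1)[OF p p us vs As'] using 1(3) 2(3) fgM
    by (simp add: w 1(7)[symmetric] 2(7)[symmetric])
  then show ?thesis
    using realizedI[OF op2_comp_cell(2)[OF p p us us As'] op2_comp_cell(2)[OF p p vs vs As'] js] r
    by simp
qed

end

section \<open>The axioms of a symmetric monoidal category from 2-cells\<close>

context wk_algebra
begin

lemma R_obj_cells:
  assumes "A \<in> Obj C"
  shows "mlunit M A = cell 1 (WBin WNul (WVar 0)) (WVar 0) [A]" "mrunit M A = cell 1 (WBin (WVar 0) WNul) (WVar 0) [A]"
    and "B \<in> Obj C \<Longrightarrow> mswap M (A, B) = cell 2 (WBin (WVar 0) (WVar (Suc 0))) (WBin (WVar (Suc 0)) (WVar 0)) [A, B]"
    and "B \<in> Obj C \<Longrightarrow> D \<in> Obj C \<Longrightarrow> massoc M (A, B, D) =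
      cell 3 (WBin (WVar 0) (WBin (WVar (Suc 0)) (WVar 2))) (WBin (WBin (WVar 0) (WVar (Suc 0))) (WVar 2)) [A, B, D]"
  using assms by (auto simp: R_obj_def Let_def cell_def ptree_of_planar)

lemma realized_assoc:
  assumes "set As \<subseteq> Obj C" "wvars u \<subseteq> {..<length As}" "wvars v \<subseteq> {..<length As}" "wvars w \<subseteq> {..<length As}"
  shows "realized As (WBin u (WBin v w)) (WBin (WBin u v) w) (massoc M (wobj M u As, wobj M v As, wobj M w As))"
  using realized_cell[of "[u, v, w]" "WBin (WVar 0) (WBin (WVar (Suc 0)) (WVar 2))"
    "WBin (WBin (WVar 0) (WVar (Suc 0))) (WVar 2)", OF _ _ assms(1)] linear_planar(3,4) assms wobj_M_obj[OF assms(1)]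
  by (auto simp: R_obj_cells numeral_3_eq_3)

lemma realized_lunit:
  assumes "set As \<subseteq> Obj C" "wvars u \<subseteq> {..<length As}"
  shows "realized As (WBin WNul u) u (mlunit M (wobj M u As))"
  using realized_cell[of "[u]" "WBin WNul (WVar 0)" "WVar 0", OF _ _ assms(1)] linear_planar(5,7) assms wobj_M_obj[OF assms(1)]
  by (auto simp: R_obj_cells)

lemma realized_runit:
  assumes "set As \<subseteq> Obj C" "wvars u \<subseteq> {..<length As}"
  shows "realized As (WBin u WNul) u (mrunit M (wobj M u As))"
  using realized_cell[of "[u]" "WBin (WVar 0) WNul" "WVar 0", OF _ _ assms(1)] linear_planar(5,8) assms wobj_M_obj[OF assms(1)]
  by (auto simp: R_obj_cells)

lemma realized_swap:
  assumes "set As \<subseteq> Obj C" "wvars u \<subseteq> {..<length As}" "wvars v \<subseteq> {..<length As}"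
  shows "realized As (WBin u v) (WBin v u) (mswap M (wobj M u As, wobj M v As))"
  using realized_cell[of "[u, v]" "WBin (WVar 0) (WVar (Suc 0))" "WBin (WVar (Suc 0)) (WVar 0)", OF _ _ assms(1)] linear_planar(1,2) assms wobj_M_obj[OF assms(1)]
  by (auto simp: R_obj_cells numeral_2_eq_2)

lemma tensor_M_functor: "cat_functor (prod_cat C C) C (tensor M)"
proof -
  interpret T: cat_functor "power_cat C 2" C "op1 X 2 (planar (Bin Unit Unit))"
    using op1_functor[OF planar_level[of "Bin Unit Unit"]] by (simp add: numeral_2_eq_2)
  have O: "A \<otimes>\<^bsub>M\<^esub> B \<in> Obj C" if "A \<in> Obj C" "B \<in> Obj C" for A B
    using T.FO_obj[of "[A, B]"] that by (simp add: tensor_R_obj)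
  have A: "f \<odot>\<^bsub>M\<^esub> g \<in> Arr C" "Dom C (f \<odot>\<^bsub>M\<^esub> g) = Dom C f \<otimes>\<^bsub>M\<^esub> Dom C g"
    "Cod C (f \<odot>\<^bsub>M\<^esub> g) = Cod C f \<otimes>\<^bsub>M\<^esub> Cod C g" if "f \<in> Arr C" "g \<in> Arr C" for f g
    using T.FA_simps[of "[f, g]"] that by (simp_all add: tensor_R_obj)
  have ext: "FO (tensor M) \<in> extensional (Obj C \<times> Obj C)" "FA (tensor M) \<in> extensional (Arr C \<times> Arr C)"
    by (simp_all add: R_obj_def Let_def)
  show ?thesis
  proof (rule cat_functor.intro)
    show "FO (tensor M) \<in> Obj (prod_cat C C) \<rightarrow>\<^sub>E Obj C"
      using ext by (auto simp: O PiE_def)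
    show "FA (tensor M) \<in> Arr (prod_cat C C) \<rightarrow>\<^sub>E Arr C"
      using ext by (auto simp: A PiE_def)
    show "in_hom C (FA (tensor M) f) (FO (tensor M) (Dom (prod_cat C C) f)) (FO (tensor M) (Cod (prod_cat C C) f))"
      if "f \<in> Arr (prod_cat C C)" for f
      using that A by (cases f) (simp add: in_hom_def)
    show "FA (tensor M) (Ide (prod_cat C C) A) = Ide C (FO (tensor M) A)" if obj: "A \<in> Obj (prod_cat C C)" for A
    proof -
      obtain B D where "A = (B, D)" "B \<in> Obj C" "D \<in> Obj C" using obj by (cases A) auto
      then show ?thesis using T.FA_Ide[of "[B, D]"] by (simp add: tensor_R_obj)
    qed
    show "FA (tensor M) (Cmp (prod_cat C C) g f) = Cmp C (FA (tensor M) g) (FA (tensor M) f)"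
      if gf: "composable (prod_cat C C) g f" for g f
    proof -
      obtain f1 f2 g1 g2 where fg: "f = (f1, f2)" "g = (g1, g2)" "f1 \<in> Arr C" "f2 \<in> Arr C" "g1 \<in> Arr C" "g2 \<in> Arr C"
        "Dom C g1 = Cod C f1" "Dom C g2 = Cod C f2"
        using gf by (cases f; cases g) (auto simp: composable_def)
      then show ?thesis
        using T.FA_Cmp'[of "[g1, g2]" "[f1, f2]"] by (simp add: tensor_R_obj composable_def)
    qed
  qed
qed

text \<open>With variables standing for the objects, both sides of each coherence axiom are realized
  with the same target and the same source free of repetitions, so \<open>realized_unique\<close>
  applies. The naturality axioms for \<alpha>, \<lambda>, \<rho> and \<tau> are naturality of the
  images of their 2-cells.\<close>

theorem R_obj_smc: "symmetric_monoidal_category M"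
proof (rule symmetric_monoidal_category.intro, unfold R_obj_simps(1))
  show "category C" by unfold_locales
  show "cat_functor (prod_cat C C) C (tensor M)" by (rule tensor_M_functor)
  show "munit M \<in> Obj C" using wobj_M_obj[of "[]" WNul] by simp
  show "massoc M \<in> extensional (Obj C \<times> Obj C \<times> Obj C)" "mlunit M \<in> extensional (Obj C)"
    "mrunit M \<in> extensional (Obj C)" "mswap M \<in> extensional (Obj C \<times> Obj C)"
    by (simp_all add: R_obj_def Let_def)
next
  fix A assume A: "A \<in> Obj C"
  then have As: "set [A] \<subseteq> Obj C" by simp
  note l = realized_lunit[OF As, of "WVar 0", simplified] and r = realized_runit[OF As, of "WVar 0", simplified]
  show "in_hom C (mlunit M A) (munit M \<otimes>\<^bsub>M\<^esub> A) A" "in_hom C (mrunit M A) (A \<otimes>\<^bsub>M\<^esub> munit M) A"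
    using realized_in_hom[OF l As] realized_in_hom[OF r As] by (simp_all add: in_hom_def)
  show "is_iso C (mlunit M A)" "is_iso C (mrunit M A)"
    using realized_iso[OF l As] realized_iso[OF r As] by simp_all
  have s: "realized [A] (WBin (WVar 0) WNul) (WBin WNul (WVar 0)) (mswap M (A, munit M))"
    using realized_swap[OF As, of "WVar 0" WNul] by simp
  show "Cmp C (mlunit M A) (mswap M (A, munit M)) = mrunit M A"
    using As by (intro realized_unique[OF realized_Cmp[OF s l As] r _ As]) simp
next
  fix A B assume AB: "A \<in> Obj C" "B \<in> Obj C"
  then have As: "set [A, B] \<subseteq> Obj C" by simp
  note s = realized_swap[OF As, of "WVar 0" "WVar 1", simplified]
    and s' = realized_swap[OF As, of "WVar 1" "WVar 0", simplified]
  show "in_hom C (mswap M (A, B)) (A \<otimes>\<^bsub>M\<^esub> B) (B \<otimes>\<^bsub>M\<^esub> A)"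
    using realized_in_hom[OF s As] by (simp add: in_hom_def)
  show "is_iso C (mswap M (A, B))" using realized_iso[OF s As] by simp
  show "Cmp C (mswap M (B, A)) (mswap M (A, B)) = Ide C (A \<otimes>\<^bsub>M\<^esub> B)"
    using realized_unique[OF realized_Cmp[OF s s' As] realized_id[OF As, of "WBin (WVar 0) (WVar (Suc 0))"] _ As] by simp
  have a: "realized [A, B] (WBin (WVar 0) (WBin WNul (WVar 1))) (WBin (WBin (WVar 0) WNul) (WVar 1)) (massoc M (A, munit M, B))"
    using realized_assoc[OF As, of "WVar 0" WNul "WVar 1"] by simp
  have r: "realized [A, B] (WBin (WBin (WVar 0) WNul) (WVar 1)) (WBin (WVar 0) (WVar 1)) (mrunit M A \<odot>\<^bsub>M\<^esub> Ide C B)"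
    using realized_tensor[OF realized_runit[OF As, of "WVar 0"] realized_id[OF As, of "WVar 1"] As] by simp
  have l: "realized [A, B] (WBin (WVar 0) (WBin WNul (WVar 1))) (WBin (WVar 0) (WVar 1)) (Ide C A \<odot>\<^bsub>M\<^esub> mlunit M B)"
    using realized_tensor[OF realized_id[OF As, of "WVar 0"] realized_lunit[OF As, of "WVar 1"] As] by simp
  show "Cmp C (mrunit M A \<odot>\<^bsub>M\<^esub> Ide C B) (massoc M (A, munit M, B)) = Ide C A \<odot>\<^bsub>M\<^esub> mlunit M B"
    by (rule realized_unique[OF realized_Cmp[OF a r As] l _ As]) simp
next
  fix A B D assume "A \<in> Obj C" "B \<in> Obj C" "D \<in> Obj C"
  then have As: "set [A, B, D] \<subseteq> Obj C" by simp
  note a = realized_assoc[OF As, of "WVar 0" "WVar 1" "WVar 2", simplified]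
  show "in_hom C (massoc M (A, B, D)) (A \<otimes>\<^bsub>M\<^esub> (B \<otimes>\<^bsub>M\<^esub> D)) ((A \<otimes>\<^bsub>M\<^esub> B) \<otimes>\<^bsub>M\<^esub> D)"
    using realized_in_hom[OF a As] by (simp add: in_hom_def)
  show "is_iso C (massoc M (A, B, D))" using realized_iso[OF a As] by simp
  have l: "realized [A, B, D] (WBin (WVar 0) (WBin (WVar 1) (WVar 2))) (WBin (WBin (WVar 2) (WVar 0)) (WVar 1))
      (Cmp C (massoc M (D, A, B)) (Cmp C (mswap M (A \<otimes>\<^bsub>M\<^esub> B, D)) (massoc M (A, B, D))))"
    using realized_Cmp[OF realized_Cmp[OF realized_assoc[OF As, of "WVar 0" "WVar 1" "WVar 2"]
        realized_swap[OF As, of "WBin (WVar 0) (WVar 1)" "WVar 2"] As] realized_assoc[OF As, of "WVar 2" "WVar 0" "WVar 1"] As]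
    by simp
  have r: "realized [A, B, D] (WBin (WVar 0) (WBin (WVar 1) (WVar 2))) (WBin (WBin (WVar 2) (WVar 0)) (WVar 1))
      (Cmp C (mswap M (A, D) \<odot>\<^bsub>M\<^esub> Ide C B) (Cmp C (massoc M (A, D, B)) (Ide C A \<odot>\<^bsub>M\<^esub> mswap M (B, D))))"
    using realized_Cmp[OF realized_Cmp[OF realized_tensor[OF realized_id[OF As, of "WVar 0"] realized_swap[OF As, of "WVar 1" "WVar 2"] As]
        realized_assoc[OF As, of "WVar 0" "WVar 2" "WVar 1"] As]
        realized_tensor[OF realized_swap[OF As, of "WVar 0" "WVar 2"] realized_id[OF As, of "WVar 1"] As] As]
    by simp
  show "Cmp C (massoc M (D, A, B)) (Cmp C (mswap M (A \<otimes>\<^bsub>M\<^esub> B, D)) (massoc M (A, B, D))) =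
      Cmp C (mswap M (A, D) \<odot>\<^bsub>M\<^esub> Ide C B) (Cmp C (massoc M (A, D, B)) (Ide C A \<odot>\<^bsub>M\<^esub> mswap M (B, D)))"
    by (rule realized_unique[OF l r _ As]) simp
next
  fix A B D E assume "A \<in> Obj C" "B \<in> Obj C" "D \<in> Obj C" "E \<in> Obj C"
  then have As: "set [A, B, D, E] \<subseteq> Obj C" by simp
  have l: "realized [A, B, D, E] (WBin (WVar 0) (WBin (WVar 1) (WBin (WVar 2) (WVar 3)))) (WBin (WBin (WBin (WVar 0) (WVar 1)) (WVar 2)) (WVar 3))
      (Cmp C (massoc M (A \<otimes>\<^bsub>M\<^esub> B, D, E)) (massoc M (A, B, D \<otimes>\<^bsub>M\<^esub> E)))"
    using realized_Cmp[OF realized_assoc[OF As, of "WVar 0" "WVar 1" "WBin (WVar 2) (WVar 3)"]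
        realized_assoc[OF As, of "WBin (WVar 0) (WVar 1)" "WVar 2" "WVar 3"] As]
    by simp
  have r: "realized [A, B, D, E] (WBin (WVar 0) (WBin (WVar 1) (WBin (WVar 2) (WVar 3)))) (WBin (WBin (WBin (WVar 0) (WVar 1)) (WVar 2)) (WVar 3))
      (Cmp C (massoc M (A, B, D) \<odot>\<^bsub>M\<^esub> Ide C E) (Cmp C (massoc M (A, B \<otimes>\<^bsub>M\<^esub> D, E)) (Ide C A \<odot>\<^bsub>M\<^esub> massoc M (B, D, E))))"
    using realized_Cmp[OF realized_Cmp[OF realized_tensor[OF realized_id[OF As, of "WVar 0"] realized_assoc[OF As, of "WVar 1" "WVar 2" "WVar 3"] As]
        realized_assoc[OF As, of "WVar 0" "WBin (WVar 1) (WVar 2)" "WVar 3"] As]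
        realized_tensor[OF realized_assoc[OF As, of "WVar 0" "WVar 1" "WVar 2"] realized_id[OF As, of "WVar 3"] As] As]
    by simp
  show "Cmp C (massoc M (A \<otimes>\<^bsub>M\<^esub> B, D, E)) (massoc M (A, B, D \<otimes>\<^bsub>M\<^esub> E)) =
      Cmp C (massoc M (A, B, D) \<odot>\<^bsub>M\<^esub> Ide C E) (Cmp C (massoc M (A, B \<otimes>\<^bsub>M\<^esub> D, E)) (Ide C A \<odot>\<^bsub>M\<^esub> massoc M (B, D, E)))"
    by (rule realized_unique[OF l r _ As]) simp
next
  \<comment> \<open>Both maps go from \<open>WBin WNul WNul\<close> to \<open>WNul\<close>, so the
    empty list of objects is enough.\<close>
  have As: "set [] \<subseteq> Obj C" by simp
  show "mlunit M (munit M) = mrunit M (munit M)"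
    using realized_unique[OF realized_lunit[OF As, of WNul] realized_runit[OF As, of WNul] _ As] by simp
next
  fix f assume "f \<in> Arr C"
  then show "Cmp C (mlunit M (Cod C f)) (Ide C (munit M) \<odot>\<^bsub>M\<^esub> f) = Cmp C f (mlunit M (Dom C f))"
    "Cmp C (mrunit M (Cod C f)) (f \<odot>\<^bsub>M\<^esub> Ide C (munit M)) = Cmp C f (mrunit M (Dom C f))"
    using cell_natural[OF linear_planar(7,5), of "[f]"] cell_natural[OF linear_planar(8,5), of "[f]"]
    by (simp_all add: R_obj_cells del: R_obj_simps(2))
next
  fix f g assume "f \<in> Arr C" "g \<in> Arr C"
  then show "Cmp C (mswap M (Cod C f, Cod C g)) (f \<odot>\<^bsub>M\<^esub> g) = Cmp C (g \<odot>\<^bsub>M\<^esub> f) (mswap M (Dom C f, Dom C g))"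
    using cell_natural[OF linear_planar(1,2), of "[f, g]"] by (simp add: R_obj_cells)
next
  fix f g h assume "f \<in> Arr C" "g \<in> Arr C" "h \<in> Arr C"
  then show "Cmp C (massoc M (Cod C f, Cod C g, Cod C h)) (f \<odot>\<^bsub>M\<^esub> (g \<odot>\<^bsub>M\<^esub> h)) =
      Cmp C ((f \<odot>\<^bsub>M\<^esub> g) \<odot>\<^bsub>M\<^esub> h) (massoc M (Dom C f, Dom C g, Dom C h))"
    using cell_natural[OF linear_planar(3,4), of "[f, g, h]"] by (simp add: R_obj_cells)
qed

text \<open>Realized arrows contain the structure maps and are closed under the operations that
  generate canonical maps.\<close>

lemma canonical_realized:
  assumes "canonical M n u v \<eta>" "length As = n" "set As \<subseteq> Obj C"
  shows "realized As u v (\<eta> As)"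
  using assms(1)
proof (induction rule: canonical.induct)
  note [simp] = assms(2,3)
  {
    case (can_id u)
    then show ?case using realized_id[OF assms(3), of u] by simp
  next
    case (can_assoc u v w)
    then show ?case using realized_assoc[OF assms(3), of u v w] by simp
  next
    case (can_lunit u)
    then show ?case using realized_lunit[OF assms(3), of u] by simp
  next
    case (can_runit u)
    then show ?case using realized_runit[OF assms(3), of u] by simp
  next
    case (can_swap u v)
    then show ?case using realized_swap[OF assms(3), of u v] by simp
  next
    case (can_inv u v \<eta>)
    then show ?case using realized_iso(2)[OF can_inv.IH assms(3)] by simp
  next
    case (can_comp u v \<eta> w \<theta>)
    then show ?case using realized_Cmp[OF can_comp.IH assms(3)] by simp
  next
    case (can_tensor u u' \<eta> v v' \<theta>)
    then show ?case using realized_tensor[OF can_tensor.IH assms(3)] by simp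
  }
qed

text \<open>Both components are realized between the same linear words: the image of the 2-cell
  through the trivial renaming \<open>[0..<n]\<close>, the canonical one because every canonical map
  is realized.\<close>

lemma op2_eq_canonical_iso:
  assumes x: "x \<in> level n" and y: "y \<in> level n"
  shows "op2 X n (x, y) = canonical_iso M n x y"
proof -
  interpret R: symmetric_monoidal_category M by (rule R_obj_smc)
  obtain \<eta> where \<eta>: "canonical M n (word_of x) (word_of y) \<eta>"
    "canonical_iso M n x y = \<lparr>NSrc = interp M x, NTgt = interp M y, NCmp = \<eta>\<rparr>"
    using R.canonical_isoE[OF x y] by blast
  note lx = linear_word_of[OF x] and ly = linear_word_of[OF y]
  have "NCmp (op2 X n (x, y)) = \<eta>"
  proof (rule extensionalityI)
    show "NCmp (op2 X n (x, y)) \<in> extensional (Obj (power_cat C n))"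
      using nat_trans.NCmp_type[OF op2_nat_trans(1)[OF x y]] by (auto simp: PiE_def)
    show "\<eta> \<in> extensional (Obj (power_cat C n))"
      using canonical_extensional[OF \<eta>(1)] by simp
    fix As assume "As \<in> Obj (power_cat C n)"
    then have As: "length As = n" "set As \<subseteq> Obj C" by auto
    have "map ((!) As) [0..<n] = As" using As(1) map_nth[of As] by simp
    moreover have "set [0..<n] \<subseteq> {..<length As}" using As(1) by auto
    ultimately have "realized As (word_of x) (word_of y) (NCmp (op2 X n (x, y)) As)"
      using realizedI[OF lx ly, of "[0..<n]" As] x y by (simp add: cell_def rename_upt[OF lx] rename_upt[OF ly])
    then show "NCmp (op2 X n (x, y)) As = \<eta> As"
      using realized_unique[OF _ canonical_realized[OF \<eta>(1) As] _ As(2)] linear_simps(2)[OF lx] by simp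
  qed
  then show ?thesis
    using op2_nat_trans(2,3)[OF x y] op1_eq_interp[OF x] op1_eq_interp[OF y] \<eta>(2) by simp
qed

text \<open>On each level both functors are extensional, so agreement on 1-cells and 2-cells already
  gives equality.\<close>

theorem S_R_obj: "S_obj M = X"
proof -
  have "hat (S_obj M) n = hat X n" for n
  proof -
    interpret F: cat_functor "Lev WkP n" "Lev (End C) n" "hat X n" by (rule hat.levelwise_functor)
    have "FO (hat (S_obj M) n) = FO (hat X n)"
    proof (rule extensionalityI)
      show "FO (hat (S_obj M) n) \<in> extensional (level n)" by (simp add: S_obj_def)
      show "FO (hat X n) \<in> extensional (level n)" using F.FO_type by (auto simp: PiE_def)
    qed (auto simp: S_obj_def op1_def simp flip: op1_eq_interp)
    moreover have "FA (hat (S_obj M) n) = FA (hat X n)"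
    proof (rule extensionalityI)
      show "FA (hat (S_obj M) n) \<in> extensional (level n \<times> level n)" by (simp add: S_obj_def)
      show "FA (hat X n) \<in> extensional (level n \<times> level n)" using F.FA_type by (auto simp: PiE_def)
    qed (auto simp: S_obj_def op2_def simp flip: op2_eq_canonical_iso)
    ultimately show ?thesis by simp
  qed
  then have "hat (S_obj M) = hat X" by (rule ext)
  moreover have "acat (S_obj M) = acat X" by (simp add: S_obj_def)
  ultimately show ?thesis by simp
qed

end

section \<open>Recovering a symmetric monoidal category from its algebra\<close>

context symmetric_monoidal_category
begin

lemma op_S_obj:
  "x \<in> level n \<Longrightarrow> op1 (S_obj M) n x = interp M x"
  "x \<in> level n \<Longrightarrow> y \<in> level n \<Longrightarrow> op2 (S_obj M) n (x, y) = canonical_iso M n x y"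
  using hat_S_obj(2,3) unfolding op1_def op2_def by blast+

lemma NCmp_canonical_iso:
  assumes "linear n u" "linear n v" "canonical M n u v \<eta>"
  shows "NCmp (op2 (S_obj M) n (ptree_of u, ptree_of v)) = \<eta>"
  using canonical_iso_eq(1)[OF ptree_of_level[OF assms(1)] ptree_of_level[OF assms(2)], of \<eta>] assms
    op_S_obj(2)[OF ptree_of_level[OF assms(1)] ptree_of_level[OF assms(2)]] by simp

text \<open>Each structure map of \<open>M\<close> is canonical by one of the generating rules, so
  coherence identifies it with the chosen image of its 2-cell.\<close>

theorem R_S_obj: "R_obj (S_obj M) = M"
proof -
  note [simp] = hat_S_obj(1)
  have t: "op1 (S_obj M) 2 (planar (Bin Unit Unit)) = interpw M 2 (WBin (WVar 0) (WVar (Suc 0)))"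
    using op_S_obj(1)[OF ptree_of_level[OF linear_planar(1)]] interp_eq[OF ptree_of_level[OF linear_planar(1)]]
    unfolding ptree_of_planar(1)[symmetric] by simp
  have "tensor (R_obj (S_obj M)) = tensor M"
  proof -
    have "FO (tensor (R_obj (S_obj M))) = FO (tensor M)"
      using tensor.FO_type unfolding R_obj_def Let_def t
      by (intro extensionalityI[of _ "mobj M \<times> mobj M"]) (auto simp: interpw_def PiE_def)
    moreover have "FA (tensor (R_obj (S_obj M))) = FA (tensor M)"
      using tensor.FA_type unfolding R_obj_def Let_def t
      by (intro extensionalityI[of _ "marr M \<times> marr M"]) (auto simp: interpw_def PiE_def)
    ultimately show ?thesis by simp
  qed
  moreover have "munit (R_obj (S_obj M)) = munit M"
    using op_S_obj(1)[OF ptree_of_level[OF linear_planar(6)]] FO_interp(1)[OF ptree_of_level[OF linear_planar(6)], of "[]"]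
    by (simp add: ptree_of_planar(6)[symmetric])
  moreover have "massoc (R_obj (S_obj M)) = massoc M"
    using NCmp_canonical_iso[OF linear_planar(3,4) can_assoc] m_extensional unfolding ptree_of_planar
    by (intro extensionalityI[of _ "mobj M \<times> mobj M \<times> mobj M"]) (auto simp: R_obj_def Let_def)
  moreover have "mlunit (R_obj (S_obj M)) = mlunit M"
    using NCmp_canonical_iso[OF linear_planar(7,5) can_lunit] m_extensional unfolding ptree_of_planar
    by (intro extensionalityI[of _ "mobj M"]) (auto simp: R_obj_def Let_def)
  moreover have "mrunit (R_obj (S_obj M)) = mrunit M"
    using NCmp_canonical_iso[OF linear_planar(8,5) can_runit] m_extensional unfolding ptree_of_planar
    by (intro extensionalityI[of _ "mobj M"]) (auto simp: R_obj_def Let_def)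
  moreover have "mswap (R_obj (S_obj M)) = mswap M"
    using NCmp_canonical_iso[OF linear_planar(1,2) can_swap] m_extensional unfolding ptree_of_planar
    by (intro extensionalityI[of _ "mobj M \<times> mobj M"]) (auto simp: R_obj_def Let_def)
  ultimately show ?thesis by simp
qed

end

section \<open>The category of symmetric monoidal categories\<close>

lemma func_eqI:
  assumes "cat_functor C D F" "cat_functor C D G"
    and "\<And>A. A \<in> Obj C \<Longrightarrow> FO F A = FO G A" "\<And>f. f \<in> Arr C \<Longrightarrow> FA F f = FA G f"
  shows "F = G"
proof -
  have "FO F = FO G"
    using assms(3) cat_functor.FO_type[OF assms(1)] cat_functor.FO_type[OF assms(2)] by (rule PiE_ext[rotated 2])
  moreover have "FA F = FA G"
    using assms(4) cat_functor.FA_type[OF assms(1)] cat_functor.FA_type[OF assms(2)] by (rule PiE_ext[rotated 2])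
  ultimately show ?thesis by simp
qed

lemma id_functor:
  assumes "category C"
  shows "cat_functor C C (id_func C)"
proof -
  interpret category C by fact
  show ?thesis
    by (rule cat_functor.intro) (auto simp: id_func_def in_hom_def composable_def)
qed

lemma comp_functor:
  assumes "category C" "cat_functor C D F" "cat_functor D E G"
  shows "cat_functor C E (comp_func C G F)"
proof -
  interpret category C by fact
  interpret F: cat_functor C D F by fact
  interpret G: cat_functor D E G by fact
  show ?thesis
    by (rule cat_functor.intro) (auto simp: comp_func_def in_hom_def F.FA_Ide G.FA_Ide composable_def F.FA_Cmp' G.FA_Cmp')
qed

lemma comp_func_simps [simp]:
  "A \<in> Obj C \<Longrightarrow> FO (comp_func C G F) A = FO G (FO F A)"
  "f \<in> Arr C \<Longrightarrow> FA (comp_func C G F) f = FA G (FA F f)"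
  "A \<in> Obj C \<Longrightarrow> FO (id_func C) A = A"
  "f \<in> Arr C \<Longrightarrow> FA (id_func C) f = f"
  by (simp_all add: comp_func_def id_func_def)

section \<open>Comparison maps of a monoidal functor, indexed by words\<close>

fun word_psi :: "('o, 'a) smf \<Rightarrow> word \<Rightarrow> 'o list \<Rightarrow> 'a" where
  "word_psi m (WVar i) As = mide (mtgt m) (smO m (As ! i))"
| "word_psi m WNul As = mF0 m"
| "word_psi m (WBin u v) As =
    mF2 m (wobj (msrc m) u As, wobj (msrc m) v As) \<cdot>\<^bsub>mtgt m\<^esub> (word_psi m u As \<odot>\<^bsub>mtgt m\<^esub> word_psi m v As)"

lemma tree_psi_label:
  "length ls = arity t \<Longrightarrow> tree_psi m t (map ((!) As) ls) = word_psi m (label t ls) As"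
proof (induction t arbitrary: ls)
  case Unit
  then show ?case by (cases ls) auto
next
  case (Bin s t)
  then show ?case by (simp add: take_map drop_map tree_obj_label)
qed auto

sublocale weak_symmetric_monoidal_functor \<subseteq> S: symmetric_monoidal_category M
  by (rule src_smc)

sublocale weak_symmetric_monoidal_functor \<subseteq> T: symmetric_monoidal_category N
  by (rule tgt_smc)

sublocale weak_symmetric_monoidal_functor \<subseteq> F: cat_functor "mcat M" "mcat N" "mfun m"
  by (rule mfun_functor)

context weak_symmetric_monoidal_functor
begin

declare src_tgt [simp]

lemma F0_simps [simp]:
  "mF0 m \<in> marr N" "mdom N (mF0 m) = munit N" "mcod N (mF0 m) = smO m (munit M)"
  using F0_in_hom by (auto simp: in_hom_def)

lemma F2_simps [simp]:
  assumes "A \<in> mobj M" "B \<in> mobj M"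
  shows "mF2 m (A, B) \<in> marr N" "mdom N (mF2 m (A, B)) = smO m A \<otimes>\<^bsub>N\<^esub> smO m B"
    "mcod N (mF2 m (A, B)) = smO m (A \<otimes>\<^bsub>M\<^esub> B)" "is_iso (mcat N) (mF2 m (A, B))"
  using F2_in_hom[OF assms] F2_iso[OF assms] by (auto simp: in_hom_def)

lemma word_psi_simps [simp]:
  assumes "set As \<subseteq> mobj M" "wvars u \<subseteq> {..<length As}"
  shows "word_psi m u As \<in> marr N" "mdom N (word_psi m u As) = wobj N u (map (smO m) As)"
    "mcod N (word_psi m u As) = smO m (wobj M u As)" "is_iso (mcat N) (word_psi m u As)"
proof -
  have "As ! i \<in> mobj M" if "i < length As" for i using assms(1) nth_mem[OF that] by blast
  then show "word_psi m u As \<in> marr N" "mdom N (word_psi m u As) = wobj N u (map (smO m) As)"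
    "mcod N (word_psi m u As) = smO m (wobj M u As)" "is_iso (mcat N) (word_psi m u As)"
    using assms by (induction u) (auto simp: F0_iso)
qed

lemma word_psi_natural:
  assumes "set fs \<subseteq> marr M" "wvars u \<subseteq> {..<length fs}"
  shows "word_psi m u (map (mcod M) fs) \<cdot>\<^bsub>N\<^esub> warr N u (map (smA m) fs) =
    smA m (warr M u fs) \<cdot>\<^bsub>N\<^esub> word_psi m u (map (mdom M) fs)"
  using assms(2)
proof (induction u)
  case (WVar i)
  then have "fs ! i \<in> marr M" "i < length fs" using assms(1) by auto
  then show ?case by simp
next
  case WNul
  then show ?case by (simp add: F.FA_Ide)
next
  case (WBin u v)
  have [simp]: "set fs \<subseteq> marr M" "mcod M ` set fs \<subseteq> mobj M" "mdom M ` set fs \<subseteq> mobj M"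
    "smA m ` set fs \<subseteq> marr N" "wvars u \<subseteq> {..<length fs}" "wvars v \<subseteq> {..<length fs}"
    using assms(1) WBin.prems by auto
  let ?D = "map (mdom M) fs" and ?E = "map (mcod M) fs" and ?F = "map (smA m) fs"
  have [simp]: "map (smO m) ?E = map (mcod N) ?F" "map (smO m) ?D = map (mdom N) ?F"
    using assms(1) by (auto simp: subset_iff)
  let ?F2 = "\<lambda>As. mF2 m (wobj M u As, wobj M v As)"
  have "word_psi m (WBin u v) ?E \<cdot>\<^bsub>N\<^esub> warr N (WBin u v) ?F =
      ?F2 ?E \<cdot>\<^bsub>N\<^esub> ((word_psi m u ?E \<cdot>\<^bsub>N\<^esub> warr N u ?F) \<odot>\<^bsub>N\<^esub> (word_psi m v ?E \<cdot>\<^bsub>N\<^esub> warr N v ?F))"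
    by (simp del: map_map)
  also have "\<dots> = ?F2 ?E \<cdot>\<^bsub>N\<^esub> (smA m (warr M u fs) \<odot>\<^bsub>N\<^esub> smA m (warr M v fs)) \<cdot>\<^bsub>N\<^esub> (word_psi m u ?D \<odot>\<^bsub>N\<^esub> word_psi m v ?D)"
    using WBin.IH by (simp del: map_map)
  also have "\<dots> = smA m (warr M u fs \<odot>\<^bsub>M\<^esub> warr M v fs) \<cdot>\<^bsub>N\<^esub> ?F2 ?D \<cdot>\<^bsub>N\<^esub> (word_psi m u ?D \<odot>\<^bsub>N\<^esub> word_psi m v ?D)"
    using F2_natural[of "warr M u fs" "warr M v fs"] by (intro T.reassoc) (simp_all del: map_map)
  finally show ?case by simp
qed

text \<open>The composition law for \<psi>, by induction on the outer word: at \<open>WBin\<close>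
  the interchange law separates the comparison maps of the inner words from those of the outer
  one.\<close>

lemma word_psi_wsubst:
  assumes "set As \<subseteq> mobj M" "wvars u \<subseteq> {..<length ws}" "\<And>w. w \<in> set ws \<Longrightarrow> wvars w \<subseteq> {..<length As}"
  shows "word_psi m (wsubst ws u) As =
    word_psi m u (map (\<lambda>w. wobj M w As) ws) \<cdot>\<^bsub>N\<^esub> warr N u (map (\<lambda>w. word_psi m w As) ws)"
  using assms(2)
proof (induction u)
  case (WVar i)
  then have "ws ! i \<in> set ws" "i < length ws" by auto
  then show ?case using assms(1,3) by simp
next
  case WNul
  then show ?case by simp
next
  case (WBin u v)
  let ?As = "map (\<lambda>w. wobj M w As) ws" and ?\<psi>s = "map (\<lambda>w. word_psi m w As) ws"
  have uv: "wvars u \<subseteq> {..<length ws}" "wvars v \<subseteq> {..<length ws}" using WBin.prems by auto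
  have s: "set ?As \<subseteq> mobj M" "set ?\<psi>s \<subseteq> marr N" using assms by auto
  have c: "map (mcod N) ?\<psi>s = map (smO m) ?As" using assms by auto
  have w: "wobj M (wsubst ws u') As = wobj M u' ?As" if "wvars u' \<subseteq> {..<length ws}" for u'
    using that by (simp add: wobj_wsubst wvars_leaves)
  have "warr N u' ?\<psi>s \<in> marr N" "mcod N (warr N u' ?\<psi>s) = wobj N u' (map (smO m) ?As)"
    if "wvars u' \<subseteq> {..<length ws}" for u'
    using T.warr_simps(1,3)[OF s(2), of u'] that unfolding c by simp_all
  then show ?case
    using WBin.IH uv s(1) by (simp add: w del: map_map)
qed

text \<open>Naturality in 2-cells, by following a derivation. The matching \<theta> is built along
  the same derivation in \<open>N\<close> and left existential; coherence in \<open>N\<close>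
  identifies it with the canonical isomorphism afterwards.\<close>

lemma word_psi_canonical:
  assumes "canonical M n u v \<eta>"
  shows "\<exists>\<theta>. canonical N n u v \<theta> \<and> (\<forall>As. length As = n \<longrightarrow> set As \<subseteq> mobj M \<longrightarrow>
    word_psi m v As \<cdot>\<^bsub>N\<^esub> \<theta> (map (smO m) As) = smA m (\<eta> As) \<cdot>\<^bsub>N\<^esub> word_psi m u As)"
  using assms
proof (induction rule: canonical.induct)
  have [simp]: "smO m ` set As \<subseteq> mobj N" if "set As \<subseteq> mobj M" for As
    using that by auto
  {
    case (can_id u)
    then show ?case
      by (intro exI[of _ "\<lambda>As\<in>Obj (power_cat (mcat N) n). mide N (wobj N u As)"] conjI canonical.can_id)
        (auto simp: F.FA_Ide)
  next
    case (can_assoc u v w)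
    then have uvw: "wvars u \<subseteq> {..<n}" "wvars v \<subseteq> {..<n}" "wvars w \<subseteq> {..<n}" by auto
    have "word_psi m (WBin (WBin u v) w) As \<cdot>\<^bsub>N\<^esub> massoc N (wobj N u (map (smO m) As), wobj N v (map (smO m) As), wobj N w (map (smO m) As))
      = smA m (massoc M (wobj M u As, wobj M v As, wobj M w As)) \<cdot>\<^bsub>N\<^esub> word_psi m (WBin u (WBin v w)) As"
      if As: "length As = n" "set As \<subseteq> mobj M" for As
    proof -
      note [simp] = As uvw
      let ?U = "wobj M u As" and ?V = "wobj M v As" and ?W = "wobj M w As"
      let ?u = "word_psi m u As" and ?v = "word_psi m v As" and ?w = "word_psi m w As"
      let ?A = "massoc N (smO m ?U, smO m ?V, smO m ?W)"
      \<comment> \<open>The comparison maps of \<open>u\<close>, \<open>v\<close> and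
        \<open>w\<close> are split off on the right, so that the left-hand side of
        \<open>F_assoc\<close> appears; naturality of the associator of \<open>N\<close> then moves
        them back.\<close>
      have "smA m (massoc M (?U, ?V, ?W)) \<cdot>\<^bsub>N\<^esub> word_psi m (WBin u (WBin v w)) As =
        (smA m (massoc M (?U, ?V, ?W)) \<cdot>\<^bsub>N\<^esub> mF2 m (?U, ?V \<otimes>\<^bsub>M\<^esub> ?W) \<cdot>\<^bsub>N\<^esub> (mide N (smO m ?U) \<odot>\<^bsub>N\<^esub> mF2 m (?V, ?W))) \<cdot>\<^bsub>N\<^esub> (?u \<odot>\<^bsub>N\<^esub> (?v \<odot>\<^bsub>N\<^esub> ?w))"
        by simp
      also have "\<dots> = mF2 m (?U \<otimes>\<^bsub>M\<^esub> ?V, ?W) \<cdot>\<^bsub>N\<^esub> (mF2 m (?U, ?V) \<odot>\<^bsub>N\<^esub> mide N (smO m ?W)) \<cdot>\<^bsub>N\<^esub> ?A \<cdot>\<^bsub>N\<^esub> (?u \<odot>\<^bsub>N\<^esub> (?v \<odot>\<^bsub>N\<^esub> ?w))"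
        by (subst F_assoc) simp_all
      also have "\<dots> = mF2 m (?U \<otimes>\<^bsub>M\<^esub> ?V, ?W) \<cdot>\<^bsub>N\<^esub> (mF2 m (?U, ?V) \<odot>\<^bsub>N\<^esub> mide N (smO m ?W)) \<cdot>\<^bsub>N\<^esub> ((?u \<odot>\<^bsub>N\<^esub> ?v) \<odot>\<^bsub>N\<^esub> ?w) \<cdot>\<^bsub>N\<^esub>
          massoc N (wobj N u (map (smO m) As), wobj N v (map (smO m) As), wobj N w (map (smO m) As))"
        using T.assoc_natural[of ?u ?v ?w] by simp
      finally show ?thesis by simp
    qed
    then show ?case using can_assoc
      by (intro exI[of _ "\<lambda>As\<in>Obj (power_cat (mcat N) n). massoc N (wobj N u As, wobj N v As, wobj N w As)"] conjI canonical.can_assoc) auto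
  next
    case (can_lunit u)
    have "word_psi m u As \<cdot>\<^bsub>N\<^esub> mlunit N (wobj N u (map (smO m) As)) = smA m (mlunit M (wobj M u As)) \<cdot>\<^bsub>N\<^esub> word_psi m (WBin WNul u) As"
      if As: "length As = n" "set As \<subseteq> mobj M" for As
    proof -
      note [simp] = As can_lunit
      have "smA m (mlunit M (wobj M u As)) \<cdot>\<^bsub>N\<^esub> word_psi m (WBin WNul u) As =
        (smA m (mlunit M (wobj M u As)) \<cdot>\<^bsub>N\<^esub> mF2 m (munit M, wobj M u As) \<cdot>\<^bsub>N\<^esub> (mF0 m \<odot>\<^bsub>N\<^esub> mide N (smO m (wobj M u As)))) \<cdot>\<^bsub>N\<^esub>
        (mide N (munit N) \<odot>\<^bsub>N\<^esub> word_psi m u As)" by simp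
      also have "\<dots> = mlunit N (smO m (wobj M u As)) \<cdot>\<^bsub>N\<^esub> (mide N (munit N) \<odot>\<^bsub>N\<^esub> word_psi m u As)"
        by (subst F_lunit) simp_all
      finally show ?thesis using T.lunit_natural[of "word_psi m u As"] by simp
    qed
    then show ?case using can_lunit
      by (intro exI[of _ "\<lambda>As\<in>Obj (power_cat (mcat N) n). mlunit N (wobj N u As)"] conjI canonical.can_lunit) auto
  next
    case (can_runit u)
    have "word_psi m u As \<cdot>\<^bsub>N\<^esub> mrunit N (wobj N u (map (smO m) As)) = smA m (mrunit M (wobj M u As)) \<cdot>\<^bsub>N\<^esub> word_psi m (WBin u WNul) As"
      if As: "length As = n" "set As \<subseteq> mobj M" for As
    proof -
      note [simp] = As can_runit
      have "smA m (mrunit M (wobj M u As)) \<cdot>\<^bsub>N\<^esub> word_psi m (WBin u WNul) As =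
        (smA m (mrunit M (wobj M u As)) \<cdot>\<^bsub>N\<^esub> mF2 m (wobj M u As, munit M) \<cdot>\<^bsub>N\<^esub> (mide N (smO m (wobj M u As)) \<odot>\<^bsub>N\<^esub> mF0 m)) \<cdot>\<^bsub>N\<^esub>
        (word_psi m u As \<odot>\<^bsub>N\<^esub> mide N (munit N))" by simp
      also have "\<dots> = mrunit N (smO m (wobj M u As)) \<cdot>\<^bsub>N\<^esub> (word_psi m u As \<odot>\<^bsub>N\<^esub> mide N (munit N))"
        by (subst F_runit) simp_all
      finally show ?thesis using T.runit_natural[of "word_psi m u As"] by simp
    qed
    then show ?case using can_runit
      by (intro exI[of _ "\<lambda>As\<in>Obj (power_cat (mcat N) n). mrunit N (wobj N u As)"] conjI canonical.can_runit) auto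
  next
    case (can_swap u v)
    then have uv: "wvars u \<subseteq> {..<n}" "wvars v \<subseteq> {..<n}" by auto
    have "word_psi m (WBin v u) As \<cdot>\<^bsub>N\<^esub> mswap N (wobj N u (map (smO m) As), wobj N v (map (smO m) As)) =
        smA m (mswap M (wobj M u As, wobj M v As)) \<cdot>\<^bsub>N\<^esub> word_psi m (WBin u v) As"
      if As: "length As = n" "set As \<subseteq> mobj M" for As
    proof -
      note [simp] = As uv
      let ?U = "wobj M u As" and ?V = "wobj M v As" and ?uv = "word_psi m u As \<odot>\<^bsub>N\<^esub> word_psi m v As"
      have "smA m (mswap M (?U, ?V)) \<cdot>\<^bsub>N\<^esub> word_psi m (WBin u v) As = mF2 m (?V, ?U) \<cdot>\<^bsub>N\<^esub> mswap N (smO m ?U, smO m ?V) \<cdot>\<^bsub>N\<^esub> ?uv"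
        using T.reassoc[OF F_swap[of ?U ?V], of ?uv] by simp
      then show ?thesis using T.swap_natural[of "word_psi m u As" "word_psi m v As"] by simp
    qed
    then show ?case using can_swap
      by (intro exI[of _ "\<lambda>As\<in>Obj (power_cat (mcat N) n). mswap N (wobj N u As, wobj N v As)"] conjI canonical.can_swap) auto
  next
    case (can_inv u v \<eta>)
    then obtain \<theta> where \<theta>: "canonical N n u v \<theta>" "\<And>As. length As = n \<Longrightarrow> set As \<subseteq> mobj M \<Longrightarrow>
      word_psi m v As \<cdot>\<^bsub>N\<^esub> \<theta> (map (smO m) As) = smA m (\<eta> As) \<cdot>\<^bsub>N\<^esub> word_psi m u As" by blast
    have "word_psi m u As \<cdot>\<^bsub>N\<^esub> inv_arr (mcat N) (\<theta> (map (smO m) As)) = smA m (inv_arr (mcat M) (\<eta> As)) \<cdot>\<^bsub>N\<^esub> word_psi m v As"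
      if As: "length As = n" "set As \<subseteq> mobj M" for As
    proof -
      let ?\<theta> = "\<theta> (map (smO m) As)"
      note [simp] = As canonical_wvars[OF \<theta>(1), THEN conjunct1] canonical_wvars[OF \<theta>(1), THEN conjunct2]
        S.canonical_in_hom[OF can_inv.hyps As] T.canonical_in_hom[OF \<theta>(1), of "map (smO m) As", simplified]
      have [simp]: "is_iso (mcat N) ?\<theta>" "?\<theta> \<in> marr N" "mdom N ?\<theta> = wobj N u (map (smO m) As)" "mcod N ?\<theta> = wobj N v (map (smO m) As)"
        using T.canonical_in_hom[OF \<theta>(1), of "map (smO m) As"] by simp_all
      have f: "is_iso (mcat N) (smA m (\<eta> As))" "smA m (inv_arr (mcat M) (\<eta> As)) = inv_arr (mcat N) (smA m (\<eta> As))"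
        using functor_iso[OF mfun_functor S.mcat_category T.mcat_category, of "\<eta> As"] by simp_all
      show ?thesis
      proof (rule T.iso_cancel_right[of ?\<theta>])
        have "(smA m (inv_arr (mcat M) (\<eta> As)) \<cdot>\<^bsub>N\<^esub> word_psi m v As) \<cdot>\<^bsub>N\<^esub> ?\<theta> =
          inv_arr (mcat N) (smA m (\<eta> As)) \<cdot>\<^bsub>N\<^esub> smA m (\<eta> As) \<cdot>\<^bsub>N\<^esub> word_psi m u As"
          using f \<theta>(2)[OF As] by (simp del: T.inv_cancel)
        also have "\<dots> = word_psi m u As" using f by simp
        finally show "(word_psi m u As \<cdot>\<^bsub>N\<^esub> inv_arr (mcat N) ?\<theta>) \<cdot>\<^bsub>N\<^esub> ?\<theta> =
          (smA m (inv_arr (mcat M) (\<eta> As)) \<cdot>\<^bsub>N\<^esub> word_psi m v As) \<cdot>\<^bsub>N\<^esub> ?\<theta>" by simp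
      qed simp_all
    qed
    then show ?case using canonical.can_inv[OF \<theta>(1)] by (intro exI conjI) auto
  next
    case (can_comp u v \<eta> w \<eta>')
    from can_comp.IH(1) obtain \<theta> where \<theta>: "canonical N n u v \<theta>" "\<And>As. length As = n \<Longrightarrow> set As \<subseteq> mobj M \<Longrightarrow>
      word_psi m v As \<cdot>\<^bsub>N\<^esub> \<theta> (map (smO m) As) = smA m (\<eta> As) \<cdot>\<^bsub>N\<^esub> word_psi m u As" by blast
    from can_comp.IH(2) obtain \<theta>' where \<theta>': "canonical N n v w \<theta>'" "\<And>As. length As = n \<Longrightarrow> set As \<subseteq> mobj M \<Longrightarrow>
      word_psi m w As \<cdot>\<^bsub>N\<^esub> \<theta>' (map (smO m) As) = smA m (\<eta>' As) \<cdot>\<^bsub>N\<^esub> word_psi m v As" by blast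
    have "word_psi m w As \<cdot>\<^bsub>N\<^esub> \<theta>' (map (smO m) As) \<cdot>\<^bsub>N\<^esub> \<theta> (map (smO m) As) = smA m (\<eta>' As \<cdot>\<^bsub>M\<^esub> \<eta> As) \<cdot>\<^bsub>N\<^esub> word_psi m u As"
      if As: "length As = n" "set As \<subseteq> mobj M" for As
    proof -
      note [simp] = As canonical_wvars[OF \<theta>(1), THEN conjunct1] canonical_wvars[OF \<theta>(1), THEN conjunct2]
        canonical_wvars[OF \<theta>'(1), THEN conjunct2]
        S.canonical_in_hom[OF can_comp.hyps(1) As] S.canonical_in_hom[OF can_comp.hyps(2) As]
      have [simp]: "\<theta> (map (smO m) As) \<in> marr N" "mdom N (\<theta> (map (smO m) As)) = wobj N u (map (smO m) As)"
          "mcod N (\<theta> (map (smO m) As)) = wobj N v (map (smO m) As)"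
        "\<theta>' (map (smO m) As) \<in> marr N" "mdom N (\<theta>' (map (smO m) As)) = wobj N v (map (smO m) As)"
          "mcod N (\<theta>' (map (smO m) As)) = wobj N w (map (smO m) As)"
        using T.canonical_in_hom[OF \<theta>(1), of "map (smO m) As"] T.canonical_in_hom[OF \<theta>'(1), of "map (smO m) As"] by simp_all
      have "word_psi m w As \<cdot>\<^bsub>N\<^esub> \<theta>' (map (smO m) As) \<cdot>\<^bsub>N\<^esub> \<theta> (map (smO m) As) =
        smA m (\<eta>' As) \<cdot>\<^bsub>N\<^esub> word_psi m v As \<cdot>\<^bsub>N\<^esub> \<theta> (map (smO m) As)"
        by (rule T.reassoc[OF \<theta>'(2)[OF As]]) simp_all
      then show ?thesis using \<theta>(2)[OF As] by (simp add: F.FA_Cmp')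
    qed
    then show ?case using canonical.can_comp[OF \<theta>(1) \<theta>'(1)] by (intro exI conjI) auto
  next
    case (can_tensor u u' \<eta> v v' \<eta>')
    from can_tensor.IH(1) obtain \<theta> where \<theta>: "canonical N n u u' \<theta>" "\<And>As. length As = n \<Longrightarrow> set As \<subseteq> mobj M \<Longrightarrow>
      word_psi m u' As \<cdot>\<^bsub>N\<^esub> \<theta> (map (smO m) As) = smA m (\<eta> As) \<cdot>\<^bsub>N\<^esub> word_psi m u As" by blast
    from can_tensor.IH(2) obtain \<theta>' where \<theta>': "canonical N n v v' \<theta>'" "\<And>As. length As = n \<Longrightarrow> set As \<subseteq> mobj M \<Longrightarrow>
      word_psi m v' As \<cdot>\<^bsub>N\<^esub> \<theta>' (map (smO m) As) = smA m (\<eta>' As) \<cdot>\<^bsub>N\<^esub> word_psi m v As" by blast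
    have "word_psi m (WBin u' v') As \<cdot>\<^bsub>N\<^esub> (\<theta> (map (smO m) As) \<odot>\<^bsub>N\<^esub> \<theta>' (map (smO m) As)) =
        smA m (\<eta> As \<odot>\<^bsub>M\<^esub> \<eta>' As) \<cdot>\<^bsub>N\<^esub> word_psi m (WBin u v) As"
      if As: "length As = n" "set As \<subseteq> mobj M" for As
    proof -
      note [simp] = As canonical_wvars[OF \<theta>(1), THEN conjunct1] canonical_wvars[OF \<theta>(1), THEN conjunct2]
        canonical_wvars[OF \<theta>'(1), THEN conjunct1] canonical_wvars[OF \<theta>'(1), THEN conjunct2]
        S.canonical_in_hom[OF can_tensor.hyps(1) As] S.canonical_in_hom[OF can_tensor.hyps(2) As]
      have [simp]: "\<theta> (map (smO m) As) \<in> marr N" "mdom N (\<theta> (map (smO m) As)) = wobj N u (map (smO m) As)"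
          "mcod N (\<theta> (map (smO m) As)) = wobj N u' (map (smO m) As)"
        "\<theta>' (map (smO m) As) \<in> marr N" "mdom N (\<theta>' (map (smO m) As)) = wobj N v (map (smO m) As)"
          "mcod N (\<theta>' (map (smO m) As)) = wobj N v' (map (smO m) As)"
        using T.canonical_in_hom[OF \<theta>(1), of "map (smO m) As"] T.canonical_in_hom[OF \<theta>'(1), of "map (smO m) As"] by simp_all
      let ?\<psi> = "word_psi m u As \<odot>\<^bsub>N\<^esub> word_psi m v As"
      have "word_psi m (WBin u' v') As \<cdot>\<^bsub>N\<^esub> (\<theta> (map (smO m) As) \<odot>\<^bsub>N\<^esub> \<theta>' (map (smO m) As)) =
        mF2 m (wobj M u' As, wobj M v' As) \<cdot>\<^bsub>N\<^esub> (smA m (\<eta> As) \<odot>\<^bsub>N\<^esub> smA m (\<eta>' As)) \<cdot>\<^bsub>N\<^esub> ?\<psi>"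
        using \<theta>(2)[OF As] \<theta>'(2)[OF As] by simp
      also have "\<dots> = smA m (\<eta> As \<odot>\<^bsub>M\<^esub> \<eta>' As) \<cdot>\<^bsub>N\<^esub> mF2 m (wobj M u As, wobj M v As) \<cdot>\<^bsub>N\<^esub> ?\<psi>"
        using F2_natural[of "\<eta> As" "\<eta>' As"] by (intro T.reassoc) simp_all
      finally show ?thesis by simp
    qed
    then show ?case using canonical.can_tensor[OF \<theta>(1) \<theta>'(1)] by (intro exI conjI) auto
  }
qed

end

section \<open>Identities and composites of monoidal functors\<close>

lemma smf_simps [simp]:
  "msrc (id_smf M) = M" "mtgt (id_smf M) = M" "mfun (id_smf M) = id_func (mcat M)" "mF0 (id_smf M) = mide M (munit M)"
  "A \<in> mobj M \<Longrightarrow> B \<in> mobj M \<Longrightarrow> mF2 (id_smf M) (A, B) = mide M (A \<otimes>\<^bsub>M\<^esub> B)"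
  "msrc (comp_smf m' m) = msrc m" "mtgt (comp_smf m' m) = mtgt m'"
  "mfun (comp_smf m' m) = comp_func (mcat (msrc m)) (mfun m') (mfun m)"
  "mF0 (comp_smf m' m) = smA m' (mF0 m) \<cdot>\<^bsub>mtgt m'\<^esub> mF0 m'"
  "A \<in> mobj (msrc m) \<Longrightarrow> B \<in> mobj (msrc m) \<Longrightarrow>
    mF2 (comp_smf m' m) (A, B) = smA m' (mF2 m (A, B)) \<cdot>\<^bsub>mtgt m'\<^esub> mF2 m' (smO m A, smO m B)"
  by (simp_all add: id_smf_def comp_smf_def Let_def)

lemma id_smf_functor:
  assumes "symmetric_monoidal_category M"
  shows "weak_symmetric_monoidal_functor (id_smf M) M M"
proof -
  interpret symmetric_monoidal_category M by fact
  show ?thesis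
  proof (rule weak_symmetric_monoidal_functor.intro)
    show "cat_functor (mcat M) (mcat M) (mfun (id_smf M))"
      using id_functor[OF mcat_category] by simp
    show "mF2 (id_smf M) \<in> extensional (mobj M \<times> mobj M)"
      by (simp add: id_smf_def)
  qed (simp_all add: assms in_hom_def)
qed

text \<open>Each compatibility axiom is the image under \<open>m'\<close> of the axiom for
  \<open>m\<close> pasted to the axiom for \<open>m'\<close>. For associativity and units a
  comparison map of \<open>m'\<close> has to pass the image of one of \<open>m\<close> in between,
  which is naturality of \<open>mF2 m'\<close>.\<close>

lemma comp_smf_functor:
  assumes m: "weak_symmetric_monoidal_functor m M N" and m': "weak_symmetric_monoidal_functor m' N P"
  shows "weak_symmetric_monoidal_functor (comp_smf m' m) M P"
proof -
  interpret f: weak_symmetric_monoidal_functor m M N by fact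
  interpret g: weak_symmetric_monoidal_functor m' N P by fact
  let ?c = "comp_smf m' m"
  have iso [simp]: "is_iso (mcat P) (smA m' k)" if "is_iso (mcat N) k" for k
    using functor_iso(1)[OF g.mfun_functor f.T.mcat_category g.T.mcat_category that] .
  show ?thesis
  proof (rule weak_symmetric_monoidal_functor.intro)
    show "symmetric_monoidal_category M" "symmetric_monoidal_category P"
      using f.src_smc g.tgt_smc by auto
    show "msrc ?c = M" "mtgt ?c = P" by simp_all
    show "cat_functor (mcat M) (mcat P) (mfun ?c)"
      using comp_functor[OF f.S.mcat_category f.mfun_functor g.mfun_functor] by simp
    show "mF2 ?c \<in> extensional (mobj M \<times> mobj M)"
      by (simp add: comp_smf_def Let_def)
    show "in_hom (mcat P) (mF0 ?c) (munit P) (smO ?c (munit M))" "is_iso (mcat P) (mF0 ?c)"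
      by (simp_all add: in_hom_def f.F0_iso g.F0_iso)
  next
    fix X Y assume [simp]: "X \<in> mobj M" "Y \<in> mobj M"
    show "in_hom (mcat P) (mF2 ?c (X, Y)) (smO ?c X \<otimes>\<^bsub>P\<^esub> smO ?c Y) (smO ?c (X \<otimes>\<^bsub>M\<^esub> Y))"
      "is_iso (mcat P) (mF2 ?c (X, Y))"
      by (simp_all add: in_hom_def)
    have "smA m' (smA m (mswap M (X, Y))) \<cdot>\<^bsub>P\<^esub> smA m' (mF2 m (X, Y)) \<cdot>\<^bsub>P\<^esub> mF2 m' (smO m X, smO m Y) =
      smA m' (smA m (mswap M (X, Y)) \<cdot>\<^bsub>N\<^esub> mF2 m (X, Y)) \<cdot>\<^bsub>P\<^esub> mF2 m' (smO m X, smO m Y)"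
      by (simp add: g.F.FA_Cmp')
    also have "\<dots> = smA m' (mF2 m (Y, X)) \<cdot>\<^bsub>P\<^esub> smA m' (mswap N (smO m X, smO m Y)) \<cdot>\<^bsub>P\<^esub> mF2 m' (smO m X, smO m Y)"
      by (simp add: f.F_swap g.F.FA_Cmp')
    also have "\<dots> = smA m' (mF2 m (Y, X)) \<cdot>\<^bsub>P\<^esub> mF2 m' (smO m Y, smO m X) \<cdot>\<^bsub>P\<^esub> mswap P (smO m' (smO m X), smO m' (smO m Y))"
      by (simp add: g.F_swap)
    finally show "smA ?c (mswap M (X, Y)) \<cdot>\<^bsub>P\<^esub> mF2 ?c (X, Y) = mF2 ?c (Y, X) \<cdot>\<^bsub>P\<^esub> mswap P (smO ?c X, smO ?c Y)"
      by simp
  next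
    fix h k assume [simp]: "h \<in> marr M" "k \<in> marr M"
    let ?G2 = "mF2 m' (smO m (mdom M h), smO m (mdom M k))"
    have "smA m' (mF2 m (mcod M h, mcod M k)) \<cdot>\<^bsub>P\<^esub> mF2 m' (smO m (mcod M h), smO m (mcod M k)) \<cdot>\<^bsub>P\<^esub> (smA m' (smA m h) \<odot>\<^bsub>P\<^esub> smA m' (smA m k)) =
      smA m' (mF2 m (mcod M h, mcod M k)) \<cdot>\<^bsub>P\<^esub> smA m' (smA m h \<odot>\<^bsub>N\<^esub> smA m k) \<cdot>\<^bsub>P\<^esub> ?G2"
      using g.F2_natural[of "smA m h" "smA m k"] by simp
    also have "\<dots> = smA m' (mF2 m (mcod M h, mcod M k) \<cdot>\<^bsub>N\<^esub> (smA m h \<odot>\<^bsub>N\<^esub> smA m k)) \<cdot>\<^bsub>P\<^esub> ?G2"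
      by (simp add: g.F.FA_Cmp')
    also have "\<dots> = smA m' (smA m (h \<odot>\<^bsub>M\<^esub> k)) \<cdot>\<^bsub>P\<^esub> smA m' (mF2 m (mdom M h, mdom M k)) \<cdot>\<^bsub>P\<^esub> ?G2"
      by (simp add: f.F2_natural g.F.FA_Cmp')
    finally show "mF2 ?c (mcod M h, mcod M k) \<cdot>\<^bsub>P\<^esub> (smA ?c h \<odot>\<^bsub>P\<^esub> smA ?c k) = smA ?c (h \<odot>\<^bsub>M\<^esub> k) \<cdot>\<^bsub>P\<^esub> mF2 ?c (mdom M h, mdom M k)"
      by simp
  next
    fix X Y Z assume [simp]: "X \<in> mobj M" "Y \<in> mobj M" "Z \<in> mobj M"
    let ?X = "smO m X" and ?Y = "smO m Y" and ?Z = "smO m Z"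
    let ?l = "mide P (smO m' ?X) \<odot>\<^bsub>P\<^esub> mF2 m' (?Y, ?Z)" and ?r = "mF2 m' (?X, ?Y) \<odot>\<^bsub>P\<^esub> mide P (smO m' ?Z)"
    have 1: "mF2 m' (?X, smO m (Y \<otimes>\<^bsub>M\<^esub> Z)) \<cdot>\<^bsub>P\<^esub> (mide P (smO m' ?X) \<odot>\<^bsub>P\<^esub> smA m' (mF2 m (Y, Z))) =
        smA m' (mide N ?X \<odot>\<^bsub>N\<^esub> mF2 m (Y, Z)) \<cdot>\<^bsub>P\<^esub> mF2 m' (?X, ?Y \<otimes>\<^bsub>N\<^esub> ?Z)"
      using g.F2_natural[of "mide N ?X" "mF2 m (Y, Z)"] by (simp add: g.F.FA_Ide)
    have 2: "mF2 m' (smO m (X \<otimes>\<^bsub>M\<^esub> Y), ?Z) \<cdot>\<^bsub>P\<^esub> (smA m' (mF2 m (X, Y)) \<odot>\<^bsub>P\<^esub> mide P (smO m' ?Z)) =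
        smA m' (mF2 m (X, Y) \<odot>\<^bsub>N\<^esub> mide N ?Z) \<cdot>\<^bsub>P\<^esub> mF2 m' (?X \<otimes>\<^bsub>N\<^esub> ?Y, ?Z)"
      using g.F2_natural[of "mF2 m (X, Y)" "mide N ?Z"] by (simp add: g.F.FA_Ide)
    have "smA ?c (massoc M (X, Y, Z)) \<cdot>\<^bsub>P\<^esub> mF2 ?c (X, Y \<otimes>\<^bsub>M\<^esub> Z) \<cdot>\<^bsub>P\<^esub> (mide P (smO ?c X) \<odot>\<^bsub>P\<^esub> mF2 ?c (Y, Z)) =
      smA m' (smA m (massoc M (X, Y, Z))) \<cdot>\<^bsub>P\<^esub> smA m' (mF2 m (X, Y \<otimes>\<^bsub>M\<^esub> Z)) \<cdot>\<^bsub>P\<^esub>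
        mF2 m' (?X, smO m (Y \<otimes>\<^bsub>M\<^esub> Z)) \<cdot>\<^bsub>P\<^esub> (mide P (smO m' ?X) \<odot>\<^bsub>P\<^esub> smA m' (mF2 m (Y, Z))) \<cdot>\<^bsub>P\<^esub> ?l"
      by simp
    also have "\<dots> = smA m' (smA m (massoc M (X, Y, Z))) \<cdot>\<^bsub>P\<^esub> smA m' (mF2 m (X, Y \<otimes>\<^bsub>M\<^esub> Z)) \<cdot>\<^bsub>P\<^esub>
        smA m' (mide N ?X \<odot>\<^bsub>N\<^esub> mF2 m (Y, Z)) \<cdot>\<^bsub>P\<^esub> mF2 m' (?X, ?Y \<otimes>\<^bsub>N\<^esub> ?Z) \<cdot>\<^bsub>P\<^esub> ?l"
      using g.T.reassoc[OF 1, of ?l] by (simp del: g.T.interchange g.T.interchange_reassoc)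
    also have "\<dots> = smA m' (smA m (massoc M (X, Y, Z)) \<cdot>\<^bsub>N\<^esub> mF2 m (X, Y \<otimes>\<^bsub>M\<^esub> Z) \<cdot>\<^bsub>N\<^esub> (mide N ?X \<odot>\<^bsub>N\<^esub> mF2 m (Y, Z))) \<cdot>\<^bsub>P\<^esub>
        mF2 m' (?X, ?Y \<otimes>\<^bsub>N\<^esub> ?Z) \<cdot>\<^bsub>P\<^esub> ?l"
      by (simp add: g.F.FA_Cmp')
    also have "\<dots> = smA m' (mF2 m (X \<otimes>\<^bsub>M\<^esub> Y, Z)) \<cdot>\<^bsub>P\<^esub> smA m' (mF2 m (X, Y) \<odot>\<^bsub>N\<^esub> mide N ?Z) \<cdot>\<^bsub>P\<^esub>
        (smA m' (massoc N (?X, ?Y, ?Z)) \<cdot>\<^bsub>P\<^esub> mF2 m' (?X, ?Y \<otimes>\<^bsub>N\<^esub> ?Z) \<cdot>\<^bsub>P\<^esub> ?l)"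
      by (subst f.F_assoc) (simp_all add: g.F.FA_Cmp')
    also have "\<dots> = smA m' (mF2 m (X \<otimes>\<^bsub>M\<^esub> Y, Z)) \<cdot>\<^bsub>P\<^esub> smA m' (mF2 m (X, Y) \<odot>\<^bsub>N\<^esub> mide N ?Z) \<cdot>\<^bsub>P\<^esub>
        mF2 m' (?X \<otimes>\<^bsub>N\<^esub> ?Y, ?Z) \<cdot>\<^bsub>P\<^esub> ?r \<cdot>\<^bsub>P\<^esub> massoc P (smO m' ?X, smO m' ?Y, smO m' ?Z)"
      by (subst g.F_assoc) simp_all
    also have "\<dots> = smA m' (mF2 m (X \<otimes>\<^bsub>M\<^esub> Y, Z)) \<cdot>\<^bsub>P\<^esub> mF2 m' (smO m (X \<otimes>\<^bsub>M\<^esub> Y), ?Z) \<cdot>\<^bsub>P\<^esub>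
        (smA m' (mF2 m (X, Y)) \<odot>\<^bsub>P\<^esub> mide P (smO m' ?Z)) \<cdot>\<^bsub>P\<^esub> ?r \<cdot>\<^bsub>P\<^esub> massoc P (smO m' ?X, smO m' ?Y, smO m' ?Z)"
      using g.T.reassoc[OF 2, of "?r \<cdot>\<^bsub>P\<^esub> massoc P (smO m' ?X, smO m' ?Y, smO m' ?Z)"]
      by (simp del: g.T.interchange g.T.interchange_reassoc)
    finally show "smA ?c (massoc M (X, Y, Z)) \<cdot>\<^bsub>P\<^esub> mF2 ?c (X, Y \<otimes>\<^bsub>M\<^esub> Z) \<cdot>\<^bsub>P\<^esub> (mide P (smO ?c X) \<odot>\<^bsub>P\<^esub> mF2 ?c (Y, Z)) =
        mF2 ?c (X \<otimes>\<^bsub>M\<^esub> Y, Z) \<cdot>\<^bsub>P\<^esub> (mF2 ?c (X, Y) \<odot>\<^bsub>P\<^esub> mide P (smO ?c Z)) \<cdot>\<^bsub>P\<^esub> massoc P (smO ?c X, smO ?c Y, smO ?c Z)"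
      by simp
  next
    fix X assume [simp]: "X \<in> mobj M"
    let ?X = "smO m X" and ?FI = "smO m (munit M)"
    let ?l = "mF0 m' \<odot>\<^bsub>P\<^esub> mide P (smO m' ?X)" and ?r = "mide P (smO m' ?X) \<odot>\<^bsub>P\<^esub> mF0 m'"
    have 1: "mF2 m' (?FI, ?X) \<cdot>\<^bsub>P\<^esub> (smA m' (mF0 m) \<odot>\<^bsub>P\<^esub> mide P (smO m' ?X)) =
        smA m' (mF0 m \<odot>\<^bsub>N\<^esub> mide N ?X) \<cdot>\<^bsub>P\<^esub> mF2 m' (munit N, ?X)"
      using g.F2_natural[of "mF0 m" "mide N ?X"] by (simp add: g.F.FA_Ide)
    have 2: "mF2 m' (?X, ?FI) \<cdot>\<^bsub>P\<^esub> (mide P (smO m' ?X) \<odot>\<^bsub>P\<^esub> smA m' (mF0 m)) =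
        smA m' (mide N ?X \<odot>\<^bsub>N\<^esub> mF0 m) \<cdot>\<^bsub>P\<^esub> mF2 m' (?X, munit N)"
      using g.F2_natural[of "mide N ?X" "mF0 m"] by (simp add: g.F.FA_Ide)
    have "smA ?c (mlunit M X) \<cdot>\<^bsub>P\<^esub> mF2 ?c (munit M, X) \<cdot>\<^bsub>P\<^esub> (mF0 ?c \<odot>\<^bsub>P\<^esub> mide P (smO ?c X)) =
      smA m' (smA m (mlunit M X)) \<cdot>\<^bsub>P\<^esub> smA m' (mF2 m (munit M, X)) \<cdot>\<^bsub>P\<^esub> mF2 m' (?FI, ?X) \<cdot>\<^bsub>P\<^esub>
        (smA m' (mF0 m) \<odot>\<^bsub>P\<^esub> mide P (smO m' ?X)) \<cdot>\<^bsub>P\<^esub> ?l"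
      by simp
    also have "\<dots> = smA m' (smA m (mlunit M X)) \<cdot>\<^bsub>P\<^esub> smA m' (mF2 m (munit M, X)) \<cdot>\<^bsub>P\<^esub>
        smA m' (mF0 m \<odot>\<^bsub>N\<^esub> mide N ?X) \<cdot>\<^bsub>P\<^esub> mF2 m' (munit N, ?X) \<cdot>\<^bsub>P\<^esub> ?l"
      using g.T.reassoc[OF 1, of ?l] by (simp del: g.T.interchange g.T.interchange_reassoc)
    also have "\<dots> = smA m' (smA m (mlunit M X) \<cdot>\<^bsub>N\<^esub> mF2 m (munit M, X) \<cdot>\<^bsub>N\<^esub> (mF0 m \<odot>\<^bsub>N\<^esub> mide N ?X)) \<cdot>\<^bsub>P\<^esub>
        mF2 m' (munit N, ?X) \<cdot>\<^bsub>P\<^esub> ?l"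
      by (simp add: g.F.FA_Cmp')
    also have "\<dots> = mlunit P (smO m' ?X)"
      by (simp add: f.F_lunit g.F_lunit)
    finally show "smA ?c (mlunit M X) \<cdot>\<^bsub>P\<^esub> mF2 ?c (munit M, X) \<cdot>\<^bsub>P\<^esub> (mF0 ?c \<odot>\<^bsub>P\<^esub> mide P (smO ?c X)) = mlunit P (smO ?c X)"
      by simp
    have "smA ?c (mrunit M X) \<cdot>\<^bsub>P\<^esub> mF2 ?c (X, munit M) \<cdot>\<^bsub>P\<^esub> (mide P (smO ?c X) \<odot>\<^bsub>P\<^esub> mF0 ?c) =
      smA m' (smA m (mrunit M X)) \<cdot>\<^bsub>P\<^esub> smA m' (mF2 m (X, munit M)) \<cdot>\<^bsub>P\<^esub> mF2 m' (?X, ?FI) \<cdot>\<^bsub>P\<^esub>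
        (mide P (smO m' ?X) \<odot>\<^bsub>P\<^esub> smA m' (mF0 m)) \<cdot>\<^bsub>P\<^esub> ?r"
      by simp
    also have "\<dots> = smA m' (smA m (mrunit M X)) \<cdot>\<^bsub>P\<^esub> smA m' (mF2 m (X, munit M)) \<cdot>\<^bsub>P\<^esub>
        smA m' (mide N ?X \<odot>\<^bsub>N\<^esub> mF0 m) \<cdot>\<^bsub>P\<^esub> mF2 m' (?X, munit N) \<cdot>\<^bsub>P\<^esub> ?r"
      using g.T.reassoc[OF 2, of ?r] by (simp del: g.T.interchange g.T.interchange_reassoc)
    also have "\<dots> = smA m' (smA m (mrunit M X) \<cdot>\<^bsub>N\<^esub> mF2 m (X, munit M) \<cdot>\<^bsub>N\<^esub> (mide N ?X \<odot>\<^bsub>N\<^esub> mF0 m)) \<cdot>\<^bsub>P\<^esub>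
        mF2 m' (?X, munit N) \<cdot>\<^bsub>P\<^esub> ?r"
      by (simp add: g.F.FA_Cmp')
    also have "\<dots> = mrunit P (smO m' ?X)"
      by (simp add: f.F_runit g.F_runit)
    finally show "smA ?c (mrunit M X) \<cdot>\<^bsub>P\<^esub> mF2 ?c (X, munit M) \<cdot>\<^bsub>P\<^esub> (mide P (smO ?c X) \<odot>\<^bsub>P\<^esub> mF0 ?c) = mrunit P (smO ?c X)"
      by simp
  qed
qed

lemma smf_eqI:
  assumes "weak_symmetric_monoidal_functor m M N" "weak_symmetric_monoidal_functor m' M N"
    and "\<And>A. A \<in> mobj M \<Longrightarrow> smO m A = smO m' A" "\<And>f. f \<in> marr M \<Longrightarrow> smA m f = smA m' f"
    and "mF0 m = mF0 m'" "\<And>A B. A \<in> mobj M \<Longrightarrow> B \<in> mobj M \<Longrightarrow> mF2 m (A, B) = mF2 m' (A, B)"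
  shows "m = m'"
proof -
  interpret f: weak_symmetric_monoidal_functor m M N by fact
  interpret g: weak_symmetric_monoidal_functor m' M N by fact
  have "mF2 m = mF2 m'"
    using f.F2_extensional g.F2_extensional assms(6) by (auto intro: extensionalityI)
  moreover have "mfun m = mfun m'"
    using f.mfun_functor g.mfun_functor assms(3,4) by (rule func_eqI)
  ultimately show ?thesis
    using assms(5) f.src_tgt g.src_tgt by (intro smf.equality) simp_all
qed

lemma comp_smf_id:
  assumes f: "weak_symmetric_monoidal_functor f M N"
  shows "comp_smf f (id_smf M) = f" "comp_smf (id_smf N) f = f"
proof -
  interpret f: weak_symmetric_monoidal_functor f M N by fact
  show "comp_smf f (id_smf M) = f"
    by (rule smf_eqI[OF comp_smf_functor[OF id_smf_functor[OF f.src_smc] f] f]) (simp_all add: f.F.FA_Ide)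
  show "comp_smf (id_smf N) f = f"
    by (rule smf_eqI[OF comp_smf_functor[OF f id_smf_functor[OF f.tgt_smc]] f]) simp_all
qed

lemma comp_smf_assoc:
  assumes f: "weak_symmetric_monoidal_functor f M N" and g: "weak_symmetric_monoidal_functor g N P"
    and h: "weak_symmetric_monoidal_functor h P Q"
  shows "comp_smf h (comp_smf g f) = comp_smf (comp_smf h g) f"
proof -
  interpret f: weak_symmetric_monoidal_functor f M N by fact
  interpret g: weak_symmetric_monoidal_functor g N P by fact
  interpret h: weak_symmetric_monoidal_functor h P Q by fact
  show ?thesis
    by (rule smf_eqI[OF comp_smf_functor[OF comp_smf_functor[OF f g] h] comp_smf_functor[OF f comp_smf_functor[OF g h]]])
      (simp_all add: h.F.FA_Cmp')
qed

lemma SMC_simps [simp]: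
  "Obj SMC = {M. symmetric_monoidal_category M}"
  "Arr SMC = {m. is_smf m}"
  "is_smf m \<Longrightarrow> Dom SMC m = msrc m"
  "is_smf m \<Longrightarrow> Cod SMC m = mtgt m"
  "symmetric_monoidal_category M \<Longrightarrow> Ide SMC M = id_smf M"
  "is_smf m' \<Longrightarrow> is_smf m \<Longrightarrow> msrc m' = mtgt m \<Longrightarrow> Cmp SMC m' m = comp_smf m' m"
  by (simp_all add: SMC_def)

lemma composable_SMC: "composable SMC m' m \<longleftrightarrow> is_smf m' \<and> is_smf m \<and> msrc m' = mtgt m"
  by (auto simp: composable_def)

theorem SMC_category: "category SMC"
proof (rule category.intro)
  have st: "symmetric_monoidal_category (msrc m)" "symmetric_monoidal_category (mtgt m)" if "is_smf m" for m
    using that by (simp_all add: weak_symmetric_monoidal_functor_def)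
  show "Dom SMC \<in> Arr SMC \<rightarrow>\<^sub>E Obj SMC" "Cod SMC \<in> Arr SMC \<rightarrow>\<^sub>E Obj SMC"
    using st by (auto simp: SMC_def)
  show "Ide SMC \<in> Obj SMC \<rightarrow>\<^sub>E Arr SMC"
    using id_smf_functor by (auto simp: SMC_def)
  show "in_hom SMC (Ide SMC M) M M" if "M \<in> Obj SMC" for M
    using that id_smf_functor[of M] by (simp add: in_hom_def)
  show "in_hom SMC (Cmp SMC g f) (Dom SMC f) (Cod SMC g)" if "composable SMC g f" for g f
  proof -
    have gf: "is_smf g" "is_smf f" "msrc g = mtgt f" using that by (auto simp: composable_SMC)
    then show ?thesis
      using comp_smf_functor[of f "msrc f" "mtgt f" g "mtgt g"] by (simp add: in_hom_def)
  qed
  show "Cmp SMC g f = undefined" if "\<not> composable SMC g f" for g f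
  proof -
    have "\<not> (is_smf g \<and> is_smf f \<and> msrc g = mtgt f)" using that unfolding composable_SMC .
    then show ?thesis by (auto simp: SMC_def)
  qed
  show "Cmp SMC f (Ide SMC (Dom SMC f)) = f" "Cmp SMC (Ide SMC (Cod SMC f)) f = f" if "f \<in> Arr SMC" for f
  proof -
    have f: "is_smf f" using that by simp
    have "is_smf (id_smf (msrc f))" "is_smf (id_smf (mtgt f))"
      using id_smf_functor[OF st(1)[OF f]] id_smf_functor[OF st(2)[OF f]] by simp_all
    then show "Cmp SMC f (Ide SMC (Dom SMC f)) = f" "Cmp SMC (Ide SMC (Cod SMC f)) f = f"
      using f st[OF f] comp_smf_id[OF f] by simp_all
  qed
  show "Cmp SMC h (Cmp SMC g f) = Cmp SMC (Cmp SMC h g) f"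
    if hg: "composable SMC h g" and gf: "composable SMC g f" for h g f
  proof -
    have c: "is_smf h" "is_smf g" "is_smf f" "msrc h = mtgt g" "msrc g = mtgt f"
      using hg gf by (auto simp: composable_SMC)
    have f: "weak_symmetric_monoidal_functor f (msrc f) (mtgt f)" and g: "weak_symmetric_monoidal_functor g (mtgt f) (mtgt g)"
      and h: "weak_symmetric_monoidal_functor h (mtgt g) (mtgt h)"
      using c by simp_all
    show ?thesis
      using c comp_smf_functor[OF f g] comp_smf_functor[OF g h] comp_smf_assoc[OF f g h] by simp
  qed
qed

section \<open>Weak morphisms\<close>

context weak_symmetric_monoidal_functor
begin

lemma word_psi_rename:
  "wvars u \<subseteq> {..<length js} \<Longrightarrow> word_psi m (rename js u) As = word_psi m u (map ((!) As) js)"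
  by (induction u) (auto simp: wobj_rename)

lemma wpsi_S_arr:
  assumes x: "x \<in> level n" and As: "length As = n" "set As \<subseteq> mobj M"
  shows "wpsi (S_arr m) n x As = word_psi m (word_of x) As"
proof -
  obtain \<sigma> t where x': "x = (\<sigma>, t)" "arity t = n" "\<sigma> permutes {..<n}" using x by auto
  have "tree_psi m t (permute_list \<sigma> As) = word_psi m (word_of x) As"
    using x' As by (simp only: permute_list_map_nth word_of_def prod.case) (rule tree_psi_label, simp)
  then show ?thesis
    using x' As by (simp add: S_arr_def)
qed

lemma S_arr_simps [simp]:
  "wsrc (S_arr m) = S_obj M" "wtgt (S_arr m) = S_obj N" "wfun (S_arr m) = mfun m"
  by (simp_all add: S_arr_def)

text \<open>Once \<psi> is expressed by words, the laws are at hand: naturality in 2-cells is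
  \<open>word_psi_canonical\<close> with coherence, composition is \<open>word_psi_wsubst\<close>,
  and equivariance is compatibility with renaming.\<close>

theorem S_arr_weak_morphism: "weak_morphism WkP (S_arr m)"
proof (rule weak_morphism.intro, unfold S_arr_simps S.hat_S_obj(1) T.hat_S_obj(1))
  show "algebra WkP (S_obj M)" "algebra WkP (S_obj N)"
    by (rule S.S_obj_algebra T.S_obj_algebra)+
  show "cat_functor (mcat M) (mcat N) (mfun m)" by (rule mfun_functor)
  show "wpsi (S_arr m) n \<in> extensional (Obj (Lev WkP n))" for n
    by (simp add: S_arr_def)
  show "wpsi (S_arr m) n q \<in> extensional (Obj (power_cat (mcat M) n))" if "q \<in> Obj (Lev WkP n)" for n q
    using that by (cases q) (simp add: S_arr_def)
next
  fix n q As assume "q \<in> Obj (Lev WkP n)" and "As \<in> Obj (power_cat (mcat M) n)"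
  then have q: "q \<in> level n" and As: "length As = n" "set As \<subseteq> mobj M" by auto
  have FAs: "length (map (smO m) As) = n" "set (map (smO m) As) \<subseteq> mobj N" using As by auto
  note \<psi> = word_psi_simps[OF As(2), of "word_of q"]
  show "in_hom (mcat N) (wpsi (S_arr m) n q As) (FO (op1 (S_obj N) n q) (map (smO m) As)) (smO m (FO (op1 (S_obj M) n q) As))"
    "is_iso (mcat N) (wpsi (S_arr m) n q As)"
    using \<psi> S.FO_interp(1)[OF q As] T.FO_interp(1)[OF q FAs] S.op_S_obj(1)[OF q] T.op_S_obj(1)[OF q] As wvars_word_of[OF q]
    by (simp_all add: wpsi_S_arr[OF q As] in_hom_def)
  show "wpsi (S_arr m) n (actO WkP n \<sigma> q) As = wpsi (S_arr m) n q (permute_list \<sigma> As)" if \<sigma>: "\<sigma> permutes {..<n}" for \<sigma>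
  proof -
    have "actO WkP n \<sigma> q = actS free_operad n \<sigma> q" by (cases q) (simp add: free_operad_def)
    then show ?thesis
      using wpsi_S_arr[OF act_level[OF q \<sigma>] As] wpsi_S_arr[OF q permute_list_in[OF \<sigma> As]] wvars_word_of[OF q]
        word_psi_rename[of "word_of q" "map \<sigma> [0..<n]" As]
      by (simp add: word_of_act[OF q \<sigma>] permute_list_map_nth As del: map_map)
  qed
next
  fix n q fs assume "q \<in> Obj (Lev WkP n)" and "fs \<in> Arr (power_cat (mcat M) n)"
  then have q: "q \<in> level n" and fs: "length fs = n" "set fs \<subseteq> marr M" by auto
  have D: "length (map (mdom M) fs) = n" "set (map (mdom M) fs) \<subseteq> mobj M"
    and E: "length (map (mcod M) fs) = n" "set (map (mcod M) fs) \<subseteq> mobj M"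
    and Ffs: "length (map (smA m) fs) = n" "set (map (smA m) fs) \<subseteq> marr N"
    using fs by auto
  show "wpsi (S_arr m) n q (map (mcod M) fs) \<cdot>\<^bsub>N\<^esub> FA (op1 (S_obj N) n q) (map (smA m) fs) =
      smA m (FA (op1 (S_obj M) n q) fs) \<cdot>\<^bsub>N\<^esub> wpsi (S_arr m) n q (map (mdom M) fs)"
    using word_psi_natural[OF fs(2), of "word_of q"] fs(1) wvars_word_of[OF q]
    by (simp add: wpsi_S_arr[OF q D] wpsi_S_arr[OF q E] S.op_S_obj(1)[OF q] T.op_S_obj(1)[OF q]
        S.FA_interp(1)[OF q fs] T.FA_interp(1)[OF q Ffs] del: map_map)
next
  fix e n As assume "e \<in> Arr (Lev WkP n)" and "As \<in> Obj (power_cat (mcat M) n)"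
  then obtain x y where e: "e = (x, y)" and x: "x \<in> level n" and y: "y \<in> level n"
    and As: "length As = n" "set As \<subseteq> mobj M" by (cases e) auto
  obtain \<eta> where \<eta>: "canonical M n (word_of x) (word_of y) \<eta>"
    "canonical_iso M n x y = \<lparr>NSrc = interp M x, NTgt = interp M y, NCmp = \<eta>\<rparr>"
    using S.canonical_isoE[OF x y] by blast
  obtain \<theta> where \<theta>: "canonical N n (word_of x) (word_of y) \<theta>"
    "word_psi m (word_of y) As \<cdot>\<^bsub>N\<^esub> \<theta> (map (smO m) As) = smA m (\<eta> As) \<cdot>\<^bsub>N\<^esub> word_psi m (word_of x) As"
    using word_psi_canonical[OF \<eta>(1)] As by blast
  show "wpsi (S_arr m) n (Cod (Lev WkP n) e) As \<cdot>\<^bsub>N\<^esub> NCmp (op2 (S_obj N) n e) (map (smO m) As) =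
      smA m (NCmp (op2 (S_obj M) n e) As) \<cdot>\<^bsub>N\<^esub> wpsi (S_arr m) n (Dom (Lev WkP n) e) As"
    unfolding e WkP_simps(3)[OF x y] WkP_simps(4)[OF x y] S.op_S_obj(2)[OF x y] T.op_S_obj(2)[OF x y]
      wpsi_S_arr[OF x As] wpsi_S_arr[OF y As] \<eta>(2) T.canonical_iso_eq(1)[OF x y \<theta>(1)]
    using \<theta>(2) by simp
next
  fix A assume "A \<in> mobj M"
  then show "wpsi (S_arr m) 1 (unitO WkP) [A] = mide N (smO m A)"
    using wpsi_S_arr[OF planar_level[of Unit], of "[A]"] by simp
next
  fix q ks qs As
  assume "q \<in> Obj (Lev WkP (length ks))" and "list_all2 (\<lambda>k q'. q' \<in> Obj (Lev WkP k)) ks qs"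
    and "As \<in> Obj (power_cat (mcat M) (sum_list ks))"
  then have q: "q \<in> level (length ks)" and qs: "list_all2 (\<lambda>k x. x \<in> level k) ks qs"
    and As: "length As = sum_list ks" "set As \<subseteq> mobj M" by auto
  let ?bw = "block_words ks qs"
  note l = list_all2_level_nth[OF qs]
  have bw: "wvars w \<subseteq> {..<length As}" if "w \<in> set ws" "ws = ?bw" for w ws
    using that unfolding As(1) by (simp only:) (rule wvars_block_words[OF qs])
  \<comment> \<open>\<open>1\<close> and \<open>2\<close> turn the blockwise lists of the
    composition law into values at the words to be substituted.\<close>
  have 1: "map2 (\<lambda>(k, q') Bs. FO (op1 (S_obj M) k q') Bs) (zip ks qs) (blocks ks As) = map (\<lambda>w. wobj M w As) ?bw"
    unfolding wobj_block_words[OF qs As(1)]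
  proof (rule nth_equalityI)
    fix i assume "i < length (map2 (\<lambda>(k, q') Bs. FO (op1 (S_obj M) k q') Bs) (zip ks qs) (blocks ks As))"
    then have i: "i < length ks" by simp
    show "map2 (\<lambda>(k, q') Bs. FO (op1 (S_obj M) k q') Bs) (zip ks qs) (blocks ks As) ! i =
        map2 (\<lambda>x. wobj M (word_of x)) qs (blocks ks As) ! i"
      using S.op_S_obj(1)[OF l(2)[OF i]] S.FO_interp(1)[OF l(2)[OF i], of "blocks ks As ! i"]
        set_blocks_subset[OF As i] l(1) i As(1) by simp
  qed (simp add: l(1))
  have 2: "map2 (\<lambda>(k, q') Bs. wpsi (S_arr m) k q' Bs) (zip ks qs) (blocks ks As) = map (\<lambda>w. word_psi m w As) ?bw"
  proof (rule nth_equalityI)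
    fix i assume "i < length (map2 (\<lambda>(k, q') Bs. wpsi (S_arr m) k q' Bs) (zip ks qs) (blocks ks As))"
    then have i: "i < length ks" by simp
    have "word_psi m (?bw ! i) As = word_psi m (word_of (qs ! i)) (blocks ks As ! i)"
      unfolding block_words_nth[OF qs i]
      using word_psi_rename[of "word_of (qs ! i)" "blocks ks [0..<sum_list ks] ! i" As] wvars_word_of[OF l(2)[OF i]] i
      by (simp add: map_nth_blocks[OF As(1) i])
    then show "map2 (\<lambda>(k, q') Bs. wpsi (S_arr m) k q' Bs) (zip ks qs) (blocks ks As) ! i = map (\<lambda>w. word_psi m w As) ?bw ! i"
      using wpsi_S_arr[OF l(2)[OF i], of "blocks ks As ! i"] set_blocks_subset[OF As i] l(1) i As(1) by simp
  qed (simp add: l(1))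
  have S: "length (map (\<lambda>w. wobj M w As) ?bw) = length ks" "set (map (\<lambda>w. wobj M w As) ?bw) \<subseteq> mobj M"
    using l(1) S.FO_interp_blocks(2)[OF qs As] by simp_all
  have P: "set (map (\<lambda>w. word_psi m w As) ws) \<subseteq> marr N" if "ws = ?bw" for ws
    using bw[OF _ that] As(2) by auto
  have "wpsi (S_arr m) (sum_list ks) (compS free_operad ks q qs) As = word_psi m (wsubst ?bw (word_of q)) As"
    using wpsi_S_arr[OF comp_level(1)[OF q qs] As] by (simp add: comp_level(2)[OF q qs] wcomp_def)
  also have "\<dots> = word_psi m (word_of q) (map (\<lambda>w. wobj M w As) ?bw) \<cdot>\<^bsub>N\<^esub> warr N (word_of q) (map (\<lambda>w. word_psi m w As) ?bw)"
    using bw[OF _ refl] l(1) wvars_word_of[OF q] by (intro word_psi_wsubst As) simp_all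
  also have "\<dots> = wpsi (S_arr m) (length ks) q (map (\<lambda>w. wobj M w As) ?bw) \<cdot>\<^bsub>N\<^esub>
      FA (op1 (S_obj N) (length ks) q) (map (\<lambda>w. word_psi m w As) ?bw)"
    using wpsi_S_arr[OF q S] T.op_S_obj(1)[OF q] T.FA_interp(1)[OF q _ P[OF refl]] l(1) by simp
  finally show "wpsi (S_arr m) (sum_list ks) (compO WkP ks q qs) As =
      wpsi (S_arr m) (length ks) q (map2 (\<lambda>(k, q') Bs. FO (op1 (S_obj M) k q') Bs) (zip ks qs) (blocks ks As)) \<cdot>\<^bsub>N\<^esub>
      FA (op1 (S_obj N) (length ks) q) (map2 (\<lambda>(k, q') Bs. wpsi (S_arr m) k q' Bs) (zip ks qs) (blocks ks As))"
    unfolding 1 2 WkP_simps(8) .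
qed

text \<open>At the tree of the symbol \<open>.\<close> the comparison map is \<open>mF2 m\<close>
  after a tensor product of identities, hence \<open>mF2 m\<close> itself.\<close>

theorem R_S_arr: "R_arr (S_arr m) = m"
proof -
  have l: "planar Nul \<in> level 0" "planar (Bin Unit Unit) \<in> level 2"
    using planar_level[of Nul] planar_level[of "Bin Unit Unit"] by (simp_all add: numeral_2_eq_2)
  have w: "word_of (planar Nul) = WNul" "word_of (planar (Bin Unit Unit)) = WBin (WVar 0) (WVar 1)"
    by (simp_all add: word_of_def)
  have "mF0 (R_arr (S_arr m)) = mF0 m"
    using wpsi_S_arr[OF l(1), of "[]"] by (simp add: R_arr_def Let_def w)
  moreover have "mF2 (R_arr (S_arr m)) = mF2 m"
  proof (rule extensionalityI)
    show "mF2 (R_arr (S_arr m)) \<in> extensional (mobj M \<times> mobj M)"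
      by (simp add: R_arr_def Let_def)
    show "mF2 m \<in> extensional (mobj M \<times> mobj M)" by (rule F2_extensional)
    fix p assume "p \<in> mobj M \<times> mobj M"
    then obtain A B where p: "p = (A, B)" "A \<in> mobj M" "B \<in> mobj M" by blast
    then show "mF2 (R_arr (S_arr m)) p = mF2 m p"
      using wpsi_S_arr[OF l(2), of "[A, B]"] by (simp add: R_arr_def Let_def w)
  qed
  moreover have "msrc (R_arr (S_arr m)) = M" "mtgt (R_arr (S_arr m)) = N" "mfun (R_arr (S_arr m)) = mfun m"
    by (simp_all add: R_arr_def Let_def S.R_S_obj T.R_S_obj)
  ultimately show ?thesis
    by (intro smf.equality) simp_all
qed

end

section \<open>From weak morphisms to monoidal functors\<close>

locale wk_morphism =
  fixes m :: "('o, 'a) wkp_mor"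
  assumes wk: "weak_morphism WkP m"

sublocale wk_morphism \<subseteq> weak_morphism WkP m
  by (rule wk)

sublocale wk_morphism \<subseteq> X: wk_algebra "wsrc m"
  by (rule wk_algebra.intro[OF src_algebra])

sublocale wk_morphism \<subseteq> Y: wk_algebra "wtgt m"
  by (rule wk_algebra.intro[OF tgt_algebra])

context wk_morphism
begin

lemma R_arr_simps [simp]:
  "msrc (R_arr m) = X.M" "mtgt (R_arr m) = Y.M" "mfun (R_arr m) = wfun m"
  "mF0 (R_arr m) = wpsi m 0 (planar Nul) []"
  "A \<in> Obj X.C \<Longrightarrow> B \<in> Obj X.C \<Longrightarrow> mF2 (R_arr m) (A, B) = wpsi m 2 (planar (Bin Unit Unit)) [A, B]"
  by (simp_all add: R_arr_def Let_def)

definition planar_psi :: "tree \<Rightarrow> 'o list \<Rightarrow> 'a" where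
  "planar_psi t = wpsi m (arity t) (planar t)"

lemma planar_psi_arr:
  assumes "length As = arity t" "set As \<subseteq> Obj X.C"
  shows "planar_psi t As \<in> Arr Y.C"
  using psi_in_hom[of "planar t" "arity t" As] planar_level[of t] assms by (simp add: planar_psi_def in_hom_def)

text \<open>The composition law of \<psi> at the symbol \<open>.\<close> composed with
  \<open>s\<close> and \<open>t\<close>, which has the form of the recursion for
  \<open>tree_psi\<close>.\<close>

lemma planar_psi_Bin:
  assumes "length As = arity (Bin s t)" "set As \<subseteq> Obj X.C"
  shows "planar_psi (Bin s t) As = Cmp Y.C
    (wpsi m 2 (planar (Bin Unit Unit)) [FO (X.planar_op s) (take (arity s) As), FO (X.planar_op t) (drop (arity s) As)])
    (FA (op1 (wtgt m) 2 (planar (Bin Unit Unit))) [planar_psi s (take (arity s) As), planar_psi t (drop (arity s) As)])"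
proof -
  have q: "planar (Bin Unit Unit) \<in> Obj (Lev WkP (length [arity s, arity t]))"
    using planar_level[of "Bin Unit Unit"] by simp
  have qs: "list_all2 (\<lambda>k q'. q' \<in> Obj (Lev WkP k)) [arity s, arity t] [planar s, planar t]"
    using planar_level[of s] planar_level[of t] by simp
  have "As \<in> Obj (power_cat X.C (sum_list [arity s, arity t]))" using assms by simp
  from psi_comp[OF q qs this] show ?thesis
    using assms(1) unfolding WkP_simps(8) comp_planar
    by (simp add: planar_psi_def X.planar_op_def numeral_2_eq_2)
qed

lemma planar_psi_tree:
  "length As = arity t \<Longrightarrow> set As \<subseteq> Obj X.C \<Longrightarrow> planar_psi t As = tree_psi (R_arr m) t As"
proof (induction t arbitrary: As)
  case Unit
  then obtain A where A: "As = [A]" "A \<in> Obj X.C" by (cases As) auto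
  then show ?case using psi_unit[OF A(2)] by (simp add: planar_psi_def)
next
  case Nul
  then show ?case by (simp add: planar_psi_def)
next
  case (Bin s t)
  have sub: "set (take n As) \<subseteq> Obj X.C" "set (drop n As) \<subseteq> Obj X.C" for n
    using Bin.prems(2) set_take_subset set_drop_subset by fast+
  let ?s = "take (arity s) As" and ?t = "drop (arity s) As"
  have l: "length ?s = arity s" "length ?t = arity t" using Bin.prems(1) by simp_all
  have o: "tree_obj X.M s ?s \<in> Obj X.C" "tree_obj X.M t ?t \<in> Obj X.C"
    using cat_functor.FO_obj[OF X.planar_op_functor, of ?s s] cat_functor.FO_obj[OF X.planar_op_functor, of ?t t]
      X.planar_op_tree(1)[OF l(1) sub(1)] X.planar_op_tree(1)[OF l(2) sub(2)] l sub by simp_all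
  note IH = Bin.IH(1)[OF l(1) sub(1)] Bin.IH(2)[OF l(2) sub(2)]
  note arr = planar_psi_arr[OF l(1) sub(1), unfolded IH] planar_psi_arr[OF l(2) sub(2), unfolded IH]
  show ?case
    unfolding planar_psi_Bin[OF Bin.prems] X.planar_op_tree(1)[OF l(1) sub(1)] X.planar_op_tree(1)[OF l(2) sub(2)] IH
    using o by (simp add: Y.tensor_R_obj(2)[OF arr])
qed

text \<open>Equivariance reduces \<psi> to planar trees, where the unit and composition laws fix it
  by its values at the two generators; so \<psi> has to be the one built from \<open>mF0\<close> and
  \<open>mF2\<close>.\<close>

lemma wpsi_eq_word_psi:
  assumes x: "x \<in> level n" and As: "length As = n" "set As \<subseteq> Obj X.C"
  shows "wpsi m n x As = word_psi (R_arr m) (word_of x) As" "wpsi m n x As = tree_psi (R_arr m) (snd x) (permute_list (fst x) As)"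
proof -
  obtain \<sigma> t where x': "x = (\<sigma>, t)" "arity t = n" "\<sigma> permutes {..<n}" using x by auto
  have pl: "planar t \<in> Obj (Lev WkP n)" using planar_level[of t] x'(2) by simp
  have "actO WkP n \<sigma> (planar t) = x" by (simp add: x'(1))
  then have "wpsi m n x As = planar_psi t (permute_list \<sigma> As)"
    using psi_act[OF pl x'(3), of As] As x'(2) by (simp add: planar_psi_def)
  also have "\<dots> = tree_psi (R_arr m) t (permute_list \<sigma> As)"
    using permute_list_in[OF x'(3) As] x'(2) by (intro planar_psi_tree) simp_all
  finally show "wpsi m n x As = tree_psi (R_arr m) (snd x) (permute_list (fst x) As)"
    by (simp add: x'(1))
  also have "\<dots> = word_psi (R_arr m) (word_of x) As"
    using x' As by (simp only: permute_list_map_nth word_of_def prod.case fst_conv snd_conv) (rule tree_psi_label, simp)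
  finally show "wpsi m n x As = word_psi (R_arr m) (word_of x) As" .
qed

lemma word_psi_cell:
  assumes "linear n u" "linear n v" "length As = n" "set As \<subseteq> Obj X.C"
  shows "Cmp Y.C (word_psi (R_arr m) v As) (Y.cell n u v (map (FO (wfun m)) As)) =
    Cmp Y.C (FA (wfun m) (X.cell n u v As)) (word_psi (R_arr m) u As)"
proof -
  note l = ptree_of_level[OF assms(1)] ptree_of_level[OF assms(2)]
  have e: "(ptree_of u, ptree_of v) \<in> Arr (Lev WkP n)" and As: "As \<in> Obj (power_cat X.C n)"
    using l assms by simp_all
  show ?thesis
    using psi_natural_cells[OF e As] unfolding WkP_simps(3)[OF l] WkP_simps(4)[OF l]
    by (simp add: wpsi_eq_word_psi(1)[OF l(1) assms(3,4)] wpsi_eq_word_psi(1)[OF l(2) assms(3,4)] X.cell_def Y.cell_def)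
qed

text \<open>Compatibility with associativity, units and symmetry is naturality of \<psi> in the
  2-cells that define these maps, with \<psi> at their source and target unfolded into
  \<open>mF0\<close> and \<open>mF2\<close>.\<close>

theorem R_arr_smf: "weak_symmetric_monoidal_functor (R_arr m) X.M Y.M"
proof -
  let ?M = "X.M" and ?N = "Y.M" and ?r = "R_arr m"
  interpret M: symmetric_monoidal_category ?M by (rule X.R_obj_smc)
  interpret N: symmetric_monoidal_category ?N by (rule Y.R_obj_smc)
  interpret F: cat_functor "X.C" "Y.C" "wfun m" by (rule wfun_functor)
  have l: "planar Nul \<in> level 0" "planar (Bin Unit Unit) \<in> level 2"
    using planar_level[of Nul] planar_level[of "Bin Unit Unit"] by (simp_all add: numeral_2_eq_2)
  have F0: "in_hom Y.C (wpsi m 0 (planar Nul) []) (munit ?N) (FO (wfun m) (munit ?M))"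
    "is_iso Y.C (wpsi m 0 (planar Nul) [])"
    using psi_in_hom[of "planar Nul" 0 "[]"] psi_iso[of "planar Nul" 0 "[]"] l by simp_all
  note [simp] = M.tensor_obj[simplified] N.tensor_obj[simplified]
  have F2: "in_hom Y.C (mF2 ?r (A, B)) (FO (wfun m) A \<otimes>\<^bsub>?N\<^esub> FO (wfun m) B) (FO (wfun m) (A \<otimes>\<^bsub>?M\<^esub> B))"
    "is_iso Y.C (mF2 ?r (A, B))" if "A \<in> Obj X.C" "B \<in> Obj X.C" for A B
    using psi_in_hom[of "planar (Bin Unit Unit)" 2 "[A, B]"] psi_iso[of "planar (Bin Unit Unit)" 2 "[A, B]"] l that
    by (simp_all add: X.tensor_R_obj Y.tensor_R_obj)
  note F2s = F2(1)[THEN in_homD(1)] F2(1)[THEN in_homD(2)] F2(1)[THEN in_homD(3)]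
  note F0s = F0(1)[THEN in_homD(1)] F0(1)[THEN in_homD(2)] F0(1)[THEN in_homD(3)]
  note N_simps = N.tensor_simps[simplified] N.tensor_Ide[simplified] N.interchange[simplified] N.interchange_reassoc[simplified]
  show ?thesis
  proof (rule weak_symmetric_monoidal_functor.intro, unfold R_obj_simps(1) R_arr_simps(1-3))
    show "symmetric_monoidal_category ?M" "symmetric_monoidal_category ?N"
      by (rule X.R_obj_smc Y.R_obj_smc)+
    show "cat_functor X.C Y.C (wfun m)" by (rule wfun_functor)
    show "mF2 ?r \<in> extensional (Obj X.C \<times> Obj X.C)"
      by (simp add: R_arr_def Let_def)
    show "in_hom Y.C (mF0 ?r) (munit ?N) (FO (wfun m) (munit ?M))" "is_iso Y.C (mF0 ?r)"
      using F0 by simp_all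
  next
    fix A B assume AB: "A \<in> Obj X.C" "B \<in> Obj X.C"
    show "in_hom Y.C (mF2 ?r (A, B)) (FO (wfun m) A \<otimes>\<^bsub>?N\<^esub> FO (wfun m) B) (FO (wfun m) (A \<otimes>\<^bsub>?M\<^esub> B))"
      "is_iso Y.C (mF2 ?r (A, B))"
      using F2[OF AB] by simp_all
    show "Cmp Y.C (FA (wfun m) (mswap ?M (A, B))) (mF2 ?r (A, B)) =
        Cmp Y.C (mF2 ?r (B, A)) (mswap ?N (FO (wfun m) A, FO (wfun m) B))"
      using word_psi_cell[OF linear_planar(1,2), of "[A, B]"] AB F2s[of A B] F2s[of B A]
      by (simp add: X.R_obj_cells Y.R_obj_cells N_simps del: R_arr_simps(5))
  next
    fix f g assume fg: "f \<in> Arr X.C" "g \<in> Arr X.C"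
    then show "Cmp Y.C (mF2 ?r (Cod X.C f, Cod X.C g)) (FA (wfun m) f \<odot>\<^bsub>?N\<^esub> FA (wfun m) g) =
        Cmp Y.C (FA (wfun m) (f \<odot>\<^bsub>?M\<^esub> g)) (mF2 ?r (Dom X.C f, Dom X.C g))"
      using psi_natural_args[of "planar (Bin Unit Unit)" 2 "[f, g]"] l by (simp add: X.tensor_R_obj Y.tensor_R_obj)
  next
    fix A B D assume ABD: "A \<in> Obj X.C" "B \<in> Obj X.C" "D \<in> Obj X.C"
    show "Cmp Y.C (FA (wfun m) (massoc ?M (A, B, D))) (Cmp Y.C (mF2 ?r (A, B \<otimes>\<^bsub>?M\<^esub> D))
          (Ide Y.C (FO (wfun m) A) \<odot>\<^bsub>?N\<^esub> mF2 ?r (B, D))) =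
        Cmp Y.C (mF2 ?r (A \<otimes>\<^bsub>?M\<^esub> B, D)) (Cmp Y.C (mF2 ?r (A, B) \<odot>\<^bsub>?N\<^esub> Ide Y.C (FO (wfun m) D))
          (massoc ?N (FO (wfun m) A, FO (wfun m) B, FO (wfun m) D)))"
      using word_psi_cell[OF linear_planar(3,4), of "[A, B, D]"] ABD F2s[of A B] F2s[of B D]
        F2s[of A "B \<otimes>\<^bsub>?M\<^esub> D"] F2s[of "A \<otimes>\<^bsub>?M\<^esub> B" D] N.assoc_simps[of "FO (wfun m) A" "FO (wfun m) B" "FO (wfun m) D"]
      by (simp add: X.R_obj_cells(4)[symmetric] Y.R_obj_cells(4)[symmetric] N_simps del: R_arr_simps(5))
  next
    fix A assume A: "A \<in> Obj X.C"
    show "Cmp Y.C (FA (wfun m) (mlunit ?M A)) (Cmp Y.C (mF2 ?r (munit ?M, A))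
          (mF0 ?r \<odot>\<^bsub>?N\<^esub> Ide Y.C (FO (wfun m) A))) = mlunit ?N (FO (wfun m) A)"
      "Cmp Y.C (FA (wfun m) (mrunit ?M A)) (Cmp Y.C (mF2 ?r (A, munit ?M))
          (Ide Y.C (FO (wfun m) A) \<odot>\<^bsub>?N\<^esub> mF0 ?r)) = mrunit ?N (FO (wfun m) A)"
      using word_psi_cell[OF linear_planar(7,5), of "[A]"] word_psi_cell[OF linear_planar(8,5), of "[A]"] A
        N.unit_simps[of "FO (wfun m) A"]
      by (simp_all add: X.R_obj_cells(1,2)[symmetric, unfolded One_nat_def] Y.R_obj_cells(1,2)[symmetric, unfolded One_nat_def] N_simps del: R_arr_simps(5) R_obj_simps(2))
  qed (rule refl)+
qed

theorem S_R_arr: "S_arr (R_arr m) = m"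
proof -
  have "wpsi (S_arr (R_arr m)) n = wpsi m n" for n
  proof (rule extensionalityI)
    show "wpsi (S_arr (R_arr m)) n \<in> extensional (level n)" by (simp add: S_arr_def)
    show "wpsi m n \<in> extensional (level n)" using psi_extensional(1)[of n] by simp
    fix x assume x: "x \<in> level n"
    show "wpsi (S_arr (R_arr m)) n x = wpsi m n x"
    proof (rule extensionalityI)
      show "wpsi (S_arr (R_arr m)) n x \<in> extensional (Obj (power_cat X.C n))"
        using x by (cases x) (simp add: S_arr_def)
      show "wpsi m n x \<in> extensional (Obj (power_cat X.C n))"
        using psi_extensional(2)[of x n] x by simp
      fix As assume "As \<in> Obj (power_cat X.C n)"
      then have As: "length As = n" "set As \<subseteq> Obj X.C" by auto
      show "wpsi (S_arr (R_arr m)) n x As = wpsi m n x As"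
        using x As wpsi_eq_word_psi(2)[OF x As] by (cases x) (simp add: S_arr_def)
    qed
  qed
  then have "wpsi (S_arr (R_arr m)) = wpsi m" by (rule ext)
  moreover have "wsrc (S_arr (R_arr m)) = wsrc m" "wtgt (S_arr (R_arr m)) = wtgt m" "wfun (S_arr (R_arr m)) = wfun m"
    by (simp_all add: S_arr_def X.S_R_obj Y.S_R_obj)
  ultimately show ?thesis by (intro wmor.equality) simp_all
qed

end

section \<open>The isomorphism\<close>

lemma S_arr_id:
  assumes "symmetric_monoidal_category M"
  shows "S_arr (id_smf M) = id_wmor WkP (S_obj M)"
proof -
  interpret f: weak_symmetric_monoidal_functor "id_smf M" M M
    by (rule id_smf_functor[OF assms])
  have \<psi>: "word_psi (id_smf M) u As = mide M (wobj M u As)"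
    if As: "set As \<subseteq> mobj M" and "wvars u \<subseteq> {..<length As}" for u As
    using that(2)
  proof (induction u)
    case (WVar i)
    then have "As ! i \<in> mobj M" using As by auto
    then show ?case by simp
  qed (use As in simp_all)
  have "wpsi (S_arr (id_smf M)) n = wpsi (id_wmor WkP (S_obj M)) n" for n
  proof (rule extensionalityI)
    show "wpsi (S_arr (id_smf M)) n \<in> extensional (level n)" "wpsi (id_wmor WkP (S_obj M)) n \<in> extensional (level n)"
      by (simp_all add: S_arr_def id_wmor_def)
    fix x assume x: "x \<in> level n"
    show "wpsi (S_arr (id_smf M)) n x = wpsi (id_wmor WkP (S_obj M)) n x"
    proof (rule extensionalityI)
      show "wpsi (S_arr (id_smf M)) n x \<in> extensional (Obj (power_cat (mcat M) n))"
        "wpsi (id_wmor WkP (S_obj M)) n x \<in> extensional (Obj (power_cat (mcat M) n))"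
        using x by (cases x, simp add: S_arr_def id_wmor_def)+
      fix As assume "As \<in> Obj (power_cat (mcat M) n)"
      then have As: "length As = n" "set As \<subseteq> mobj M" by auto
      show "wpsi (S_arr (id_smf M)) n x As = wpsi (id_wmor WkP (S_obj M)) n x As"
        unfolding f.wpsi_S_arr[OF x As]
        using x As \<psi>[OF As(2), of "word_of x"] f.S.FO_interp(1)[OF x As] f.S.op_S_obj(1)[OF x] wvars_word_of[OF x]
        by (simp add: id_wmor_def)
    qed
  qed
  then have "wpsi (S_arr (id_smf M)) = wpsi (id_wmor WkP (S_obj M))" by (rule ext)
  then show ?thesis by (intro wmor.equality) (simp_all add: S_arr_def id_wmor_def)
qed

text \<open>On words the comparison map of a composite is pasted from those of the factors; the
  induction passes a product by naturality of \<open>mF2 m'\<close> at the comparison maps of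
  \<open>m\<close>.\<close>

lemma S_arr_comp:
  assumes m: "weak_symmetric_monoidal_functor m M N" and m': "weak_symmetric_monoidal_functor m' N P"
  shows "S_arr (comp_smf m' m) = comp_wmor WkP (S_arr m') (S_arr m)"
proof -
  interpret f: weak_symmetric_monoidal_functor m M N by fact
  interpret g: weak_symmetric_monoidal_functor m' N P by fact
  interpret h: weak_symmetric_monoidal_functor "comp_smf m' m" M P
    by (rule comp_smf_functor[OF m m'])
  have \<psi>: "word_psi (comp_smf m' m) u As = smA m' (word_psi m u As) \<cdot>\<^bsub>P\<^esub> word_psi m' u (map (smO m) As)"
    if As: "set As \<subseteq> mobj M" and "wvars u \<subseteq> {..<length As}" for u As
    using that(2)
  proof (induction u)
    case (WVar i)
    then have "As ! i \<in> mobj M" "i < length As" using As by auto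
    then show ?case by (simp add: g.F.FA_Ide)
  next
    case WNul
    then show ?case by simp
  next
    case (WBin u v)
    have uv: "wvars u \<subseteq> {..<length As}" "wvars v \<subseteq> {..<length As}" using WBin.prems by auto
    have [simp]: "smO m ` set As \<subseteq> mobj N" using As by auto
    note [simp] = uv As
    let ?As = "map (smO m) As"
    let ?U = "wobj M u As" and ?V = "wobj M v As" and ?u = "word_psi m u As" and ?v = "word_psi m v As"
    let ?k = "word_psi m' u ?As \<odot>\<^bsub>P\<^esub> word_psi m' v ?As"
    have "word_psi (comp_smf m' m) (WBin u v) As =
      smA m' (mF2 m (?U, ?V)) \<cdot>\<^bsub>P\<^esub> mF2 m' (smO m ?U, smO m ?V) \<cdot>\<^bsub>P\<^esub> (smA m' ?u \<odot>\<^bsub>P\<^esub> smA m' ?v) \<cdot>\<^bsub>P\<^esub> ?k"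
      using WBin.IH by simp
    also have "\<dots> = smA m' (mF2 m (?U, ?V)) \<cdot>\<^bsub>P\<^esub> smA m' (?u \<odot>\<^bsub>N\<^esub> ?v) \<cdot>\<^bsub>P\<^esub>
        mF2 m' (wobj N u ?As, wobj N v ?As) \<cdot>\<^bsub>P\<^esub> ?k"
    proof -
      have "mF2 m' (smO m ?U, smO m ?V) \<cdot>\<^bsub>P\<^esub> (smA m' ?u \<odot>\<^bsub>P\<^esub> smA m' ?v) \<cdot>\<^bsub>P\<^esub> ?k =
        smA m' (?u \<odot>\<^bsub>N\<^esub> ?v) \<cdot>\<^bsub>P\<^esub> mF2 m' (wobj N u ?As, wobj N v ?As) \<cdot>\<^bsub>P\<^esub> ?k"
        using g.F2_natural[of ?u ?v] by (intro g.T.reassoc) simp_all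
      then show ?thesis by (simp only:)
    qed
    also have "\<dots> = smA m' (word_psi m (WBin u v) As) \<cdot>\<^bsub>P\<^esub> word_psi m' (WBin u v) ?As"
      by (simp add: g.F.FA_Cmp')
    finally show ?case .
  qed
  let ?c = "comp_wmor WkP (S_arr m') (S_arr m)"
  have "wpsi (S_arr (comp_smf m' m)) n = wpsi ?c n" for n
  proof (rule extensionalityI)
    show "wpsi (S_arr (comp_smf m' m)) n \<in> extensional (level n)" "wpsi ?c n \<in> extensional (level n)"
      by (simp_all add: S_arr_def comp_wmor_def)
    fix x assume x: "x \<in> level n"
    show "wpsi (S_arr (comp_smf m' m)) n x = wpsi ?c n x"
    proof (rule extensionalityI)
      show "wpsi (S_arr (comp_smf m' m)) n x \<in> extensional (Obj (power_cat (mcat M) n))"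
        "wpsi ?c n x \<in> extensional (Obj (power_cat (mcat M) n))"
        using x by (cases x, simp add: S_arr_def comp_wmor_def)+
      fix As assume "As \<in> Obj (power_cat (mcat M) n)"
      then have As: "length As = n" "set As \<subseteq> mobj M" by auto
      have FAs: "length (map (smO m) As) = n" "set (map (smO m) As) \<subseteq> mobj N" using As by auto
      show "wpsi (S_arr (comp_smf m' m)) n x As = wpsi ?c n x As"
        unfolding h.wpsi_S_arr[OF x As]
        using x As \<psi>[OF As(2), of "word_of x"] f.wpsi_S_arr[OF x As] g.wpsi_S_arr[OF x FAs] wvars_word_of[OF x]
        by (simp add: comp_wmor_def)
    qed
  qed
  then have "wpsi (S_arr (comp_smf m' m)) = wpsi ?c" by (rule ext)
  then show ?thesis by (intro wmor.equality) (simp_all add: comp_wmor_def)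
qed

lemma WkPCat_simps [simp]:
  "Obj WkPCat = {X. algebra WkP X}"
  "Arr WkPCat = {m. weak_morphism WkP m}"
  "weak_morphism WkP m \<Longrightarrow> Dom WkPCat m = wsrc m"
  "weak_morphism WkP m \<Longrightarrow> Cod WkPCat m = wtgt m"
  "algebra WkP X \<Longrightarrow> Ide WkPCat X = id_wmor WkP X"
  "weak_morphism WkP m' \<Longrightarrow> weak_morphism WkP m \<Longrightarrow> wsrc m' = wtgt m \<Longrightarrow>
    Cmp WkPCat m' m = comp_wmor WkP m' m"
  by (simp_all add: WkPCat_def Weak_Alg_def)

text \<open>Preservation of sources, targets, identities and composites is checked for S. As R
  inverts S on objects and arrows, its functoriality and the category axioms of
  \<open>WkPCat\<close> follow by transport along S.\<close>

theorem theorem4p6p12: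
  shows "isomorphism_of_categories
    (SMC :: (('o, 'a) smc, ('o, 'a) smf) cat)
    (WkPCat :: (('o, 'a) wkp_alg, ('o, 'a) wkp_mor) cat)
    S_functor R_functor"
proof (rule isomorphism_of_categoriesI)
  have S_obj: "algebra WkP (S_obj M)" "R_obj (S_obj M) = M"
    if "symmetric_monoidal_category M" for M :: "('o, 'a) smc"
    using that symmetric_monoidal_category.S_obj_algebra symmetric_monoidal_category.R_S_obj by blast+
  have S_arr: "weak_morphism WkP (S_arr m)" "R_arr (S_arr m) = m"
    "wsrc (S_arr m) = S_obj (msrc m)" "wtgt (S_arr m) = S_obj (mtgt m)"
    if "is_smf m" for m :: "('o, 'a) smf"
    using that weak_symmetric_monoidal_functor.S_arr_weak_morphism weak_symmetric_monoidal_functor.R_S_arr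
      weak_symmetric_monoidal_functor.S_arr_simps by blast+
  have R_obj: "symmetric_monoidal_category (R_obj X)" "S_obj (R_obj X) = X"
    if "algebra WkP X" for X :: "('o, 'a) wkp_alg"
    using that wk_algebra.R_obj_smc wk_algebra.S_R_obj by (auto simp: wk_algebra_def)
  have R_arr: "is_smf (R_arr m)" "S_arr (R_arr m) = m"
    if "weak_morphism WkP m" for m :: "('o, 'a) wkp_mor"
  proof -
    interpret wk_morphism m by (rule wk_morphism.intro[OF that])
    show "is_smf (R_arr m)" "S_arr (R_arr m) = m"
      using R_arr_smf S_R_arr by simp_all
  qed
  have st: "symmetric_monoidal_category (msrc m)" "symmetric_monoidal_category (mtgt m)" if "is_smf m" for m :: "('o, 'a) smf"
    using that by (simp_all add: weak_symmetric_monoidal_functor_def)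
  have S_fun: "FO S_functor M = S_obj M" if "symmetric_monoidal_category M" for M :: "('o, 'a) smc"
    using that by (simp add: S_functor_def)
  have S_fun': "FA S_functor m = S_arr m" if "is_smf m" for m :: "('o, 'a) smf"
    using that by (simp add: S_functor_def)
  have R_fun: "FO R_functor X = R_obj X" if "algebra WkP X" for X :: "('o, 'a) wkp_alg"
    using that by (simp add: R_functor_def)
  have R_fun': "FA R_functor m = R_arr m" if "weak_morphism WkP m" for m :: "('o, 'a) wkp_mor"
    using that by (simp add: R_functor_def)
  show "category (SMC :: (('o, 'a) smc, ('o, 'a) smf) cat)" by (rule SMC_category)
  show "FO S_functor \<in> Obj SMC \<rightarrow>\<^sub>E Obj (WkPCat :: (('o, 'a) wkp_alg, ('o, 'a) wkp_mor) cat)"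
    using S_obj(1) by (auto simp: S_functor_def)
  show "FA S_functor \<in> Arr SMC \<rightarrow>\<^sub>E Arr (WkPCat :: (('o, 'a) wkp_alg, ('o, 'a) wkp_mor) cat)"
    using S_arr(1) by (auto simp: S_functor_def)
  show "FO R_functor \<in> Obj WkPCat \<rightarrow>\<^sub>E Obj (SMC :: (('o, 'a) smc, ('o, 'a) smf) cat)"
    using R_obj(1) by (auto simp: R_functor_def)
  show "FA R_functor \<in> Arr WkPCat \<rightarrow>\<^sub>E Arr (SMC :: (('o, 'a) smc, ('o, 'a) smf) cat)"
    using R_arr(1) by (auto simp: R_functor_def)
  show "FO R_functor (FO S_functor M) = M" if "M \<in> Obj SMC" for M :: "('o, 'a) smc"
    using that S_obj by (simp add: S_fun R_fun)
  show "FA R_functor (FA S_functor m) = m" if "m \<in> Arr SMC" for m :: "('o, 'a) smf"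
    using that S_arr(1,2) by (simp add: S_fun' R_fun')
  show "FO S_functor (FO R_functor X) = X" if "X \<in> Obj WkPCat" for X :: "('o, 'a) wkp_alg"
    using that R_obj by (simp add: S_fun R_fun)
  show "FA S_functor (FA R_functor m) = m" if "m \<in> Arr WkPCat" for m :: "('o, 'a) wkp_mor"
    using that R_arr by (simp add: S_fun' R_fun')
  show "Dom (WkPCat :: (('o, 'a) wkp_alg, ('o, 'a) wkp_mor) cat) \<in> extensional (Arr WkPCat)"
    "Cod (WkPCat :: (('o, 'a) wkp_alg, ('o, 'a) wkp_mor) cat) \<in> extensional (Arr WkPCat)"
    "Ide (WkPCat :: (('o, 'a) wkp_alg, ('o, 'a) wkp_mor) cat) \<in> extensional (Obj WkPCat)"
    by (simp_all add: WkPCat_def Weak_Alg_def)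
  show "Dom WkPCat (FA S_functor m) = FO S_functor (Dom SMC m)" "Cod WkPCat (FA S_functor m) = FO S_functor (Cod SMC m)"
    if "m \<in> Arr SMC" for m :: "('o, 'a) smf"
    using that S_arr(1,3,4) st by (simp_all add: S_fun S_fun')
  show "Ide WkPCat (FO S_functor M) = FA S_functor (Ide SMC M)" if "M \<in> Obj SMC" for M :: "('o, 'a) smc"
    using that S_obj(1) id_smf_functor[of M] by (simp add: S_fun S_fun' S_arr_id)
  show "Cmp WkPCat (FA S_functor g) (FA S_functor f) = FA S_functor (Cmp SMC g f)" if "composable SMC g f" for g f :: "('o, 'a) smf"
  proof -
    have gf: "is_smf g" "is_smf f" "msrc g = mtgt f" using that unfolding composable_SMC by blast+
    have "weak_symmetric_monoidal_functor (comp_smf g f) (msrc f) (mtgt g)" "S_arr (comp_smf g f) = comp_wmor WkP (S_arr g) (S_arr f)"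
      using comp_smf_functor[of f "msrc f" "mtgt f" g "mtgt g"] S_arr_comp[of f "msrc f" "mtgt f" g "mtgt g"] gf by simp_all
    then show ?thesis
      using gf S_arr(1)[OF gf(1)] S_arr(1)[OF gf(2)] S_arr(3)[OF gf(1)] S_arr(4)[OF gf(2)] by (simp add: S_fun')
  qed
  show "Cmp WkPCat g f = undefined" if "\<not> composable WkPCat g f" for g f :: "('o, 'a) wkp_mor"
  proof -
    have "\<not> (weak_morphism WkP g \<and> weak_morphism WkP f \<and> wsrc g = wtgt f)"
      using that by (auto simp: composable_def)
    then show ?thesis by (auto simp: WkPCat_def Weak_Alg_def)
  qed
qed

end
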